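(* Let $\alpha$ be a (finite) measure on $(\mathbb{R},\mathscr{B}(\mathbb{R}))$ with a bounded support $S\subset\mathbb{R}$, and, for any $t$ in $\mathbb{R}$, let $S_t$ be the closure of the convex hull of $\{itx:x\in S\}$. Then, with $a=\alpha(S)>0$, $$\int_{\mathbb{P}}e^{it\varphi(I)}\,\mathscr{D}_\alpha(d\varphi)=\frac{\Gamma(a)}{2\pi i}\,\mathrm{PV}\!\int_{\gamma-i\infty}^{\gamma+i\infty}e^w\frac{1}{w^a}\exp\left\{-\int_{\mathbb{R}}\log\left(1-\frac{itx}{w}\right)\alpha(dx)\right\}dw$$ holds for every $\gamma>0$. Moreover, if $\mathfrak{C}_t$ is any contour consisting of a simple loop, beginning and ending at $-\infty$, and encircling $S_t$ in such a way that $S_t\cap\mathfrak{C}_t=\varnothing$, then $$\int_{\mathbb{P}}e^{it\varphi(I)}\,\mathscr{D}_\alpha(d\varphi)=\frac{\Gamma(a)}{2\pi i}\int_{\mathfrak{C}_t}\frac{e^w}{w^a}\exp\left\{-\int_{\mathbb{R}}\log\left(1-\frac{itx}{w}\right)\alpha(dx)\right\}dw.$$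
   Context: $\mathbb{P}$ is the space of all probability measures on $(\mathbb{R},\mathscr{B}(\mathbb{R}))$, where $\mathscr{B}(\mathbb{R})$ is the Borel class on $\mathbb{R}$, endowed with the topology of weak convergence and the corresponding Borel $\sigma$-algebra. $\mathscr{D}_\alpha$ is the probability distribution on $\mathbb{P}$ of the (functional) Dirichlet process with parameter $\alpha$: under $\mathscr{D}_\alpha$, for every finite measurable partition $C_1,\ldots,C_n,C_{n+1}$ of $\mathbb{R}$, the random vector $(\varphi(C_1),\ldots,\varphi(C_n))$ has the Dirichlet distribution with parameter $(\alpha(C_1),\ldots,\alpha(C_n),\alpha(C_{n+1}))$. $I$ is the identity map on $\mathbb{R}$ and $\varphi(I)=\int_{\mathbb{R}}x\,\varphi(dx)$. $\log$ is the principal determination of the logarithm, $\log z=\log|z|+i\arg(z)$ with $\arg(z)\in(-\pi,\pi]$, and $w^a=\exp(a\log w)$. $\mathrm{PV}\int$ denotes the principal value integral, i.e. $\mathrm{PV}\int_{\gamma-i\infty}^{\gamma+i\infty}=\lim_{R\to+\infty}\int_{\gamma-iR}^{\gamma+iR}$.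
   Formalization: In the second formula, if a is not an integer, the contour must also avoid the half-line (-∞,0] and the segments from 0 to itx, x in S, where the principal logarithms jump; otherwise the formula fails, e.g. for α=δ_1/2, t=1 and a loop round i that crosses (0,i). *)

theory Defs
  imports "HOL-Probability.Probability" "HOL-Complex_Analysis.Complex_Analysis"
begin

definition prob_measures :: "real measure set" where
  "prob_measures = {\<phi>. real_distribution \<phi>}"

text \<open>The weak topology is the coarsest topology on \<^const>\<open>prob_measures\<close> making all the maps
  \<open>\<phi> \<mapsto> \<integral> f d\<phi>\<close>, \<open>f\<close> bounded and continuous, continuous.\<close>

definition weak_topology :: "real measure topology" where
  "weak_topology = topology_generated_by
     {{\<phi> \<in> prob_measures. (\<integral>x. f x \<partial>\<phi>) \<in> U} | (f :: real \<Rightarrow> real) U.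
        continuous_on UNIV f \<and> bounded (range f) \<and> open U}"

definition weak_borel :: "real measure measure" where
  "weak_borel = sigma prob_measures {U. openin weak_topology U}"

text \<open>Dirichlet distributions are needed for parameters some of which may vanish, since a cell of a
  partition may be a null set. They are therefore defined by normalising independent
  gamma variables, with the convention that the gamma distribution of shape \<open>0\<close> is the unit mass
  at \<open>0\<close>. Parameters are indexed by \<open>{1..n + 1}\<close>, and the vector consists of the first \<open>n\<close>
  coordinates only.\<close>

definition gamma_distribution :: "real \<Rightarrow> real measure" where
  "gamma_distribution s =
     (if s = 0 then return borel 0
      else density lborel
        (\<lambda>x. ennreal (if x > 0 then x powr (s - 1) * exp (- x) / Gamma s else 0)))"

definition dirichlet_distribution :: "nat \<Rightarrow> (nat \<Rightarrow> real) \<Rightarrow> (nat \<Rightarrow> real) measure" where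
  "dirichlet_distribution n p =
     distr (PiM {1..n + 1} (\<lambda>i. gamma_distribution (p i))) (PiM {1..n} (\<lambda>_. borel))
       (\<lambda>z. \<lambda>i\<in>{1..n}. z i / (\<Sum>j\<in>{1..n + 1}. z j))"

text \<open>\<open>D\<close> is the law, on the space of probability measures, of the Dirichlet process with
  parameter \<open>\<alpha>\<close>.\<close>

definition dirichlet_process_law :: "real measure \<Rightarrow> real measure measure \<Rightarrow> bool" where
  "dirichlet_process_law \<alpha> D \<longleftrightarrow>
     prob_space D \<and> sets D = sets weak_borel \<and>
     (\<forall>n C. (\<forall>i\<in>{1..n + 1}. C i \<in> sets borel) \<and> disjoint_family_on C {1..n + 1} \<and>
            (\<Union>i\<in>{1..n + 1}. C i) = UNIV \<longrightarrow>
        distr D (PiM {1..n} (\<lambda>_. borel)) (\<lambda>\<phi>. \<lambda>i\<in>{1..n}. measure \<phi> (C i)) =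
        dirichlet_distribution n (\<lambda>i. measure \<alpha> (C i)))"

definition measure_support :: "real measure \<Rightarrow> real set" where
  "measure_support \<alpha> = {x. \<forall>U. open U \<and> x \<in> U \<longrightarrow> emeasure \<alpha> U > 0}"

definition dirichlet_mean_integrand :: "real measure \<Rightarrow> real \<Rightarrow> real \<Rightarrow> complex \<Rightarrow> complex" where
  "dirichlet_mean_integrand \<alpha> a t w =
     exp w * (1 / w powr of_real a) *
     exp (- (\<integral>x. Ln (1 - \<i> * of_real t * of_real x / w) \<partial>\<alpha>))"

definition has_pv_line_integral :: "(complex \<Rightarrow> complex) \<Rightarrow> complex \<Rightarrow> real \<Rightarrow> bool" where
  "has_pv_line_integral f L \<gamma> \<longleftrightarrow>
     (\<forall>R>0. f contour_integrable_on linepath (Complex \<gamma> (- R)) (Complex \<gamma> R)) \<and>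
     ((\<lambda>R. contour_integral (linepath (Complex \<gamma> (- R)) (Complex \<gamma> R)) f) \<longlongrightarrow> L) at_top"

text \<open>A contour from \<open>-\<infinity>\<close> to \<open>-\<infinity>\<close> is parametrised by the whole real line; \<open>subpath p q c\<close> is
  its piece between the parameters \<open>p\<close> and \<open>q\<close>.\<close>

definition simple_loop_from_minus_infinity :: "(real \<Rightarrow> complex) \<Rightarrow> bool" where
  "simple_loop_from_minus_infinity c \<longleftrightarrow>
     inj c \<and> (\<forall>p q. p < q \<longrightarrow> valid_path (subpath p q c)) \<and>
     filterlim (\<lambda>s. Re (c s)) at_bot at_bot \<and> filterlim (\<lambda>s. Re (c s)) at_bot at_top"

text \<open>Such a contour encircles \<open>z\<close> (in the positive sense) if it has winding number \<open>1\<close> about \<open>z\<close>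
  once its two ends have been joined by a segment far to the left.\<close>

definition loop_encircles :: "(real \<Rightarrow> complex) \<Rightarrow> complex \<Rightarrow> bool" where
  "loop_encircles c z \<longleftrightarrow>
     (\<forall>\<^sub>F (p, q) in at_bot \<times>\<^sub>F at_top.
        winding_number (subpath p q c +++ linepath (c q) (c p)) z = 1)"

definition has_loop_integral :: "(complex \<Rightarrow> complex) \<Rightarrow> complex \<Rightarrow> (real \<Rightarrow> complex) \<Rightarrow> bool" where
  "has_loop_integral f L c \<longleftrightarrow>
     (\<forall>p q. p < q \<longrightarrow> f contour_integrable_on subpath p q c) \<and>
     ((\<lambda>(p, q). contour_integral (subpath p q c) f) \<longlongrightarrow> L) (at_bot \<times>\<^sub>F at_top)"

text \<open>The points \<open>w\<close> at which \<open>w\<close>, or \<open>1 - itx/w\<close> for some \<open>x \<in> S\<close>, lies on the branch cut of the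
  principal logarithm (or is not defined). If \<open>a\<close> is not an integer, the integrand jumps across this
  set (at points outside the closed convex hull of \<open>{itx | x \<in> S}\<close>), so an admissible contour has to
  stay off it. If \<open>a\<close> is an integer, there are no such jumps. If the hull contains \<open>0\<close>, the
  negative real axis is the only part of the set that is not already inside the hull.\<close>

definition integrand_cuts :: "real \<Rightarrow> real set \<Rightarrow> complex set" where
  "integrand_cuts t S =
     \<real>\<^sub>\<le>\<^sub>0 \<union> {\<i> * of_real t * of_real x * of_real s | x s. x \<in> S \<and> s \<in> {0..1}}"

end

theory Submission
  imports Defs "HOL-Real_Asymp.Real_Asymp"
begin

text \<open>Write \<open>M\<close> for the mean \<open>\<integral> x d\<phi>\<close> of the random measure \<open>\<phi>\<close>, \<open>a\<close> for the total mass of \<open>\<alpha>\<close>, and \<open>m\<^sub>k\<close> for the moments of \<open>M\<close>.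
  The key identity is a power series form of the Markov-Krein correspondence,
  \<open>exp (- \<integral> log (1 - zx) d\<alpha>) = \<Sum>\<^sub>k pochhammer a k / k! m\<^sub>k z\<^sup>k\<close> for small \<open>z\<close>
  (lemma \<open>generating_function\<close>). For a Dirichlet vector, that is, for independent gamma variables \<open>Z\<^sub>i\<close> divided by their total,
  it expresses that the total is independent of the normalised vector: expand \<open>E exp (z \<Sum> x\<^sub>i Z\<^sub>i) = \<Prod> (1 - z x\<^sub>i)\<^bsup>-a(i)\<^esup>\<close>, where \<open>a(i)\<close> is the shape of \<open>Z\<^sub>i\<close>, in powers of \<open>z\<close>
  and pull the moments \<open>pochhammer a k\<close> of the total out
  (lemma \<open>moments_generating_identity\<close>). The general case follows by discretising \<open>x\<close> on finer and finer grids, and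
  complex \<open>z\<close> are reached by analytic continuation.\<close>

text \<open>With \<open>z = it/w\<close> the integrand becomes \<open>\<Sum>\<^sub>k pochhammer a k / k! m\<^sub>k (it)\<^sup>k e\<^sup>w w\<^bsup>-a-k\<^esup>\<close> for large \<open>|w|\<close>. Hankel's formula
  (theorem \<open>Hankel_vertical\<close>) gives \<open>2 \<pi> i / \<Gamma>(a + k)\<close> as the principal value of \<open>\<integral> e\<^sup>w w\<^bsup>-a-k\<^esup> dw\<close> along a vertical line, and
  \<open>pochhammer a k = \<Gamma>(a + k) / \<Gamma>(a)\<close>. So the sum is \<open>2 \<pi> i / \<Gamma>(a)\<close> times the exponential series
  \<open>\<Sum>\<^sub>k (it)\<^sup>k m\<^sub>k / k! = E e\<^bsup>itM\<^esup>\<close> on a line far to the right, and on every other line in the right half-plane by Cauchy's theorem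
  (theorem \<open>has_pv_line_integral_integrand\<close>).\<close>

text \<open>For a loop, cut off a long piece of it and compare this piece with a path through the same ends whose
  main part is a vertical segment of height \<open>2R\<close> (lemma \<open>loop_integral_eq_reference\<close>). The remaining parts vanish: horizontal segments at
  height \<open>R\<close> as \<open>R\<close> grows, and vertical segments at abscissa \<open>x\<close> as \<open>x\<close> tends to \<open>-\<infinity>\<close>. Cauchy's theorem is
  applied in a domain with connected complement on which the integrand is analytic: the complement of the cuts if \<open>a\<close> is not an integer, and
  the complement of the hull of the support if \<open>a\<close> is one, since then the integrand extends analytically to it
  (lemma \<open>integer_mass_extension\<close>). The loop may approach \<open>-\<infinity>\<close> with wild imaginary parts, so the estimate of
  the vertical segments must not depend on their length; it comes from integration by parts
  (lemma \<open>vertical_segment_bound\<close>).\<close>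

section \<open>Integrals along vertical lines\<close>

abbreviation vline :: "real \<Rightarrow> real \<Rightarrow> real \<Rightarrow> complex" where
  "vline x R \<equiv> linepath (Complex x (- R)) (Complex x R)"

lemma half_plane_convex_open: "convex {w. 0 < Re w}" "open {w. 0 < Re w}"
  by (auto simp: convex_halfspace_Re_gt open_halfspace_Re_gt)

text \<open>On the line \<open>Re w = x \<noteq> 0\<close> the modulus \<open>|w|\<close> is comparable to \<open>1 + |Im w|\<close>, so powers of the latter
  serve as integrable majorants on all vertical lines at once.\<close>

lemma integrable_inverse_power_weight:
  fixes b :: real
  assumes "1 < b"
  shows "integrable lborel (\<lambda>y::real. (1 + \<bar>y\<bar>) powr (- b))"
proof -
  have half: "integrable lborel (\<lambda>y::real. (1 + y) powr (- b) * indicator {0..} y)"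
  proof (rule integrableI_nonneg)
    have "(\<integral>\<^sup>+y. ennreal ((1 + y) powr (- b) * indicator {0..} y) \<partial>lborel) =
          (\<integral>\<^sup>+y. ennreal ((1 + y) powr (- b)) * indicator {0..} y \<partial>lborel)"
      by (intro nn_integral_cong) (auto simp: indicator_def)
    also have "\<dots> = 0 - (1 + 0) powr (1 - b) / (1 - b)"
    proof (rule nn_integral_FTC_atLeast)
      fix y :: real assume "0 \<le> y"
      then show "((\<lambda>y. (1 + y) powr (1 - b) / (1 - b)) has_real_derivative (1 + y) powr (- b)) (at y)"
      proof -
        have "((\<lambda>y. (1 + y) powr (1 - b)) has_real_derivative (1 - b) * (1 + y) powr (1 - b - 1) * 1) (at y)"
          using \<open>0 \<le> y\<close> by (intro DERIV_fun_powr derivative_eq_intros) auto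
        from DERIV_cdivide[OF this, of "1 - b"] show ?thesis using assms by simp
      qed
    next
      have "((\<lambda>y::real. (1 + y) powr (1 - b)) \<longlongrightarrow> 0) at_top"
        using assms by (intro tendsto_neg_powr filterlim_tendsto_add_at_top[OF tendsto_const]) (auto intro: filterlim_ident)
      then show "((\<lambda>y::real. (1 + y) powr (1 - b) / (1 - b)) \<longlongrightarrow> 0) at_top"
        by (rule tendsto_divide_zero)
    qed auto
    also have "\<dots> < \<infinity>" by simp
    finally show "(\<integral>\<^sup>+y. ennreal ((1 + y) powr (- b) * indicator {0..} y) \<partial>lborel) < \<infinity>" .
  qed (auto simp: indicator_def)
  then have "integrable lborel (\<lambda>y. (1 + (0 + (-1) * y)) powr (- b) * indicator {0..} (0 + (-1) * y))"
    by (rule lborel_integrable_real_affine) simp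
  with half have "integrable lborel (\<lambda>y. (1 + y) powr (- b) * indicator {0..} y +
      (1 + (0 + (-1) * y)) powr (- b) * indicator {0..} (0 + (-1) * y))"
    by (rule Bochner_Integration.integrable_add)
  then show ?thesis
    by (rule Bochner_Integration.integrable_bound) (auto simp: indicator_def)
qed

lemma norm_ge_weight:
  assumes "0 < \<delta>" "\<delta> \<le> \<bar>Re w\<bar>"
  shows "min 1 \<delta> / 2 * (1 + \<bar>Im w\<bar>) \<le> cmod w"
proof -
  have "min 1 \<delta> * (1 + \<bar>Im w\<bar>) \<le> \<delta> + \<bar>Im w\<bar>"
    using assms mult_right_mono[of "min 1 \<delta>" 1 "\<bar>Im w\<bar>"] by (auto simp: algebra_simps)
  also have "\<dots> \<le> 2 * cmod w"
    using assms abs_Re_le_cmod[of w] abs_Im_le_cmod[of w] by linarith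
  finally show ?thesis by simp
qed

lemma norm_powr_le_weight:
  assumes "0 < \<delta>" "\<delta> \<le> \<bar>Re w\<bar>" "0 \<le> b"
  shows "cmod w powr (- b) \<le> (min 1 \<delta> / 2) powr (- b) * (1 + \<bar>Im w\<bar>) powr (- b)"
proof -
  have "cmod w powr (- b) \<le> (min 1 \<delta> / 2 * (1 + \<bar>Im w\<bar>)) powr (- b)"
    using assms norm_ge_weight[OF assms(1,2)] by (intro powr_mono2') auto
  also have "\<dots> = (min 1 \<delta> / 2) powr (- b) * (1 + \<bar>Im w\<bar>) powr (- b)"
    by (rule powr_mult)
  finally show ?thesis .
qed

lemma contour_integral_vline:
  assumes "0 < R" "continuous_on UNIV (\<lambda>y. f (Complex x y))"
  shows "f contour_integrable_on vline x R"
    and "contour_integral (vline x R) f = \<i> * (LBINT y. indicator {-R..R} y *\<^sub>R f (Complex x y))"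
proof -
  have c: "continuous_on {-R..R} (\<lambda>y. f (Complex x y))"
    using assms(2) continuous_on_subset by blast
  then have "set_integrable lborel {-R..R} (\<lambda>y. f (Complex x y))"
    unfolding set_integrable_def by (intro borel_integrable_compact) auto
  then have "((\<lambda>y. f (Complex x y)) has_integral (LBINT y:{-R..R}. f (Complex x y))) {-R..R}"
    using set_borel_integral_eq_integral[of "{-R..R}" "\<lambda>y. f (Complex x y)"] by (simp add: has_integral_integral[symmetric])
  then have "(f has_contour_integral (\<i> * (LBINT y:{-R..R}. f (Complex x y)))) (vline x R)"
    using assms(1)
    by (subst has_contour_integral_linepath_same_Re_iff[where c = x and a = "-R" and b = R]) (auto simp: mult.assoc[symmetric])
  then show "f contour_integrable_on vline x R"
    and "contour_integral (vline x R) f = \<i> * (LBINT y. indicator {-R..R} y *\<^sub>R f (Complex x y))"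
    by (auto simp: contour_integrable_on_def contour_integral_unique set_lebesgue_integral_def)
qed

lemma contour_integral_vline_tendsto:
  assumes "continuous_on UNIV (\<lambda>y. f (Complex x y))" "integrable lborel (\<lambda>y. f (Complex x y))"
  shows "((\<lambda>R. contour_integral (vline x R) f) \<longlongrightarrow> \<i> * (LBINT y. f (Complex x y))) at_top"
proof -
  have m: "(\<lambda>y. f (Complex x y)) \<in> borel_measurable borel"
    using assms(1) by (rule borel_measurable_continuous_onI)
  have "((\<lambda>R. LBINT y. indicator {-R..R} y *\<^sub>R f (Complex x y)) \<longlongrightarrow> (LBINT y. f (Complex x y))) at_top"
  proof (rule integral_dominated_convergence_at_top)
    show "integrable lborel (\<lambda>y. norm (f (Complex x y)))" using assms(2) by simp
    show "AE y in lborel. ((\<lambda>R. indicator {-R..R} y *\<^sub>R f (Complex x y)) \<longlongrightarrow> f (Complex x y)) at_top"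
    proof (rule AE_I2, rule tendsto_eventually)
      fix y
      show "\<forall>\<^sub>F R in at_top. indicator {-R..R} y *\<^sub>R f (Complex x y) = f (Complex x y)"
        using eventually_ge_at_top[of "\<bar>y\<bar>"] by eventually_elim (auto simp: indicator_def)
    qed
    show "\<forall>\<^sub>F R in at_top. AE y in lborel. norm (indicator {-R..R} y *\<^sub>R f (Complex x y)) \<le> norm (f (Complex x y))"
      by (auto simp: indicator_def)
  qed (use m in measurable)
  then have "((\<lambda>R. \<i> * (LBINT y. indicator {-R..R} y *\<^sub>R f (Complex x y))) \<longlongrightarrow> \<i> * (LBINT y. f (Complex x y))) at_top"
    by (intro tendsto_intros)
  then show ?thesis
    by (rule Lim_transform_eventually)
      (use eventually_gt_at_top[of 0] in eventually_elim, use assms contour_integral_vline(2) in auto)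
qed

text \<open>By Cauchy's theorem the integrals along the two lines differ by two horizontal segments of fixed
  length, on which the integrand tends to \<open>0\<close>.\<close>

lemma vertical_integral_shift:
  assumes hol: "f holomorphic_on {w. 0 < Re w}" and \<gamma>: "0 < \<gamma>" "0 < \<gamma>'"
    and bound: "\<And>w. min \<gamma> \<gamma>' \<le> Re w \<Longrightarrow> Re w \<le> max \<gamma> \<gamma>' \<Longrightarrow> cmod (f w) \<le> e \<bar>Im w\<bar>"
    and e: "(e \<longlongrightarrow> 0) at_top"
    and lim: "((\<lambda>R. contour_integral (vline \<gamma> R) f) \<longlongrightarrow> L) at_top"
  shows "((\<lambda>R. contour_integral (vline \<gamma>' R) f) \<longlongrightarrow> L) at_top"
proof -
  obtain g where g: "\<And>w. 0 < Re w \<Longrightarrow> (g has_field_derivative f w) (at w within {w. 0 < Re w})"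
    using holomorphic_convex_primitive'[OF half_plane_convex_open hol] by auto
  have prim: "(f has_contour_integral (g v - g u)) (linepath u v)" if "0 < Re u" "0 < Re v" for u v
  proof -
    have "path_image (linepath u v) \<subseteq> {w. 0 < Re w}"
      using that half_plane_convex_open(1) by (simp add: closed_segment_subset)
    then have "(f has_contour_integral (g (pathfinish (linepath u v)) - g (pathstart (linepath u v)))) (linepath u v)"
      using g by (intro contour_integral_primitive[where S = "{w. 0 < Re w}"]) auto
    then show ?thesis by simp
  qed
  have step: "cmod (g (Complex \<gamma>' y) - g (Complex \<gamma> y)) \<le> e \<bar>y\<bar> * \<bar>\<gamma>' - \<gamma>\<bar>" for y
  proof -
    have seg: "Im w = y \<and> min \<gamma> \<gamma>' \<le> Re w \<and> Re w \<le> max \<gamma> \<gamma>'"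
      if "w \<in> closed_segment (Complex \<gamma> y) (Complex \<gamma>' y)" for w
      using that \<gamma> by (auto simp: closed_segment_same_Im closed_segment_eq_real_ivl split: if_splits)
    have "cmod (f (Complex \<gamma> y)) \<le> e \<bar>y\<bar>" using bound[of "Complex \<gamma> y"] by simp
    then have "0 \<le> e \<bar>y\<bar>" using norm_ge_zero order_trans by blast
    moreover have "cmod (f w) \<le> e \<bar>y\<bar>" if "w \<in> closed_segment (Complex \<gamma> y) (Complex \<gamma>' y)" for w
      using bound[of w] seg[OF that] by simp
    ultimately have "cmod (g (Complex \<gamma>' y) - g (Complex \<gamma> y)) \<le> e \<bar>y\<bar> * cmod (Complex \<gamma>' y - Complex \<gamma> y)"
      using \<gamma> by (intro has_contour_integral_bound_linepath[OF prim]) auto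
    also have "cmod (Complex \<gamma>' y - Complex \<gamma> y) = \<bar>\<gamma>' - \<gamma>\<bar>"
      by (simp add: cmod_def)
    finally show ?thesis .
  qed
  have zero: "((\<lambda>R. contour_integral (vline \<gamma>' R) f - contour_integral (vline \<gamma> R) f) \<longlongrightarrow> 0) at_top"
  proof (rule Lim_null_comparison)
    have "norm (contour_integral (vline \<gamma>' R) f - contour_integral (vline \<gamma> R) f) \<le> 2 * e R * \<bar>\<gamma>' - \<gamma>\<bar>"
      if "0 \<le> R" for R
    proof -
      have "contour_integral (vline \<gamma>' R) f - contour_integral (vline \<gamma> R) f =
        (g (Complex \<gamma>' R) - g (Complex \<gamma> R)) - (g (Complex \<gamma>' (-R)) - g (Complex \<gamma> (-R)))"
        using \<gamma> by (simp add: contour_integral_unique[OF prim])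
      also have "norm \<dots> \<le> e \<bar>R\<bar> * \<bar>\<gamma>' - \<gamma>\<bar> + e \<bar>-R\<bar> * \<bar>\<gamma>' - \<gamma>\<bar>"
        by (rule norm_triangle_le_diff[OF add_mono[OF step step]])
      finally show ?thesis using that by simp
    qed
    then show "\<forall>\<^sub>F R in at_top. norm (contour_integral (vline \<gamma>' R) f - contour_integral (vline \<gamma> R) f) \<le> 2 * e R * \<bar>\<gamma>' - \<gamma>\<bar>"
      using eventually_ge_at_top[of "0::real"] by (rule eventually_mono[rotated]) auto
    show "((\<lambda>R. 2 * e R * \<bar>\<gamma>' - \<gamma>\<bar>) \<longlongrightarrow> 0) at_top"
      using e by (auto intro!: tendsto_eq_intros)
  qed
  show ?thesis using tendsto_add[OF zero lim] by simp
qed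

section \<open>Hankel's integral for the reciprocal gamma function\<close>

lemma Laplace_exp_integral:
  assumes "0 < Re s"
  shows "integrable lborel (\<lambda>x::real. indicator {0<..} x *\<^sub>R exp (- (of_real x * s)))"
    and "(LBINT x. indicator {0<..} x *\<^sub>R exp (- (of_real x * s))) = 1 / s"
proof -
  have s: "s \<noteq> 0" using assms by auto
  have ni: "(\<integral>\<^sup>+x. ennreal (exp (- (x * Re s))) * indicator {0..} x \<partial>lborel) = 0 - (- exp (- (0 * Re s)) / Re s)"
  proof (rule nn_integral_FTC_atLeast)
    show "((\<lambda>x. - exp (- (x * Re s)) / Re s) has_real_derivative exp (- (x * Re s))) (at x)" for x
      using assms by (auto intro!: derivative_eq_intros)
    have "filterlim (\<lambda>x. - (x * Re s)) at_bot at_top"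
      using assms by (auto simp: filterlim_uminus_at_bot intro!: filterlim_at_top_mult_tendsto_pos filterlim_ident)
    then have "((\<lambda>x. exp (- (x * Re s))) \<longlongrightarrow> 0) at_top"
      by (rule filterlim_compose[OF exp_at_bot])
    from tendsto_divide_zero[OF this, of "- Re s"]
    show "((\<lambda>x. - exp (- (x * Re s)) / Re s) \<longlongrightarrow> 0) at_top"
      by simp
  qed auto
  have "(\<integral>\<^sup>+x. ennreal (norm (indicator {0<..} x *\<^sub>R exp (- (of_real x * s)))) \<partial>lborel)
        \<le> (\<integral>\<^sup>+x. ennreal (exp (- (x * Re s))) * indicator {0..} x \<partial>lborel)"
    by (intro nn_integral_mono) (auto simp: indicator_def)
  also have "\<dots> < \<infinity>" unfolding ni by simp
  finally show int: "integrable lborel (\<lambda>x::real. indicator {0<..} x *\<^sub>R exp (- (of_real x * s)))"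
    by (intro integrableI_bounded) auto
  have "(LBINT x=0..\<infinity>. exp (- (of_real x * s))) = 0 - (- exp (- (of_real 0 * s)) / s)"
  proof (rule interval_integral_FTC_integrable)
    show "((\<lambda>x. - exp (- (of_real x * s)) / s) has_vector_derivative exp (- (of_real x * s))) (at x)" for x
      using s by (auto intro!: derivative_eq_intros has_vector_derivative_real_field)
    show "set_integrable lborel (einterval 0 \<infinity>) (\<lambda>x. exp (- (of_real x * s)))"
      using int by (simp add: set_integrable_def einterval_def greaterThan_def[symmetric] zero_ereal_def)
    show "(((\<lambda>x. - exp (- (of_real x * s)) / s) \<circ> real_of_ereal) \<longlongrightarrow> - exp (- (of_real 0 * s)) / s) (at_right 0)"
      unfolding zero_ereal_def by (subst ereal_tendsto_simps) (use s in \<open>auto intro!: tendsto_eq_intros\<close>)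
    have "filterlim (\<lambda>x. - (x * Re s)) at_bot at_top"
      using assms by (auto simp: filterlim_uminus_at_bot intro!: filterlim_at_top_mult_tendsto_pos filterlim_ident)
    then have "((\<lambda>x. exp (- (x * Re s))) \<longlongrightarrow> 0) at_top"
      by (rule filterlim_compose[OF exp_at_bot])
    then have "((\<lambda>x. exp (- (of_real x * s))) \<longlongrightarrow> 0) at_top"
      by (subst tendsto_norm_zero_iff[symmetric]) simp
    from tendsto_divide_zero[OF this, of "- s"]
    have "((\<lambda>x. - exp (- (of_real x * s)) / s) \<longlongrightarrow> 0) at_top"
      by simp
    then show "(((\<lambda>x. - exp (- (of_real x * s)) / s) \<circ> real_of_ereal) \<longlongrightarrow> 0) (at_left \<infinity>)"
      by (simp add: ereal_tendsto_simps)
  qed (auto simp: zero_ereal_def)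
  then show "(LBINT x. indicator {0<..} x *\<^sub>R exp (- (of_real x * s))) = 1 / s"
    by (simp add: interval_lebesgue_integral_def set_lebesgue_integral_def einterval_def greaterThan_def[symmetric] zero_ereal_def)
qed

lemma Re_pos_notin_nonpos_Reals: "0 < Re w \<Longrightarrow> w \<notin> \<real>\<^sub>\<le>\<^sub>0"
  by (auto simp: complex_nonpos_Reals_iff)

lemma continuous_on_Complex [continuous_intros]:
  "continuous_on A f \<Longrightarrow> continuous_on A g \<Longrightarrow> continuous_on A (\<lambda>x. Complex (f x) (g x))"
  by (simp add: Complex_eq continuous_intros)

lemma vertical_line_power:
  assumes "1 < b" "0 < x"
  shows "continuous_on UNIV (\<lambda>y. Complex x y powr (- of_real b))"
    and "integrable lborel (\<lambda>y. Complex x y powr (- of_real b))"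
proof -
  show c: "continuous_on UNIV (\<lambda>y. Complex x y powr (- of_real b))"
    using assms by (intro continuous_intros) (auto simp: complex_eq_iff)
  have n: "norm (Complex x y powr (- of_real b)) \<le> (min 1 x / 2) powr (- b) * (1 + \<bar>y\<bar>) powr (- b)" for y
    using norm_powr_le_weight[of x "Complex x y" b] assms by (simp add: norm_powr_real_powr')
  show "integrable lborel (\<lambda>y. Complex x y powr (- of_real b))"
  proof (rule Bochner_Integration.integrable_bound)
    show "integrable lborel (\<lambda>y. (min 1 x / 2) powr (- b) * (1 + \<bar>y\<bar>) powr (- b))"
      using integrable_inverse_power_weight[OF assms(1)] by simp
    show "AE y in lborel. norm (Complex x y powr (- of_real b)) \<le> norm ((min 1 x / 2) powr (- b) * (1 + \<bar>y\<bar>) powr (- b))"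
      using n by (intro AE_I2) (simp add: order_trans[OF _ abs_ge_self])
  qed (use c in \<open>auto intro: borel_measurable_continuous_onI\<close>)
qed

text \<open>Close the line by a large rectangle to its right. The only pole of \<open>w\<^bsup>-b\<^esup> / (w - 1)\<close> inside it is \<open>1\<close>,
  and the three new sides contribute \<open>O(R\<^bsup>1-b\<^esup>)\<close>.\<close>

lemma vertical_integral_power_cauchy:
  assumes b: "1 < b" and x: "0 < x" "x < 1"
  shows "(LBINT y. Complex x y powr (- of_real b) / (1 - Complex x y)) = 2 * of_real pi"
proof -
  define f where "f w = w powr (- of_real b) / (1 - w)" for w :: complex
  have ne: "1 - Complex x y \<noteq> 0" for y using x by (auto simp: complex_eq_iff)
  have far: "1 - x \<le> cmod (1 - Complex x y)" for y
    using abs_Re_le_cmod[of "1 - Complex x y"] x by auto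
  have c: "continuous_on UNIV (\<lambda>y. f (Complex x y))"
    unfolding f_def using ne by (intro continuous_on_divide vertical_line_power(1)[OF b x(1)] continuous_intros) auto
  have "integrable lborel (\<lambda>y. norm (Complex x y powr (- of_real b)) / (1 - x))"
    using vertical_line_power(2)[OF b x(1)] by simp
  then have i: "integrable lborel (\<lambda>y. f (Complex x y))"
    using c far x by (rule_tac Bochner_Integration.integrable_bound)
      (auto simp: f_def norm_divide intro!: borel_measurable_continuous_onI divide_left_mono mult_pos_pos AE_I2 ne[simplified])
  have lim: "((\<lambda>R. contour_integral (vline x R) f) \<longlongrightarrow> \<i> * (LBINT y. f (Complex x y))) at_top"
    by (rule contour_integral_vline_tendsto[OF c i])
  have bound: "cmod (contour_integral (vline x R) f - 2 * of_real pi * \<i>) \<le> 4 * R powr (1 - b)" if R: "2 \<le> R" for R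
  proof -
    define p where "p w = w powr (- of_real b) / (w - 1)" for w :: complex
    define z1 z2 z3 z4 where "z1 = Complex x (-R)" and "z2 = Complex R (-R)" and "z3 = Complex R R" and "z4 = Complex x R"
    note z_defs = z1_def z2_def z3_def z4_def
    have hol: "(\<lambda>w. w powr (- of_real b)) holomorphic_on {w. 0 < Re w}"
      by (intro holomorphic_intros) (auto simp: complex_nonpos_Reals_iff)
    have img: "path_image (rectpath z1 z3) \<subseteq> {w. 0 < Re w} - {1}"
      using R x by (subst path_image_rectpath) (auto simp: z_defs)
    have w1: "winding_number (rectpath z1 z3) 1 = 1"
      using R x by (intro winding_number_rectpath) (auto simp: z_defs in_box_complex_iff)
    have "(p has_contour_integral (2 * pi * \<i> * winding_number (rectpath z1 z3) 1 * 1 powr (- of_real b))) (rectpath z1 z3)"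
      unfolding p_def using half_plane_convex_open img hol
      by (intro Cauchy_integral_formula_convex_simple[where S = "{w. 0 < Re w}"]) (auto simp: interior_open)
    then have whole: "(p has_contour_integral (2 * pi * \<i>)) (rectpath z1 z3)" by (simp add: w1)
    have rect: "rectpath z1 z3 = linepath z1 z2 +++ linepath z2 z3 +++ linepath z3 z4 +++ linepath z4 z1"
      by (simp add: rectpath_def Let_def z_defs)
    have pc: "continuous_on A p" if "A \<subseteq> {w. 0 < Re w} - {1}" for A
      unfolding p_def using that by (intro continuous_intros) (auto simp: subset_iff)
    note ic = contour_integrable_continuous_linepath[OF pc]
    have sub: "closed_segment z1 z2 \<subseteq> {w. 0 < Re w} - {1}" "closed_segment z2 z3 \<subseteq> {w. 0 < Re w} - {1}"
        "closed_segment z3 z4 \<subseteq> {w. 0 < Re w} - {1}" "closed_segment z4 z1 \<subseteq> {w. 0 < Re w} - {1}"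
      using img unfolding rect by (simp_all add: path_image_join)
    note ics = sub[THEN ic]
    have sum: "2 * pi * \<i> = contour_integral (linepath z1 z2) p + (contour_integral (linepath z2 z3) p +
        (contour_integral (linepath z3 z4) p + contour_integral (linepath z4 z1) p))"
      using contour_integral_unique[OF whole] ics unfolding rect by simp
    have small: "cmod (contour_integral (linepath u v) p) \<le> R powr (- b) * cmod (v - u)"
      if "closed_segment u v \<subseteq> {w. 0 < Re w} - {1}" "\<And>w. w \<in> closed_segment u v \<Longrightarrow> Re w = R \<or> \<bar>Im w\<bar> = R" for u v
    proof (rule contour_integral_bound_linepath[OF ic[OF that(1)]])
      fix w assume w: "w \<in> closed_segment u v"
      then have "R \<le> cmod w" using that(2)[OF w] abs_Re_le_cmod[of w] abs_Im_le_cmod[of w] R by auto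
      moreover have "1 \<le> cmod (w - 1)"
        using that(2)[OF w] abs_Re_le_cmod[of "w - 1"] abs_Im_le_cmod[of "w - 1"] R by auto
      ultimately have "cmod w powr (- b) / cmod (w - 1) \<le> R powr (- b) / 1"
        using R b by (intro frac_le powr_mono2') auto
      then show "cmod (p w) \<le> R powr (- b)"
        by (simp add: p_def norm_divide norm_powr_real_powr')
    qed auto
    have s12: "Im w = - R" if "w \<in> closed_segment z1 z2" for w
      using that by (auto simp: z_defs closed_segment_same_Im)
    have s23: "Re w = R" if "w \<in> closed_segment z2 z3" for w
      using that by (auto simp: z_defs closed_segment_same_Re)
    have s34: "Im w = R" if "w \<in> closed_segment z3 z4" for w
      using that by (auto simp: z_defs closed_segment_same_Im)
    have "cmod (contour_integral (linepath z1 z2) p) \<le> R powr (- b) * cmod (z2 - z1)"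
      by (rule small[OF sub(1)]) (use s12 R in force)
    then have b12: "cmod (contour_integral (linepath z1 z2) p) \<le> R powr (- b) * R"
      by (rule order_trans) (use x R in \<open>auto simp: z_defs cmod_def intro!: mult_left_mono\<close>)
    have "cmod (contour_integral (linepath z3 z4) p) \<le> R powr (- b) * cmod (z4 - z3)"
      by (rule small[OF sub(3)]) (use s34 R in force)
    then have b34: "cmod (contour_integral (linepath z3 z4) p) \<le> R powr (- b) * R"
      by (rule order_trans) (use x R in \<open>auto simp: z_defs cmod_def intro!: mult_left_mono\<close>)
    have "cmod (contour_integral (linepath z2 z3) p) \<le> R powr (- b) * cmod (z3 - z2)"
      by (rule small[OF sub(2)]) (use s23 R in force)
    then have b23: "cmod (contour_integral (linepath z2 z3) p) \<le> R powr (- b) * (2 * R)"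
      by (rule order_trans) (use x R in \<open>auto simp: z_defs cmod_def real_sqrt_mult intro!: mult_left_mono\<close>)
    have "contour_integral (linepath z4 z1) p = - contour_integral (linepath z1 z4) p"
      by (rule contour_integral_reverse_linepath[OF pc[OF sub(4)]])
    also have "\<dots> = contour_integral (vline x R) f"
    proof -
      have "(\<lambda>w. - p w) = f" by (auto simp: f_def p_def fun_eq_iff minus_divide_right)
      moreover have "p contour_integrable_on linepath z1 z4"
        using ic sub(4) by (simp add: closed_segment_commute)
      ultimately show ?thesis
        using contour_integral_neg[of "linepath z1 z4" p] by (simp add: z_defs)
    qed
    finally have "contour_integral (vline x R) f - 2 * of_real pi * \<i> =
        - (contour_integral (linepath z1 z2) p + contour_integral (linepath z2 z3) p + contour_integral (linepath z3 z4) p)"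
      using sum by (simp add: algebra_simps)
    also have "cmod \<dots> \<le> R powr (- b) * R + R powr (- b) * (2 * R) + R powr (- b) * R"
      unfolding norm_minus_cancel by (intro norm_triangle_mono b12 b23 b34)
    also have "\<dots> = 4 * R powr (1 - b)"
      using R by (simp add: powr_diff powr_minus field_simps)
    finally show ?thesis .
  qed
  have "((\<lambda>R. contour_integral (vline x R) f - 2 * of_real pi * \<i>) \<longlongrightarrow> 0) at_top"
  proof (rule Lim_null_comparison)
    show "\<forall>\<^sub>F R in at_top. norm (contour_integral (vline x R) f - 2 * of_real pi * \<i>) \<le> 4 * R powr (1 - b)"
      using eventually_ge_at_top[of 2] by eventually_elim (rule bound)
    show "((\<lambda>R. 4 * R powr (1 - b)) \<longlongrightarrow> 0) at_top"
      using b by (auto intro!: tendsto_mult_right_zero tendsto_neg_powr filterlim_ident)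
  qed
  then have "((\<lambda>R. contour_integral (vline x R) f) \<longlongrightarrow> 2 * of_real pi * \<i>) at_top"
    using Lim_null by blast
  from tendsto_unique[OF _ lim this] have "\<i> * (LBINT y. f (Complex x y)) = 2 * of_real pi * \<i>"
    by simp
  then show ?thesis by (simp add: f_def)
qed

lemma norm_exp_powr_le:
  assumes "0 < \<delta>" "\<delta> \<le> Re w" "Re w \<le> x" "0 \<le> b"
  shows "cmod (exp w * w powr (- of_real b)) \<le> exp x * ((min 1 \<delta> / 2) powr (- b) * (1 + \<bar>Im w\<bar>) powr (- b))"
  using norm_powr_le_weight[of \<delta> w b] assms
  by (auto simp: norm_mult norm_powr_real_powr' intro!: mult_mono)

lemma holomorphic_exp_powr: "(\<lambda>w. exp w * w powr s) holomorphic_on {w. 0 < Re w}"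
  by (intro holomorphic_intros) (auto simp: complex_nonpos_Reals_iff)

lemma weight_tendsto_0: "0 < b \<Longrightarrow> ((\<lambda>y::real. c * (1 + y) powr (- b)) \<longlongrightarrow> 0) at_top"
  by (intro tendsto_mult_right_zero tendsto_neg_powr filterlim_tendsto_add_at_top[OF tendsto_const] filterlim_ident) auto

lemma vertical_integral_exp_powr_shift:
  assumes "0 < b" "0 < \<gamma>" "0 < \<gamma>'"
    and "((\<lambda>R. contour_integral (vline \<gamma> R) (\<lambda>w. exp w * w powr (- of_real b))) \<longlongrightarrow> L) at_top"
  shows "((\<lambda>R. contour_integral (vline \<gamma>' R) (\<lambda>w. exp w * w powr (- of_real b))) \<longlongrightarrow> L) at_top"
proof (rule vertical_integral_shift[OF holomorphic_exp_powr assms(2,3) _ _ assms(4)])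
  let ?c = "exp (max \<gamma> \<gamma>') * (min 1 (min \<gamma> \<gamma>') / 2) powr (- b)"
  show "((\<lambda>y. ?c * (1 + y) powr (- b)) \<longlongrightarrow> 0) at_top"
    by (rule weight_tendsto_0[OF assms(1)])
  show "cmod (exp w * w powr (- of_real b)) \<le> ?c * (1 + \<bar>Im w\<bar>) powr (- b)"
    if "min \<gamma> \<gamma>' \<le> Re w" "Re w \<le> max \<gamma> \<gamma>'" for w
    using norm_exp_powr_le[OF _ that, of b] assms by (simp add: mult.assoc)
qed

lemma vertical_line_exp_powr:
  assumes "1 < b" "0 < x"
  shows "continuous_on UNIV (\<lambda>y. exp (Complex x y) * Complex x y powr (- of_real b))"
    and "integrable lborel (\<lambda>y. exp (Complex x y) * Complex x y powr (- of_real b))"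
proof -
  show c: "continuous_on UNIV (\<lambda>y. exp (Complex x y) * Complex x y powr (- of_real b))"
    by (intro continuous_intros vertical_line_power(1) assms)
  have "integrable lborel (\<lambda>y. exp x * norm (Complex x y powr (- of_real b)))"
    using vertical_line_power(2)[OF assms] by (intro integrable_mult_right integrable_norm)
  then show "integrable lborel (\<lambda>y. exp (Complex x y) * Complex x y powr (- of_real b))"
    by (rule Bochner_Integration.integrable_bound) (use c in \<open>auto simp: norm_mult intro!: borel_measurable_continuous_onI\<close>)
qed

lemma Gamma_integral_lborel:
  assumes "0 < s"
  shows "has_bochner_integral lborel (\<lambda>x::real. indicator {0<..} x * (x powr (s - 1) * exp (- x))) (Gamma s)"
proof (rule has_bochner_integral_nn_integral)
  have "(\<integral>\<^sup>+x. ennreal (indicator {0<..} x * (x powr (s - 1) * exp (- x))) \<partial>lborel) =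
        (\<integral>\<^sup>+x. ennreal (indicator {0..} x * x powr (s - 1) / exp x) \<partial>lborel)"
    by (intro nn_integral_cong_AE) (use AE_lborel_singleton[of 0] in \<open>eventually_elim, auto simp: indicator_def exp_minus field_simps\<close>)
  then show "(\<integral>\<^sup>+x. ennreal (indicator {0<..} x * (x powr (s - 1) * exp (- x))) \<partial>lborel) = ennreal (Gamma s)"
    using Gamma_conv_nn_integral_real[OF assms] by simp
qed (use Gamma_real_pos[OF assms] in auto)

text \<open>Let \<open>K\<close> be the integral, which does not depend on the line. Evaluate it on the line \<open>Re w = x / 2\<close> and
  rescale by \<open>x\<close>: this gives \<open>x\<^bsup>b-1\<^esup> e\<^bsup>-x\<^esup> K\<close> as an integral over the fixed line \<open>Re w = 1 / 2\<close> of \<open>e\<^bsup>-x(1-w)\<^esup> w\<^bsup>-b\<^esup>\<close>.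
  Integrating over \<open>x > 0\<close> turns the left-hand side into \<open>\<Gamma>(b) K\<close>, and by Fubini the right-hand side into the
  integral of \<open>w\<^bsup>-b\<^esup> / (1 - w)\<close>, which Cauchy's formula evaluates.\<close>

lemma Hankel_vertical_absolutely:
  assumes b: "1 < b" and \<gamma>: "0 < \<gamma>"
  shows "((\<lambda>R. contour_integral (vline \<gamma> R) (\<lambda>w. exp w * w powr (- of_real b))) \<longlongrightarrow> 2 * of_real pi * \<i> / of_real (Gamma b)) at_top"
proof -
  define f where "f w = exp w * w powr (- of_real b)" for w :: complex
  define K where "K x = (LBINT y. f (Complex x y))" for x
  have lim: "((\<lambda>R. contour_integral (vline x R) f) \<longlongrightarrow> \<i> * K x) at_top" if "0 < x" for x
    unfolding K_def by (rule contour_integral_vline_tendsto) (use vertical_line_exp_powr[OF b that] in \<open>auto simp: f_def\<close>)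
  have K_const: "K x = K \<gamma>" if "0 < x" for x
  proof -
    have "((\<lambda>R. contour_integral (vline \<gamma> R) f) \<longlongrightarrow> \<i> * K x) at_top"
      using lim[OF that] unfolding f_def using b by (intro vertical_integral_exp_powr_shift[OF _ that \<gamma>]) auto
    from tendsto_unique[OF _ this lim[OF \<gamma>]] show ?thesis by simp
  qed
  define F where "F x y = indicator {0<..} x *\<^sub>R exp (- (of_real x * (1 - Complex (1/2) y))) * Complex (1/2) y powr (- of_real b)" for x y :: real
  have scale: "(LBINT y. F x y) = indicator {0<..} x *\<^sub>R (of_real (x powr (b - 1) * exp (- x)) * K \<gamma>)" for x
  proof (cases "0 < x")
    case True
    have "K \<gamma> = K (x / 2)" using K_const[of "x / 2"] True by simp
    also have "\<dots> = \<bar>x\<bar> *\<^sub>R (LBINT y. f (Complex (x / 2) (0 + x * y)))"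
      unfolding K_def using True by (intro lborel_integral_real_affine) auto
    also have "(\<lambda>y. f (Complex (x / 2) (0 + x * y))) = (\<lambda>y. of_real (x powr (- b) * exp x) * F x y)"
    proof
      fix y
      have "Complex (x / 2) (0 + x * y) = of_real x * Complex (1/2) y" by (simp add: complex_eq_iff)
      moreover have "(of_real x * Complex (1/2) y) powr (- of_real b) = of_real (x powr (- b)) * Complex (1/2) y powr (- of_real b)"
        using True by (subst powr_times_real_left) (auto simp: powr_of_real[symmetric])
      moreover have "exp (of_real x * Complex (1/2) y) = of_real (exp x) * exp (- (of_real x * (1 - Complex (1/2) y)))"
        by (simp add: exp_of_real[symmetric] exp_add[symmetric] algebra_simps)
      ultimately show "f (Complex (x / 2) (0 + x * y)) = of_real (x powr (- b) * exp x) * F x y"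
        using True by (simp add: f_def F_def)
    qed
    finally have "K \<gamma> = of_real (x * (x powr (- b) * exp x)) * (LBINT y. F x y)"
      using True by (simp add: scaleR_conv_of_real)
    moreover have "x powr (b - 1) * exp (- x) * (x * (x powr (- b) * exp x)) = 1"
      using True by (simp add: powr_diff powr_minus exp_minus field_simps)
    then have "of_real (x powr (b - 1) * exp (- x)) * of_real (x * (x powr (- b) * exp x)) = (1::complex)"
      by (metis of_real_1 of_real_mult)
    ultimately show ?thesis using True by (simp add: mult.assoc[symmetric])
  qed (simp add: F_def)
  have F_meas: "case_prod F \<in> borel_measurable (lborel \<Otimes>\<^sub>M lborel)"
  proof -
    have [measurable]: "(\<lambda>y. Complex (1/2) y powr (- of_real b)) \<in> borel_measurable borel"
      using vertical_line_power(1)[OF b] by (intro borel_measurable_continuous_onI) auto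
    have [measurable]: "(\<lambda>y. Complex (1/2) y) \<in> borel_measurable borel"
      by (intro borel_measurable_continuous_onI continuous_intros)
    show ?thesis unfolding F_def by measurable
  qed
  have normF: "norm (F x y) = norm (indicator {0<..} x *\<^sub>R exp (- (of_real x * (1/2::complex)))) * norm (Complex (1/2) y powr (- of_real b))" for x y
    by (simp add: F_def norm_mult)
  have "integrable (lborel \<Otimes>\<^sub>M lborel) (case_prod F)"
  proof (rule lborel_pair.Fubini_integrable[OF F_meas])
    have "integrable lborel (\<lambda>x. norm (indicator {0<..} x *\<^sub>R exp (- (of_real x * (1/2::complex)))))"
      using Laplace_exp_integral(1)[of "1/2"] by (intro integrable_norm) simp
    then show "integrable lborel (\<lambda>x. LBINT y. norm (case (x, y) of (x, y) \<Rightarrow> F x y))"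
      by (simp only: split_conv normF integral_mult_right_zero) (rule integrable_mult_left)
    show "AE x in lborel. integrable lborel (\<lambda>y. case (x, y) of (x, y) \<Rightarrow> F x y)"
    proof (rule AE_I2)
      fix x :: real
      have "integrable lborel (\<lambda>y. norm (indicator {0<..} x *\<^sub>R exp (- (of_real x * (1/2::complex)))) * norm (Complex (1/2) y powr (- of_real b)))"
        using vertical_line_power(2)[OF b, of "1/2"] by simp
      moreover have "F x \<in> borel_measurable lborel" using measurable_Pair2[OF F_meas, of x] by simp
      ultimately show "integrable lborel (\<lambda>y. case (x, y) of (x, y) \<Rightarrow> F x y)"
        unfolding split_conv by (rule Bochner_Integration.integrable_bound) (simp only: normF norm_mult abs_norm_cancel norm_ge_zero order_refl AE_I2 real_norm_def abs_mult)
    qed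
  qed
  from lborel_pair.Fubini_integral[OF this]
  have "(LBINT x. LBINT y. F x y) = (LBINT y. LBINT x. F x y)" by simp
  also have "\<dots> = (LBINT y. Complex (1/2) y powr (- of_real b) / (1 - Complex (1/2) y))"
  proof (intro Bochner_Integration.integral_cong refl)
    fix y
    have "(LBINT x. F x y) = (LBINT x. indicator {0<..} x *\<^sub>R exp (- (of_real x * (1 - Complex (1/2) y)))) * Complex (1/2) y powr (- of_real b)"
      unfolding F_def by (rule integral_mult_left_zero)
    also have "(LBINT x. indicator {0<..} x *\<^sub>R exp (- (of_real x * (1 - Complex (1/2) y)))) = 1 / (1 - Complex (1/2) y)"
      by (rule Laplace_exp_integral(2)) simp
    finally show "(LBINT x. F x y) = Complex (1/2) y powr (- of_real b) / (1 - Complex (1/2) y)"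
      by simp
  qed
  also have "\<dots> = 2 * of_real pi" by (rule vertical_integral_power_cauchy[OF b]) auto
  finally have "(LBINT x. LBINT y. F x y) = 2 * of_real pi" .
  moreover have "(LBINT x. LBINT y. F x y) = of_real (Gamma b) * K \<gamma>"
  proof -
    have "(LBINT x. LBINT y. F x y) = (LBINT x. of_real (indicator {0<..} x * (x powr (b - 1) * exp (- x))) * K \<gamma>)"
      unfolding scale by (intro Bochner_Integration.integral_cong) (auto simp: indicator_def)
    then show ?thesis
      using Gamma_integral_lborel[of b] b by (simp add: has_bochner_integral_iff del: of_real_mult)
  qed
  ultimately have "\<i> * K \<gamma> = 2 * of_real pi * \<i> / of_real (Gamma b)"
  proof -
    assume "(LBINT x. LBINT y. F x y) = 2 * of_real pi" "(LBINT x. LBINT y. F x y) = of_real (Gamma b) * K \<gamma>"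
    then have "K \<gamma> = 2 * of_real pi / of_real (Gamma b)"
      using Gamma_real_pos[of b] b by (auto simp add: eq_divide_eq mult.commute)
    then show ?thesis by simp
  qed
  with lim[OF \<gamma>] show ?thesis unfolding f_def by simp
qed

text \<open>The general case follows from the recursion \<open>\<integral> e\<^sup>w w\<^bsup>-b\<^esup> dw = [e\<^sup>w w\<^bsup>-b\<^esup>] + b \<integral> e\<^sup>w w\<^bsup>-b-1\<^esup> dw\<close>, which matches
  \<open>\<Gamma>(b + 1) = b \<Gamma>(b)\<close>.\<close>

theorem Hankel_vertical:
  assumes b: "0 < b" and \<gamma>: "0 < \<gamma>"
  shows "((\<lambda>R. contour_integral (vline \<gamma> R) (\<lambda>w. exp w * w powr (- of_real b))) \<longlongrightarrow> 2 * of_real pi * \<i> / of_real (Gamma b)) at_top"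
proof -
  define g where "g w = exp w * w powr (- of_real b)" for w :: complex
  define k where "k w = exp w * w powr (- of_real (b + 1))" for w :: complex
  have rec: "contour_integral (vline \<gamma> R) g = g (Complex \<gamma> R) - g (Complex \<gamma> (- R)) + of_real b * contour_integral (vline \<gamma> R) k" for R
  proof -
    have sub: "path_image (vline \<gamma> R) \<subseteq> {w. 0 < Re w}"
      using \<gamma> half_plane_convex_open by (auto simp: closed_segment_subset subset_iff closed_segment_same_Re)
    have "(g has_field_derivative g w - of_real b * k w) (at w within {w. 0 < Re w})" if "w \<in> {w. 0 < Re w}" for w
    proof -
      have "w \<notin> \<real>\<^sub>\<le>\<^sub>0" using that by (auto simp: complex_nonpos_Reals_iff)
      moreover have e: "- complex_of_real (b + 1) = - complex_of_real b - 1" by simp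
      ultimately have "(g has_field_derivative g w - of_real b * k w) (at w)"
        unfolding g_def k_def e by (auto intro!: derivative_eq_intros simp: algebra_simps)
      then show ?thesis by (rule has_field_derivative_at_within)
    qed
    from contour_integral_primitive[OF this valid_path_linepath sub]
    have "((\<lambda>w. g w - of_real b * k w) has_contour_integral g (Complex \<gamma> R) - g (Complex \<gamma> (- R))) (vline \<gamma> R)"
      by simp
    moreover have "g contour_integrable_on vline \<gamma> R" "k contour_integrable_on vline \<gamma> R"
      unfolding g_def k_def
      by (intro contour_integrable_continuous_linepath holomorphic_on_imp_continuous_on
          holomorphic_on_subset[OF holomorphic_exp_powr] sub[unfolded path_image_linepath])+
    then have diff: "contour_integral (vline \<gamma> R) (\<lambda>w. g w - of_real b * k w) =
        contour_integral (vline \<gamma> R) g - of_real b * contour_integral (vline \<gamma> R) k"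
      by (simp add: contour_integral_diff contour_integrable_lmul contour_integral_lmul)
    ultimately have "g (Complex \<gamma> R) - g (Complex \<gamma> (- R)) =
        contour_integral (vline \<gamma> R) g - of_real b * contour_integral (vline \<gamma> R) k"
      using contour_integral_unique by metis
    then show ?thesis by simp
  qed
  have zero: "((\<lambda>R. g (Complex \<gamma> R)) \<longlongrightarrow> 0) at_top" "((\<lambda>R. g (Complex \<gamma> (- R))) \<longlongrightarrow> 0) at_top"
  proof -
    let ?c = "exp \<gamma> * (min 1 \<gamma> / 2) powr (- b)"
    have le: "cmod (g (Complex \<gamma> y)) \<le> ?c * (1 + \<bar>y\<bar>) powr (- b)" for y
      using norm_exp_powr_le[of \<gamma> "Complex \<gamma> y" \<gamma> b] b \<gamma> by (simp add: g_def mult.assoc)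
    show "((\<lambda>R. g (Complex \<gamma> R)) \<longlongrightarrow> 0) at_top"
    proof (rule Lim_null_comparison[OF _ weight_tendsto_0[OF b]])
      show "\<forall>\<^sub>F y in at_top. cmod (g (Complex \<gamma> y)) \<le> ?c * (1 + y) powr (- b)"
        using eventually_ge_at_top[of 0] by eventually_elim (rule order_trans[OF le], simp)
    qed
    show "((\<lambda>R. g (Complex \<gamma> (- R))) \<longlongrightarrow> 0) at_top"
    proof (rule Lim_null_comparison[OF _ weight_tendsto_0[OF b]])
      show "\<forall>\<^sub>F y in at_top. cmod (g (Complex \<gamma> (- y))) \<le> ?c * (1 + y) powr (- b)"
        using eventually_ge_at_top[of 0] by eventually_elim (rule order_trans[OF le], simp)
    qed
  qed
  have "((\<lambda>R. contour_integral (vline \<gamma> R) k) \<longlongrightarrow> 2 * of_real pi * \<i> / of_real (Gamma (b + 1))) at_top"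
    unfolding k_def using b \<gamma> by (intro Hankel_vertical_absolutely) auto
  then have "((\<lambda>R. contour_integral (vline \<gamma> R) g) \<longlongrightarrow> 0 - 0 + of_real b * (2 * of_real pi * \<i> / of_real (Gamma (b + 1)))) at_top"
    unfolding rec by (intro tendsto_add tendsto_diff tendsto_mult tendsto_const zero)
  also have "0 - 0 + of_real b * (2 * of_real pi * \<i> / of_real (Gamma (b + 1))) = 2 * of_real pi * \<i> / of_real (Gamma b)"
  proof -
    have "Gamma (b + 1) = b * Gamma b" using b by (intro Gamma_plus1) (use nonpos_Ints_nonpos[of b] in linarith)
    then show ?thesis using b by simp
  qed
  finally show ?thesis unfolding g_def .
qed

section \<open>Measurability on the space of probability measures\<close>

lemma space_weak_borel [simp]: "space weak_borel = prob_measures"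
  by (simp add: weak_borel_def space_measure_of_conv)

lemma openin_weak_topology_subset: "openin weak_topology U \<Longrightarrow> U \<subseteq> prob_measures"
  by (drule openin_subset) (auto simp: weak_topology_def)

lemma openin_in_sets_weak_borel: "openin weak_topology U \<Longrightarrow> U \<in> sets weak_borel"
  unfolding weak_borel_def using openin_weak_topology_subset by (subst sets_measure_of) auto

lemma measurable_integral_bounded_continuous:
  fixes f :: "real \<Rightarrow> real"
  assumes "continuous_on UNIV f" "bounded (range f)"
  shows "(\<lambda>\<phi>. \<integral>x. f x \<partial>\<phi>) \<in> borel_measurable weak_borel"
proof (rule borel_measurableI)
  fix U :: "real set" assume "open U"
  have "openin weak_topology {\<phi> \<in> prob_measures. (\<integral>x. f x \<partial>\<phi>) \<in> U}"
    unfolding weak_topology_def using assms \<open>open U\<close> by (intro topology_generated_by_Basis) blast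
  moreover have "(\<lambda>\<phi>. \<integral>x. f x \<partial>\<phi>) -` U \<inter> space weak_borel = {\<phi> \<in> prob_measures. (\<integral>x. f x \<partial>\<phi>) \<in> U}" by auto
  ultimately show "(\<lambda>\<phi>. \<integral>x. f x \<partial>\<phi>) -` U \<inter> space weak_borel \<in> sets weak_borel"
    by (simp add: openin_in_sets_weak_borel)
qed

text \<open>The indicator of an open half-line is a pointwise limit of bounded continuous functions.\<close>

lemma measurable_measure_lessThan: "(\<lambda>\<phi>. measure \<phi> {..<x}) \<in> borel_measurable weak_borel"
proof (rule borel_measurable_LIMSEQ_real)
  define f where "f n y = max 0 (min 1 (real n * (x - y)))" for n :: nat and y :: real
  show "(\<lambda>\<phi>. \<integral>y. f n y \<partial>\<phi>) \<in> borel_measurable weak_borel" for n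
    by (rule measurable_integral_bounded_continuous)
      (auto simp: f_def bounded_iff intro!: continuous_intros exI[of _ 1])
  show "(\<lambda>n. \<integral>y. f n y \<partial>\<phi>) \<longlonglongrightarrow> measure \<phi> {..<x}" if "\<phi> \<in> space weak_borel" for \<phi>
  proof -
    interpret real_distribution \<phi> using that by (simp add: prob_measures_def)
    have "(\<lambda>n. \<integral>y. f n y \<partial>\<phi>) \<longlonglongrightarrow> (\<integral>y. indicator {..<x} y \<partial>\<phi>)"
    proof (rule integral_dominated_convergence[where w = "\<lambda>_. 1"])
      show "AE y in \<phi>. (\<lambda>n. f n y) \<longlonglongrightarrow> indicator {..<x} y"
      proof (rule AE_I2)
        fix y
        show "(\<lambda>n. f n y) \<longlonglongrightarrow> indicator {..<x} y"
        proof (cases "y < x")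
          case True
          obtain N :: nat where N: "1 / (x - y) < real N" using reals_Archimedean2 by blast
          have "f n y = 1" if "N \<le> n" for n
          proof -
            have "1 < real N * (x - y)" using N True by (simp add: field_simps)
            also have "\<dots> \<le> real n * (x - y)" using that True by (intro mult_right_mono) auto
            finally show ?thesis by (simp add: f_def)
          qed
          then have "\<forall>\<^sub>F n in sequentially. f n y = indicator {..<x} y"
            using True by (auto simp: eventually_sequentially)
          then show ?thesis by (rule tendsto_eventually)
        next
          case False
          then have "real n * (x - y) \<le> 0" for n by (simp add: mult_nonneg_nonpos)
          then have "f n y = 0" for n by (simp add: f_def min.coboundedI2)
          then show ?thesis using False by simp
        qed
      qed
    qed (auto simp: f_def)
    then show ?thesis by simp
  qed
qed

lemma measurable_measure_Ico: 
  assumes "x \<le> y"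
  shows "(\<lambda>\<phi>. measure \<phi> {x..<y}) \<in> borel_measurable weak_borel"
proof -
  have "measure \<phi> {x..<y} = measure \<phi> {..<y} - measure \<phi> {..<x}" if "\<phi> \<in> space weak_borel" for \<phi>
  proof -
    interpret real_distribution \<phi> using that by (simp add: prob_measures_def)
    have "{x..<y} = {..<y} - {..<x}" by auto
    then show ?thesis using assms finite_measure_Diff[of "{..<y}" "{..<x}"] by auto
  qed
  then show ?thesis
    by (subst measurable_cong[of _ _ "\<lambda>\<phi>. measure \<phi> {..<y} - measure \<phi> {..<x}"])
      (auto intro!: borel_measurable_diff measurable_measure_lessThan)
qed

text \<open>The Bochner integral is \<open>0\<close> when the identity is not integrable, so the truncated means converge to it
  only after being cut off to the set \<open>A\<close> of those \<open>\<phi>\<close> whose truncated absolute means stay bounded, which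
  is the set of \<open>\<phi>\<close> with integrable identity.\<close>

lemma measurable_mean: "(\<lambda>\<phi>. \<integral>x. x \<partial>\<phi>) \<in> borel_measurable weak_borel"
proof (rule borel_measurable_LIMSEQ_real)
  define c where "c n x = max (- real n) (min (real n) x)" for n :: nat and x :: real
  define A where "A = {\<phi> \<in> space weak_borel. \<exists>K::nat. \<forall>n. (\<integral>x. \<bar>c n x\<bar> \<partial>\<phi>) \<le> real K}"
  have c_cont: "continuous_on UNIV (c n)" "continuous_on UNIV (\<lambda>x. \<bar>c n x\<bar>)" for n
    unfolding c_def by (intro continuous_intros)+
  have c_bd: "\<bar>c n x\<bar> \<le> real n" for n x by (auto simp: c_def)
  have m1: "(\<lambda>\<phi>. \<integral>x. c n x \<partial>\<phi>) \<in> borel_measurable weak_borel" for n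
    using c_bd by (intro measurable_integral_bounded_continuous c_cont) (auto simp: bounded_iff)
  have m2 [measurable]: "(\<lambda>\<phi>. \<integral>x. \<bar>c n x\<bar> \<partial>\<phi>) \<in> borel_measurable weak_borel" for n
    using c_bd by (intro measurable_integral_bounded_continuous c_cont) (auto simp: bounded_iff)
  have A [measurable]: "A \<in> sets weak_borel" unfolding A_def by measurable
  show "(\<lambda>\<phi>. indicator A \<phi> * (\<integral>x. c n x \<partial>\<phi>)) \<in> borel_measurable weak_borel" for n
    using m1 A by measurable
  show "(\<lambda>n. indicator A \<phi> * (\<integral>x. c n x \<partial>\<phi>)) \<longlonglongrightarrow> (\<integral>x. x \<partial>\<phi>)" if \<phi>: "\<phi> \<in> space weak_borel" for \<phi>
  proof -
    interpret real_distribution \<phi> using \<phi> by (simp add: prob_measures_def)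
    have [measurable]: "c n \<in> borel_measurable borel" for n by (rule borel_measurable_continuous_onI[OF c_cont(1)])
    have lim: "(\<lambda>n. c n x) \<longlonglongrightarrow> x" for x
    proof -
      obtain N :: nat where N: "\<bar>x\<bar> < real N" using reals_Archimedean2 by blast
      have "c n x = x" if "N \<le> n" for n using N that by (auto simp: c_def)
      then show ?thesis by (intro tendsto_eventually) (auto simp: eventually_sequentially)
    qed
    have c_le: "\<bar>c n x\<bar> \<le> \<bar>x\<bar>" for n x by (auto simp: c_def)
    have int_c: "integrable \<phi> (\<lambda>x. \<bar>c n x\<bar>)" for n
      by (rule integrable_const_bound[of _ "real n"]) (use c_bd in auto)
    show ?thesis
    proof (cases "integrable \<phi> (\<lambda>x. x)")
      case True
      obtain K :: nat where K: "(\<integral>x. \<bar>x\<bar> \<partial>\<phi>) < real K" using reals_Archimedean2 by blast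
      have "(\<integral>x. \<bar>c n x\<bar> \<partial>\<phi>) \<le> (\<integral>x. \<bar>x\<bar> \<partial>\<phi>)" for n
        using True int_c c_le by (intro integral_mono) auto
      then have "\<forall>n. (\<integral>x. \<bar>c n x\<bar> \<partial>\<phi>) \<le> real K" using K by (meson less_imp_le order_trans)
      then have "\<phi> \<in> A" using \<phi> unfolding A_def by blast
      moreover have "(\<lambda>n. \<integral>x. c n x \<partial>\<phi>) \<longlonglongrightarrow> (\<integral>x. x \<partial>\<phi>)"
      proof (rule integral_dominated_convergence[where w = "\<lambda>x. \<bar>x\<bar>"])
        show "integrable \<phi> (\<lambda>x. \<bar>x\<bar>)" using True by (rule integrable_abs)
        show "AE x in \<phi>. (\<lambda>n. c n x) \<longlonglongrightarrow> x" using lim by (rule AE_I2)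
        show "AE x in \<phi>. norm (c n x) \<le> \<bar>x\<bar>" for n using c_le by (intro AE_I2) simp
      qed measurable
      ultimately show ?thesis by simp
    next
      case False
      have "\<phi> \<notin> A"
      proof
        assume "\<phi> \<in> A"
        then obtain K :: nat where K: "(\<integral>x. \<bar>c n x\<bar> \<partial>\<phi>) \<le> real K" for n unfolding A_def by blast
        have "integrable \<phi> (\<lambda>x. \<bar>x\<bar>)"
        proof (rule integrable_monotone_convergence[of _ "\<lambda>n x. \<bar>c n x\<bar>"])
          show "AE x in \<phi>. mono (\<lambda>n. \<bar>c n x\<bar>)" by (auto simp: c_def mono_def)
          show "AE x in \<phi>. (\<lambda>n. \<bar>c n x\<bar>) \<longlonglongrightarrow> \<bar>x\<bar>" by (intro AE_I2 tendsto_rabs lim)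
          have "mono (\<lambda>n. \<integral>x. \<bar>c n x\<bar> \<partial>\<phi>)"
            using int_c by (intro monoI integral_mono) (auto simp: c_def)
          with K have "\<exists>L. (\<lambda>n. \<integral>x. \<bar>c n x\<bar> \<partial>\<phi>) \<longlonglongrightarrow> L"
            by (intro exI[of _ "SUP n. \<integral>x. \<bar>c n x\<bar> \<partial>\<phi>"] LIMSEQ_incseq_SUP) (auto intro!: bdd_aboveI)
          then show "(\<lambda>n. \<integral>x. \<bar>c n x\<bar> \<partial>\<phi>) \<longlonglongrightarrow> (SOME L. (\<lambda>n. \<integral>x. \<bar>c n x\<bar> \<partial>\<phi>) \<longlonglongrightarrow> L)"
            by (rule someI_ex)
        qed (use int_c in auto)
        then have "integrable \<phi> (\<lambda>x. x)" by (rule integrable_abs_cancel) measurable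
        with False show False by blast
      qed
      then show ?thesis using not_integrable_integral_eq[OF False] by simp
    qed
  qed
qed

section \<open>Gamma distributions\<close>

lemma sets_gamma_distribution [simp, measurable_cong]: "sets (gamma_distribution s) = sets borel"
  by (simp add: gamma_distribution_def)

lemma space_gamma_distribution [simp]: "space (gamma_distribution s) = UNIV"
  by (simp add: gamma_distribution_def)

lemma nn_integral_gamma_distribution:
  assumes "0 < s" "F \<in> borel_measurable borel"
  shows "(\<integral>\<^sup>+x. F x \<partial>gamma_distribution s) =
    (\<integral>\<^sup>+x. ennreal (indicator {0<..} x * (x powr (s - 1) * exp (- x) / Gamma s)) * F x \<partial>lborel)"
proof -
  have "(\<lambda>x. ennreal (if x > 0 then x powr (s - 1) * exp (- x) / Gamma s else 0)) =
     (\<lambda>x. ennreal (indicator {0<..} x * (x powr (s - 1) * exp (- x) / Gamma s)))"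
    by (auto simp: indicator_def)
  moreover have "gamma_distribution s = density lborel (\<lambda>x. ennreal (if x > 0 then x powr (s - 1) * exp (- x) / Gamma s else 0))"
    using assms by (simp add: gamma_distribution_def)
  ultimately show ?thesis using assms(2) by (simp add: nn_integral_density)
qed

lemma prob_space_gamma_distribution:
  assumes "0 \<le> s"
  shows "prob_space (gamma_distribution s)"
proof (cases "s = 0")
  case True
  then show ?thesis by (simp add: gamma_distribution_def prob_space_return)
next
  case False
  then have s: "0 < s" using assms by simp
  have "emeasure (gamma_distribution s) UNIV = (\<integral>\<^sup>+x. 1 \<partial>gamma_distribution s)" by simp
  also have "\<dots> = (\<integral>\<^sup>+x. ennreal (indicator {0<..} x * (x powr (s - 1) * exp (- x) / Gamma s)) \<partial>lborel)"
    using s by (subst nn_integral_gamma_distribution) auto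
  also have "\<dots> = ennreal (Gamma s / Gamma s)"
  proof -
    have i: "has_bochner_integral lborel (\<lambda>x::real. indicator {0<..} x * (x powr (s - 1) * exp (- x)) / Gamma s) (Gamma s / Gamma s)"
      using Gamma_integral_lborel[OF s] by (rule has_bochner_integral_divide_zero)
    show ?thesis
      using i Gamma_real_pos[OF s] by (subst nn_integral_eq_integral) (auto simp: has_bochner_integral_iff)
  qed
  finally show ?thesis using Gamma_real_pos[OF s] by (intro prob_spaceI) simp
qed

lemma AE_gamma_distribution_nonneg:
  assumes "0 \<le> s"
  shows "AE x in gamma_distribution s. 0 \<le> x"
proof (cases "s = 0")
  case True
  then show ?thesis unfolding gamma_distribution_def by (simp, subst AE_return) auto
next
  case False
  then show ?thesis unfolding gamma_distribution_def by (simp, subst AE_density) auto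
qed

lemma AE_gamma_distribution_pos:
  assumes "0 < s"
  shows "AE x in gamma_distribution s. 0 < x"
  using assms unfolding gamma_distribution_def by (simp, subst AE_density) auto

text \<open>Tilting a gamma law by \<open>e\<^bsup>-ux\<^esup>\<close> is, up to normalisation, the same as rescaling it.\<close>

lemma gamma_distribution_tilt:
  assumes "0 \<le> s" "- 1 < u" and [measurable]: "F \<in> borel_measurable borel"
  shows "(\<integral>\<^sup>+x. F x * ennreal (exp (- (u * x))) \<partial>gamma_distribution s) =
    ennreal ((1 + u) powr (- s)) * (\<integral>\<^sup>+x. F (x / (1 + u)) \<partial>gamma_distribution s)"
proof (cases "s = 0")
  case True
  then show ?thesis using assms by (simp add: gamma_distribution_def nn_integral_return)
next
  case False
  then have s: "0 < s" using assms by simp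
  have "(\<integral>\<^sup>+x. F x * ennreal (exp (- (u * x))) \<partial>gamma_distribution s) =
     (\<integral>\<^sup>+x. ennreal (indicator {0<..} x * (x powr (s - 1) * exp (- x) / Gamma s)) * (F x * ennreal (exp (- (u * x)))) \<partial>lborel)"
    by (rule nn_integral_gamma_distribution[OF s]) measurable
  also have "\<dots> = ennreal \<bar>1 / (1 + u)\<bar> * (\<integral>\<^sup>+x. ennreal (indicator {0<..} (0 + 1 / (1 + u) * x) * ((0 + 1 / (1 + u) * x) powr (s - 1) *
       exp (- (0 + 1 / (1 + u) * x)) / Gamma s)) * (F (0 + 1 / (1 + u) * x) * ennreal (exp (- (u * (0 + 1 / (1 + u) * x))))) \<partial>lborel)"
    using assms(2) by (intro nn_integral_real_affine) auto
  also have "\<dots> = ennreal ((1 + u) powr (- s)) * (\<integral>\<^sup>+x. ennreal (indicator {0<..} x * (x powr (s - 1) * exp (- x) / Gamma s)) * F (x / (1 + u)) \<partial>lborel)"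
    unfolding nn_integral_cmult[symmetric]
  proof (subst (1 2) nn_integral_cmult[symmetric], measurable, intro nn_integral_cong)
    fix x :: real
    show "ennreal \<bar>1 / (1 + u)\<bar> * (ennreal (indicator {0<..} (0 + 1 / (1 + u) * x) * ((0 + 1 / (1 + u) * x) powr (s - 1) *
       exp (- (0 + 1 / (1 + u) * x)) / Gamma s)) * (F (0 + 1 / (1 + u) * x) * ennreal (exp (- (u * (0 + 1 / (1 + u) * x))))))
      = ennreal ((1 + u) powr (- s)) * (ennreal (indicator {0<..} x * (x powr (s - 1) * exp (- x) / Gamma s)) * F (x / (1 + u)))"
    proof (cases "0 < x")
      case True
      define v where "v = 1 + u"
      have v: "0 < v" "u = v - 1" using assms(2) by (auto simp: v_def)
      have G: "0 < Gamma s" by (rule Gamma_real_pos[OF s])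
      have e: "exp (- (x / v)) * exp (- ((v - 1) * (x / v))) = exp (- x)"
        unfolding exp_add[symmetric] using v by (simp add: field_simps)
      have p: "1 / v * (x / v) powr (s - 1) = v powr (- s) * x powr (s - 1)"
        using v True by (simp add: powr_divide powr_diff powr_minus field_simps)
      have "1 / v * ((x / v) powr (s - 1) * exp (- (x / v)) / Gamma s) * exp (- ((v - 1) * (x / v)))
          = (1 / v * (x / v) powr (s - 1)) * (exp (- (x / v)) * exp (- ((v - 1) * (x / v)))) / Gamma s"
        by simp
      also have "\<dots> = v powr (- s) * (x powr (s - 1) * exp (- x) / Gamma s)"
        unfolding p e by simp
      finally have "ennreal (1 / v) * ennreal ((x / v) powr (s - 1) * exp (- (x / v)) / Gamma s) * ennreal (exp (- ((v - 1) * (x / v))))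
         = ennreal (v powr (- s)) * ennreal (x powr (s - 1) * exp (- x) / Gamma s)"
        using v G by (simp add: ennreal_mult[symmetric])
      then have "F (x / v) * (ennreal (1 / v) * ennreal ((x / v) powr (s - 1) * exp (- (x / v)) / Gamma s) * ennreal (exp (- ((v - 1) * (x / v)))))
         = F (x / v) * (ennreal (v powr (- s)) * ennreal (x powr (s - 1) * exp (- x) / Gamma s))"
        by (rule arg_cong)
      then show ?thesis
        using v True by (simp add: v_def[symmetric] mult_ac)
    next
      case False
      then show ?thesis using assms(2) by (simp add: zero_less_divide_iff)
    qed
  qed
  also have "(\<integral>\<^sup>+x. ennreal (indicator {0<..} x * (x powr (s - 1) * exp (- x) / Gamma s)) * F (x / (1 + u)) \<partial>lborel) =
      (\<integral>\<^sup>+x. F (x / (1 + u)) \<partial>gamma_distribution s)"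
    by (rule nn_integral_gamma_distribution[OF s, symmetric]) measurable
  finally show ?thesis .
qed

lemma gamma_distribution_mgf:
  assumes "0 \<le> s" "c < 1"
  shows "integrable (gamma_distribution s) (\<lambda>x. exp (c * x))"
    and "(\<integral>x. exp (c * x) \<partial>gamma_distribution s) = (1 - c) powr (- s)"
proof -
  interpret prob_space "gamma_distribution s" by (rule prob_space_gamma_distribution[OF assms(1)])
  have "(\<integral>\<^sup>+x. ennreal (exp (c * x)) \<partial>gamma_distribution s) = ennreal ((1 - c) powr (- s))"
    using gamma_distribution_tilt[of s "- c" "\<lambda>_. 1"] assms emeasure_space_1 by simp
  then have "has_bochner_integral (gamma_distribution s) (\<lambda>x. exp (c * x)) ((1 - c) powr (- s))"
    by (intro has_bochner_integral_nn_integral) auto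
  then show "integrable (gamma_distribution s) (\<lambda>x. exp (c * x))"
    and "(\<integral>x. exp (c * x) \<partial>gamma_distribution s) = (1 - c) powr (- s)"
    by (auto simp: has_bochner_integral_iff)
qed

section \<open>Moments of Dirichlet vectors\<close>

text \<open>The tilting factor of a product measure splits into one factor per coordinate.\<close>

lemma gamma_vector_tilt:
  assumes u: "- 1 < u" and s: "\<And>i. 0 \<le> s i"
  shows "finite I \<Longrightarrow> Q \<in> borel_measurable (PiM I (\<lambda>_. borel)) \<Longrightarrow>
    (\<integral>\<^sup>+z. Q z * ennreal (exp (- (u * (\<Sum>i\<in>I. z i)))) \<partial>PiM I (\<lambda>i. gamma_distribution (s i))) =
    ennreal ((1 + u) powr (- (\<Sum>i\<in>I. s i))) * (\<integral>\<^sup>+z. Q (\<lambda>i\<in>I. z i / (1 + u)) \<partial>PiM I (\<lambda>i. gamma_distribution (s i)))"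
proof (induction I arbitrary: Q rule: finite_induct)
  case empty
  then show ?case using u by (simp add: PiM_empty nn_integral_count_space_finite)
next
  case (insert i I Q)
  let ?G = "\<lambda>i. gamma_distribution (s i)"
  interpret prob_space "?G j" for j by (rule prob_space_gamma_distribution[OF s])
  interpret product_sigma_finite ?G by unfold_locales
  interpret GI: prob_space "PiM I ?G" by (rule prob_space_PiM) unfold_locales
  have [measurable]: "Q \<in> borel_measurable (PiM (insert i I) ?G)"
    using insert.prems by (simp cong: measurable_cong_sets sets_PiM_cong)
  have [measurable]: "(\<lambda>(x, y). Q (x(i := y / c))) \<in> borel_measurable (PiM I ?G \<Otimes>\<^sub>M ?G i)" for c :: real
  proof -
    have "(\<lambda>p. (fst p)(i := snd p / c)) \<in> measurable (PiM I ?G \<Otimes>\<^sub>M ?G i) (PiM (insert i I) ?G)"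
      by (rule measurable_fun_upd[where J = I]) auto
    from measurable_compose[OF this] show ?thesis by (simp add: split_beta')
  qed
  have exp_meas [measurable]: "(\<lambda>z. exp (- (u * (\<Sum>j\<in>J. z j)))) \<in> borel_measurable (PiM J ?G)" for J
    by measurable
  have single [measurable]: "(\<lambda>y. Q (x(i := y))) \<in> borel_measurable borel" if "x \<in> space (PiM I ?G)" for x
  proof -
    have "(\<lambda>(x, y). Q (x(i := y / 1))) \<in> borel_measurable (PiM I ?G \<Otimes>\<^sub>M ?G i)" by measurable
    from measurable_Pair2[OF this that] show ?thesis by (simp cong: measurable_cong_sets)
  qed
  define H where "H x = (\<integral>\<^sup>+y. Q (x(i := y / (1 + u))) \<partial>?G i)" for x
  have H [measurable]: "H \<in> borel_measurable (PiM I (\<lambda>_. borel))"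
  proof -
    have "H \<in> borel_measurable (PiM I ?G)" unfolding H_def by measurable
    then show ?thesis by (simp cong: measurable_cong_sets sets_PiM_cong)
  qed
  have "(\<integral>\<^sup>+z. Q z * ennreal (exp (- (u * (\<Sum>j\<in>insert i I. z j)))) \<partial>PiM (insert i I) ?G) =
      (\<integral>\<^sup>+x. \<integral>\<^sup>+y. Q (x(i := y)) * ennreal (exp (- (u * (\<Sum>j\<in>insert i I. (x(i := y)) j)))) \<partial>?G i \<partial>PiM I ?G)"
    by (rule product_nn_integral_insert[OF insert.hyps]) measurable
  also have "\<dots> = (\<integral>\<^sup>+x. (ennreal ((1 + u) powr (- s i)) * H x) * ennreal (exp (- (u * (\<Sum>j\<in>I. x j)))) \<partial>PiM I ?G)"
  proof (intro nn_integral_cong)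
    fix x assume x: "x \<in> space (PiM I ?G)"
    have sum: "(\<Sum>j\<in>insert i I. (x(i := y)) j) = y + (\<Sum>j\<in>I. x j)" for y
      using insert.hyps by (simp add: sum.insert) (intro sum.cong, auto)
    have "Q (x(i := y)) * ennreal (exp (- (u * (\<Sum>j\<in>insert i I. (x(i := y)) j)))) =
      ennreal (exp (- (u * (\<Sum>j\<in>I. x j)))) * (Q (x(i := y)) * ennreal (exp (- (u * y))))" for y
    proof -
      have "exp (- (u * (y + (\<Sum>j\<in>I. x j)))) = exp (- (u * (\<Sum>j\<in>I. x j))) * exp (- (u * y))"
        by (simp add: exp_add[symmetric] algebra_simps)
      then show ?thesis unfolding sum by (simp add: ennreal_mult mult_ac)
    qed
    then have "(\<integral>\<^sup>+y. Q (x(i := y)) * ennreal (exp (- (u * (\<Sum>j\<in>insert i I. (x(i := y)) j)))) \<partial>?G i) =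
      (\<integral>\<^sup>+y. ennreal (exp (- (u * (\<Sum>j\<in>I. x j)))) * (Q (x(i := y)) * ennreal (exp (- (u * y)))) \<partial>?G i)"
      by (intro nn_integral_cong) blast
    also have "\<dots> = ennreal (exp (- (u * (\<Sum>j\<in>I. x j)))) * (\<integral>\<^sup>+y. Q (x(i := y)) * ennreal (exp (- (u * y))) \<partial>?G i)"
      using single[OF x] by (intro nn_integral_cmult) (simp cong: measurable_cong_sets)
    also have "(\<integral>\<^sup>+y. Q (x(i := y)) * ennreal (exp (- (u * y))) \<partial>?G i) = ennreal ((1 + u) powr (- s i)) * H x"
      unfolding H_def using s u single[OF x] by (intro gamma_distribution_tilt) auto
    finally show "(\<integral>\<^sup>+y. Q (x(i := y)) * ennreal (exp (- (u * (\<Sum>j\<in>insert i I. (x(i := y)) j)))) \<partial>?G i) =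
        (ennreal ((1 + u) powr (- s i)) * H x) * ennreal (exp (- (u * (\<Sum>j\<in>I. x j))))"
      by (simp only: mult_ac)
  qed
  also have "\<dots> = ennreal ((1 + u) powr (- (\<Sum>j\<in>I. s j))) * (\<integral>\<^sup>+x. ennreal ((1 + u) powr (- s i)) * H (\<lambda>j\<in>I. x j / (1 + u)) \<partial>PiM I ?G)"
    by (rule insert.IH) measurable
  also have "(\<integral>\<^sup>+x. ennreal ((1 + u) powr (- s i)) * H (\<lambda>j\<in>I. x j / (1 + u)) \<partial>PiM I ?G) =
      ennreal ((1 + u) powr (- s i)) * (\<integral>\<^sup>+x. H (\<lambda>j\<in>I. x j / (1 + u)) \<partial>PiM I ?G)"
  proof (rule nn_integral_cmult)
    have "H \<in> borel_measurable (PiM I ?G)" using H by (simp cong: measurable_cong_sets sets_PiM_cong)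
    moreover have "(\<lambda>x. \<lambda>j\<in>I. x j / (1 + u)) \<in> measurable (PiM I ?G) (PiM I ?G)" by measurable
    ultimately show "(\<lambda>x. H (\<lambda>j\<in>I. x j / (1 + u))) \<in> borel_measurable (PiM I ?G)" by (rule measurable_compose[rotated])
  qed
  also have "(\<integral>\<^sup>+x. H (\<lambda>j\<in>I. x j / (1 + u)) \<partial>PiM I ?G) = (\<integral>\<^sup>+z. Q (\<lambda>j\<in>insert i I. z j / (1 + u)) \<partial>PiM (insert i I) ?G)"
  proof (subst product_nn_integral_insert[OF insert.hyps])
    show "(\<lambda>z. Q (\<lambda>j\<in>insert i I. z j / (1 + u))) \<in> borel_measurable (PiM (insert i I) ?G)"
      by measurable
    have "(\<lambda>j\<in>I. x j / (1 + u))(i := y / (1 + u)) = (\<lambda>j\<in>insert i I. (x(i := y)) j / (1 + u))" for x :: "'a \<Rightarrow> real" and y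
      using insert.hyps by (auto simp: fun_eq_iff)
    then show "(\<integral>\<^sup>+x. H (\<lambda>j\<in>I. x j / (1 + u)) \<partial>PiM I ?G) =
      (\<integral>\<^sup>+x. \<integral>\<^sup>+y. Q (\<lambda>j\<in>insert i I. (x(i := y)) j / (1 + u)) \<partial>?G i \<partial>PiM I ?G)"
      by (simp add: H_def)
  qed
  also have "ennreal ((1 + u) powr (- (\<Sum>j\<in>I. s j))) * (ennreal ((1 + u) powr (- s i)) * (\<integral>\<^sup>+z. Q (\<lambda>j\<in>insert i I. z j / (1 + u)) \<partial>PiM (insert i I) ?G)) =
      ennreal ((1 + u) powr (- (\<Sum>j\<in>insert i I. s j))) * (\<integral>\<^sup>+z. Q (\<lambda>j\<in>insert i I. z j / (1 + u)) \<partial>PiM (insert i I) ?G)"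
    using insert.hyps by (simp add: mult.assoc[symmetric] ennreal_mult[symmetric] powr_add[symmetric] add.commute)
  finally show ?case .
qed

text \<open>Independent gamma variables with a total shape that is positive; single shapes may vanish. Dividing
  by the total gives the Dirichlet vector.\<close>

locale gamma_vector =
  fixes I :: "'i set" and s :: "'i \<Rightarrow> real"
  assumes finite_I: "finite I" and s_nonneg: "\<And>i. 0 \<le> s i" and s_pos: "0 < (\<Sum>i\<in>I. s i)"
begin

abbreviation G :: "('i \<Rightarrow> real) measure" where "G \<equiv> PiM I (\<lambda>i. gamma_distribution (s i))"

definition total :: "('i \<Rightarrow> real) \<Rightarrow> real" where "total z = (\<Sum>i\<in>I. z i)"

lemma prob_space_G: "prob_space G"
  using prob_space_gamma_distribution[OF s_nonneg] by (rule prob_space_PiM)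

lemma measurable_total [measurable]: "total \<in> borel_measurable G"
  unfolding total_def by measurable

lemma AE_nonneg: "AE z in G. \<forall>i\<in>I. 0 \<le> z i"
  using finite_I s_nonneg
  by (intro AE_finite_allI AE_PiM_component[of I "\<lambda>i. gamma_distribution (s i)"] AE_gamma_distribution_nonneg
      prob_space_gamma_distribution) auto

lemma AE_total_pos: "AE z in G. 0 < total z"
proof -
  obtain i where i: "i \<in> I" "0 < s i"
    using s_pos sum_nonpos[of I s] by (meson not_less)
  have "AE z in G. 0 < z i"
    using i s_nonneg by (intro AE_PiM_component[of I "\<lambda>i. gamma_distribution (s i)"] AE_gamma_distribution_pos
      prob_space_gamma_distribution) auto
  with AE_nonneg show ?thesis
  proof eventually_elim
    case (elim z)
    then have "z i \<le> total z" unfolding total_def using i finite_I by (intro member_le_sum) auto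
    with elim show ?case by simp
  qed
qed

lemma mgf:
  assumes "\<And>i. i \<in> I \<Longrightarrow> c i < 1"
  shows "integrable G (\<lambda>z. exp (\<Sum>i\<in>I. c i * z i))"
    and "(\<integral>z. exp (\<Sum>i\<in>I. c i * z i) \<partial>G) = (\<Prod>i\<in>I. (1 - c i) powr (- s i))"
proof -
  interpret prob_space "gamma_distribution (s i)" for i by (rule prob_space_gamma_distribution[OF s_nonneg])
  interpret product_sigma_finite "\<lambda>i. gamma_distribution (s i)" by unfold_locales
  have e: "exp (\<Sum>i\<in>I. c i * z i) = (\<Prod>i\<in>I. exp (c i * z i))" for z :: "'i \<Rightarrow> real"
    using finite_I by (rule exp_sum)
  show "integrable G (\<lambda>z. exp (\<Sum>i\<in>I. c i * z i))"
    unfolding e using finite_I assms s_nonneg by (intro product_integrable_prod gamma_distribution_mgf) auto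
  show "(\<integral>z. exp (\<Sum>i\<in>I. c i * z i) \<partial>G) = (\<Prod>i\<in>I. (1 - c i) powr (- s i))"
    unfolding e using finite_I assms s_nonneg
    by (subst product_integral_prod) (auto simp: gamma_distribution_mgf intro!: prod.cong)
qed

lemma integrable_total_power: "integrable G (\<lambda>z. total z ^ k)"
proof (rule Bochner_Integration.integrable_bound)
  show "integrable G (\<lambda>z. (fact k * 2 ^ k) * exp (\<Sum>i\<in>I. (1/2) * z i))"
    by (intro integrable_mult_right mgf(1)) auto
  show "AE z in G. norm (total z ^ k) \<le> norm (fact k * 2 ^ k * exp (\<Sum>i\<in>I. (1/2) * z i))"
    using AE_total_pos
  proof eventually_elim
    case (elim z)
    have "v ^ k / fact k \<le> exp v" if "0 \<le> v" for v :: real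
    proof -
      have "(\<Sum>n\<in>{k}. v ^ n /\<^sub>R fact n) \<le> (\<Sum>n. v ^ n /\<^sub>R fact n)"
        using that by (intro sum_le_suminf summable_exp_generic) auto
      moreover have "(\<Sum>n\<in>{k}. v ^ n /\<^sub>R fact n) = v ^ k / fact k"
        by (simp add: field_simps)
      ultimately show ?thesis unfolding exp_def by linarith
    qed
    from this[of "total z / 2"] elim have "(total z / 2) ^ k / fact k \<le> exp (total z / 2)" by simp
    then have "fact k * 2 ^ k * ((total z / 2) ^ k / fact k) \<le> fact k * 2 ^ k * exp (total z / 2)"
      by (intro mult_left_mono) auto
    also have "fact k * 2 ^ k * ((total z / 2) ^ k / fact k) = total z ^ k" by (simp add: power_divide)
    also have "total z / 2 = (\<Sum>i\<in>I. (1/2) * z i)" by (simp add: total_def sum_divide_distrib)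
    finally show ?case using elim by simp
  qed
qed measurable

text \<open>Since \<open>g\<close> is homogeneous of degree \<open>0\<close>, the tilting identity reads
  \<open>E[total\<^sup>k g exp (- u total)] = (1 + u)\<^bsup>-a-k\<^esup> E[total\<^sup>k g]\<close>; differentiating at \<open>u = 0\<close> raises \<open>k\<close>.\<close>

lemma moment_total_step_nonneg:
  fixes g :: "('i \<Rightarrow> real) \<Rightarrow> real"
  assumes g_meas: "g \<in> borel_measurable (PiM I (\<lambda>_. borel))"
    and g_hom: "\<And>z c. 0 < c \<Longrightarrow> g (\<lambda>i\<in>I. z i / c) = g z"
    and g_bd: "AE z in G. 0 \<le> g z" "AE z in G. g z \<le> C"
  shows "(\<integral>z. total z ^ Suc k * g z \<partial>G) = ((\<Sum>i\<in>I. s i) + real k) * (\<integral>z. total z ^ k * g z \<partial>G)"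
proof -
  define a where "a = (\<Sum>i\<in>I. s i)"
  have [measurable]: "g \<in> borel_measurable G" using g_meas by (simp cong: measurable_cong_sets sets_PiM_cong)
  have [measurable]: "total \<in> borel_measurable (PiM I (\<lambda>_. borel))" unfolding total_def by measurable
  note g_meas [measurable]
  have int: "integrable G (\<lambda>z. total z ^ j * g z)" for j
  proof (rule Bochner_Integration.integrable_bound)
    show "integrable G (\<lambda>z. C * total z ^ j)" by (intro integrable_mult_right integrable_total_power)
    show "AE z in G. norm (total z ^ j * g z) \<le> norm (C * total z ^ j)"
      using AE_total_pos g_bd
    proof eventually_elim
      case (elim z)
      then have "0 \<le> C" by linarith
      with elim show ?case by (simp add: abs_mult mult.commute mult_left_mono)
    qed
  qed measurable
  define \<psi> where "\<psi> u = (\<integral>z. total z ^ k * g z * exp (- (u * total z)) \<partial>G)" for u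
  have \<psi>: "\<psi> u = (1 + u) powr (- a - real k) * (\<integral>z. total z ^ k * g z \<partial>G)" if u: "0 \<le> u" for u
  proof -
    have nn: "AE z in G. 0 \<le> total z ^ k * g z" using AE_total_pos g_bd(1) by eventually_elim simp
    let ?E = "\<integral>z. total z ^ k * g z \<partial>G"
    have nn_exp: "AE z in G. 0 \<le> total z ^ k * g z * exp (- (u * total z))" using nn by eventually_elim simp
    have nn_scaled: "AE z in G. 0 \<le> (1 + u) powr (- real k) * (total z ^ k * g z)" using nn by eventually_elim simp
    have "\<psi> u = enn2real (\<integral>\<^sup>+z. ennreal (total z ^ k * g z * exp (- (u * total z))) \<partial>G)"
      unfolding \<psi>_def using nn_exp by (intro integral_eq_nn_integral) auto
    also have "(\<integral>\<^sup>+z. ennreal (total z ^ k * g z * exp (- (u * total z))) \<partial>G) =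
        (\<integral>\<^sup>+z. ennreal (total z ^ k * g z) * ennreal (exp (- (u * (\<Sum>i\<in>I. z i)))) \<partial>G)"
    proof (rule nn_integral_cong_AE)
      show "AE z in G. ennreal (total z ^ k * g z * exp (- (u * total z))) =
          ennreal (total z ^ k * g z) * ennreal (exp (- (u * (\<Sum>i\<in>I. z i))))"
        using nn by eventually_elim (simp add: ennreal_mult total_def)
    qed
    also have "\<dots> = ennreal ((1 + u) powr (- a)) * (\<integral>\<^sup>+z. ennreal (total (\<lambda>i\<in>I. z i / (1 + u)) ^ k * g (\<lambda>i\<in>I. z i / (1 + u))) \<partial>G)"
      unfolding a_def using u by (intro gamma_vector_tilt s_nonneg finite_I) auto
    also have "(\<integral>\<^sup>+z. ennreal (total (\<lambda>i\<in>I. z i / (1 + u)) ^ k * g (\<lambda>i\<in>I. z i / (1 + u))) \<partial>G) =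
        (\<integral>\<^sup>+z. ennreal ((1 + u) powr (- real k) * (total z ^ k * g z)) \<partial>G)"
    proof (intro nn_integral_cong arg_cong[where f = ennreal])
      fix z :: "'i \<Rightarrow> real"
      have "total (\<lambda>i\<in>I. z i / (1 + u)) = total z / (1 + u)" by (simp add: total_def sum_divide_distrib)
      moreover have "(total z / (1 + u)) ^ k = (1 + u) powr (- real k) * total z ^ k"
        using u by (simp add: power_divide powr_minus powr_realpow field_simps)
      ultimately show "total (\<lambda>i\<in>I. z i / (1 + u)) ^ k * g (\<lambda>i\<in>I. z i / (1 + u)) = (1 + u) powr (- real k) * (total z ^ k * g z)"
        using u g_hom[of "1 + u" z] by simp
    qed
    also have "\<dots> = ennreal ((1 + u) powr (- real k) * ?E)"
      using nn_scaled int[of k] by (subst nn_integral_eq_integral) auto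
    also have "ennreal ((1 + u) powr (- a)) * \<dots> = ennreal ((1 + u) powr (- a) * ((1 + u) powr (- real k) * ?E))"
      by (rule ennreal_mult'[symmetric]) simp
    also have "(1 + u) powr (- a) * ((1 + u) powr (- real k) * ?E) = (1 + u) powr (- a - real k) * ?E"
      by (simp add: mult.assoc[symmetric] powr_add[symmetric])
    finally show ?thesis
      using integral_nonneg_AE[OF nn] by simp
  qed
  have "(\<lambda>n. real (Suc n) * (\<psi> 0 - \<psi> (1 / real (Suc n)))) \<longlonglongrightarrow> (\<integral>z. total z ^ Suc k * g z \<partial>G)"
  proof -
    have "(\<lambda>n. \<integral>z. total z ^ k * g z * (real (Suc n) * (1 - exp (- (1 / real (Suc n) * total z)))) \<partial>G) \<longlonglongrightarrow> (\<integral>z. total z ^ Suc k * g z \<partial>G)"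
    proof (rule integral_dominated_convergence[where w = "\<lambda>z. total z ^ Suc k * g z"])
      show "AE z in G. (\<lambda>n. total z ^ k * g z * (real (Suc n) * (1 - exp (- (1 / real (Suc n) * total z))))) \<longlonglongrightarrow> total z ^ Suc k * g z"
        using AE_total_pos
      proof eventually_elim
        case (elim z)
        have "(\<lambda>n. real (Suc n) * (1 - exp (- (1 / real (Suc n) * x)))) \<longlonglongrightarrow> x" if "0 < x" for x
          using that by real_asymp
        from this[OF elim] have "(\<lambda>n. total z ^ k * g z * (real (Suc n) * (1 - exp (- (1 / real (Suc n) * total z))))) \<longlonglongrightarrow> total z ^ k * g z * total z"
          by (intro tendsto_intros)
        then show ?case
          by (simp add: mult_ac)
      qed
      show "AE z in G. norm (total z ^ k * g z * (real (Suc n) * (1 - exp (- (1 / real (Suc n) * total z))))) \<le> total z ^ Suc k * g z" for n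
        using AE_total_pos g_bd(1)
      proof eventually_elim
        case (elim z)
        define v where "v = 1 / real (Suc n) * total z"
        have v: "0 \<le> v" "real (Suc n) * v = total z" using elim by (auto simp: v_def)
        have "1 - exp (- v) \<le> v" using exp_ge_add_one_self[of "- v"] by linarith
        then have "real (Suc n) * (1 - exp (- v)) \<le> total z" using v(2) mult_left_mono[of "1 - exp (- v)" v "real (Suc n)"] by simp
        moreover have "0 \<le> real (Suc n) * (1 - exp (- v))" using v by simp
        moreover have "0 \<le> total z ^ k * g z" using elim by simp
        ultimately have "\<bar>total z ^ k * g z * (real (Suc n) * (1 - exp (- v)))\<bar> \<le> total z ^ k * g z * total z"
          by (metis abs_mult abs_of_nonneg mult_left_mono)
        then show ?case unfolding v_def by (simp add: mult_ac)
      qed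
    qed (measurable, measurable, rule int)
    moreover have "(\<integral>z. total z ^ k * g z * (real (Suc n) * (1 - exp (- (1 / real (Suc n) * total z)))) \<partial>G) =
        real (Suc n) * (\<psi> 0 - \<psi> (1 / real (Suc n)))" for n
    proof -
      have i2: "integrable G (\<lambda>z. total z ^ k * g z * exp (- (1 / real (Suc n) * total z)))"
        using int[of k]
      proof (rule Bochner_Integration.integrable_bound)
        show "AE z in G. norm (total z ^ k * g z * exp (- (1 / real (Suc n) * total z))) \<le> norm (total z ^ k * g z)"
          using AE_total_pos by eventually_elim (unfold norm_mult, rule mult_right_le_one_le, auto)
      qed measurable
      have "(\<integral>z. total z ^ k * g z * (real (Suc n) * (1 - exp (- (1 / real (Suc n) * total z)))) \<partial>G) =
          (\<integral>z. real (Suc n) * (total z ^ k * g z - total z ^ k * g z * exp (- (1 / real (Suc n) * total z))) \<partial>G)"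
        by (intro Bochner_Integration.integral_cong refl) (simp only: right_diff_distrib mult_1_right mult_ac)
      also have "\<dots> = real (Suc n) * ((\<integral>z. total z ^ k * g z \<partial>G) - (\<integral>z. total z ^ k * g z * exp (- (1 / real (Suc n) * total z)) \<partial>G))"
        unfolding integral_mult_right_zero Bochner_Integration.integral_diff[OF int i2] ..
      finally show ?thesis by (simp add: \<psi>_def)
    qed
    ultimately show ?thesis by simp
  qed
  moreover have "(\<lambda>n. real (Suc n) * (\<psi> 0 - \<psi> (1 / real (Suc n)))) \<longlonglongrightarrow> (a + real k) * (\<integral>z. total z ^ k * g z \<partial>G)"
  proof -
    have "(\<lambda>n. real (Suc n) * (1 - (1 + 1 / real (Suc n)) powr (- b))) \<longlonglongrightarrow> b" if "0 < b" for b :: real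
      using that by real_asymp
    from this[of "a + real k"] s_pos have "(\<lambda>n. real (Suc n) * (1 - (1 + 1 / real (Suc n)) powr (- a - real k))) \<longlonglongrightarrow> a + real k"
      by (simp add: a_def add_pos_nonneg)
    then have "(\<lambda>n. real (Suc n) * (1 - (1 + 1 / real (Suc n)) powr (- a - real k)) * (\<integral>z. total z ^ k * g z \<partial>G)) \<longlonglongrightarrow> (a + real k) * (\<integral>z. total z ^ k * g z \<partial>G)"
      by (intro tendsto_intros)
    moreover have "real (Suc n) * (1 - (1 + 1 / real (Suc n)) powr (- a - real k)) * (\<integral>z. total z ^ k * g z \<partial>G) =
        real (Suc n) * (\<psi> 0 - \<psi> (1 / real (Suc n)))" for n
      using \<psi>[of 0] \<psi>[of "1 / real (Suc n)"] by (simp add: left_diff_distrib mult.assoc)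
    ultimately show ?thesis by (simp only:)
  qed
  ultimately show ?thesis unfolding a_def by (rule LIMSEQ_unique)
qed

text \<open>This is the independence of the total and the normalised vector, in the form needed here: the total has
  the moments \<open>pochhammer a k\<close> of a gamma variable, whatever function \<open>g\<close> of the normalised vector is
  weighted in. Adding a constant to \<open>g\<close> reduces the claim to nonnegative \<open>g\<close>.\<close>

lemma
  fixes g :: "('i \<Rightarrow> real) \<Rightarrow> real"
  assumes g_meas: "g \<in> borel_measurable (PiM I (\<lambda>_. borel))"
    and g_hom: "\<And>z c. 0 < c \<Longrightarrow> g (\<lambda>i\<in>I. z i / c) = g z"
    and g_bd: "AE z in G. \<bar>g z\<bar> \<le> C"
  shows integrable_moment_total: "integrable G (\<lambda>z. total z ^ k * g z)"
    and moment_total: "(\<integral>z. total z ^ k * g z \<partial>G) = pochhammer (\<Sum>i\<in>I. s i) k * (\<integral>z. g z \<partial>G)"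
proof -
  have [measurable]: "g \<in> borel_measurable G" using g_meas by (simp cong: measurable_cong_sets sets_PiM_cong)
  have int: "integrable G (\<lambda>z. total z ^ j * g z)" for j
  proof (rule Bochner_Integration.integrable_bound)
    show "integrable G (\<lambda>z. C * total z ^ j)" by (intro integrable_mult_right integrable_total_power)
    show "AE z in G. norm (total z ^ j * g z) \<le> norm (C * total z ^ j)"
      using AE_total_pos g_bd by eventually_elim (simp add: abs_mult mult.commute mult_left_mono)
  qed measurable
  then show "integrable G (\<lambda>z. total z ^ k * g z)" .
  have step: "(\<integral>z. total z ^ Suc j * g z \<partial>G) = ((\<Sum>i\<in>I. s i) + real j) * (\<integral>z. total z ^ j * g z \<partial>G)" for j
  proof -
    interpret prob_space G by (rule prob_space_G)
    have "AE z in G. 0 \<le> C" using g_bd by eventually_elim linarith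
    then have C: "0 \<le> C" by (simp add: AE_const)
    have add: "(\<integral>z. total z ^ i * (g z + C) \<partial>G) = (\<integral>z. total z ^ i * g z \<partial>G) + (\<integral>z. total z ^ i * C \<partial>G)" for i
      unfolding distrib_left using int[of i] integrable_total_power[of i] by (intro Bochner_Integration.integral_add) auto
    have e1: "(\<integral>z. total z ^ Suc j * (g z + C) \<partial>G) = ((\<Sum>i\<in>I. s i) + real j) * (\<integral>z. total z ^ j * (g z + C) \<partial>G)"
      using g_meas g_bd by (intro moment_total_step_nonneg[where C = "2 * C"])
        (auto simp: g_hom elim!: eventually_mono)
    have e2: "(\<integral>z. total z ^ Suc j * C \<partial>G) = ((\<Sum>i\<in>I. s i) + real j) * (\<integral>z. total z ^ j * C \<partial>G)"
      using C by (intro moment_total_step_nonneg[where C = C]) auto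
    show ?thesis using e1[unfolded add] by (simp only: distrib_left e2 add_right_cancel)
  qed
  show "(\<integral>z. total z ^ k * g z \<partial>G) = pochhammer (\<Sum>i\<in>I. s i) k * (\<integral>z. g z \<partial>G)"
    by (induction k) (simp_all only: step pochhammer_Suc, simp_all)
qed

end

lemma sums_pochhammer_powr:
  fixes a r :: real
  assumes "\<bar>r\<bar> < 1"
  shows "(\<lambda>n. pochhammer a n / fact n * r ^ n) sums (1 - r) powr (- a)"
proof -
  have "(\<lambda>n. (- a gchoose n) * (- r) ^ n) sums (1 + (- r)) powr (- a)"
    using assms by (intro gen_binomial_real) simp
  moreover have "(- a gchoose n) * (- r) ^ n = pochhammer a n / fact n * r ^ n" for n
    by (simp add: gbinomial_pochhammer power_minus[of r] mult_ac flip: power_add)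
  ultimately show ?thesis by simp
qed

context gamma_vector begin

definition mean :: "('i \<Rightarrow> real) \<Rightarrow> ('i \<Rightarrow> real) \<Rightarrow> real" where
  "mean x z = (\<Sum>i\<in>I. x i * (z i / total z))"

lemma mean_eq: "mean x z = (\<Sum>i\<in>I. x i * z i) / total z"
  by (simp add: mean_def sum_divide_distrib)

lemma abs_mean_le:
  assumes "\<And>i. i \<in> I \<Longrightarrow> \<bar>x i\<bar> \<le> B" "\<forall>i\<in>I. 0 \<le> z i" "0 < total z"
  shows "\<bar>mean x z\<bar> \<le> B"
proof -
  have "\<bar>\<Sum>i\<in>I. x i * z i\<bar> \<le> (\<Sum>i\<in>I. B * z i)"
    using assms by (intro order_trans[OF sum_abs] sum_mono) (auto simp: abs_mult intro: mult_right_mono)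
  then show ?thesis using assms(3) by (simp add: mean_eq total_def sum_distrib_left[symmetric] pos_divide_le_eq)
qed

text \<open>Expand \<open>exp (c \<Sum> x\<^sub>i z\<^sub>i)\<close> in powers of \<open>\<Sum> x\<^sub>i z\<^sub>i = total \<cdot> mean\<close> and separate the total from the mean.\<close>

theorem moments_generating_identity:
  assumes x: "\<And>i. i \<in> I \<Longrightarrow> \<bar>x i\<bar> \<le> B" and c: "\<bar>c\<bar> * B < 1" and B: "0 \<le> B"
  shows "(\<lambda>k. pochhammer (\<Sum>i\<in>I. s i) k / fact k * c ^ k * (\<integral>z. mean x z ^ k \<partial>G)) sums (\<Prod>i\<in>I. (1 - c * x i) powr (- s i))"
proof -
  define a where "a = (\<Sum>i\<in>I. s i)"
  have a: "0 < a" using s_pos by (simp add: a_def)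
  define f where "f k z = c ^ k / fact k * (total z ^ k * mean x z ^ k)" for k z
  have mm: "(\<lambda>z. mean x z ^ k) \<in> borel_measurable (PiM I (\<lambda>_. borel))" for k
    unfolding mean_def total_def by measurable
  have mh: "mean x (\<lambda>i\<in>I. z i / b) = mean x z" if "0 < b" for z b
    using that by (simp add: mean_eq total_def sum_divide_distrib[symmetric])
  have mb: "AE z in G. \<bar>mean x z\<bar> \<le> B"
    using AE_nonneg AE_total_pos by eventually_elim (rule abs_mean_le[OF x])
  have mbk: "AE z in G. \<bar>mean x z ^ k\<bar> \<le> B ^ k" for k
    using mb by eventually_elim (auto simp: power_abs intro: power_mono)
  have int: "integrable G (f k)" for k
    unfolding f_def by (intro integrable_mult_right integrable_moment_total[OF mm _ mbk]) (simp add: mh)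
  have val: "(\<integral>z. f k z \<partial>G) = pochhammer a k / fact k * c ^ k * (\<integral>z. mean x z ^ k \<partial>G)" for k
    unfolding f_def a_def by (simp add: moment_total[OF mm _ mbk] mh)
  have norm_le: "(\<integral>z. norm (f k z) \<partial>G) \<le> pochhammer a k / fact k * (\<bar>c\<bar> * B) ^ k" for k
  proof -
    have "(\<integral>z. norm (f k z) \<partial>G) \<le> (\<integral>z. \<bar>c\<bar> ^ k / fact k * (total z ^ k * B ^ k) \<partial>G)"
    proof (rule integral_mono_AE)
      show "integrable G (\<lambda>z. norm (f k z))" using int by simp
      show "integrable G (\<lambda>z. \<bar>c\<bar> ^ k / fact k * (total z ^ k * B ^ k))"
        by (intro integrable_mult_right integrable_mult_left integrable_total_power)
      show "AE z in G. norm (f k z) \<le> \<bar>c\<bar> ^ k / fact k * (total z ^ k * B ^ k)"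
        using AE_total_pos mbk[of k]
        by eventually_elim (auto simp: f_def abs_mult power_abs intro!: mult_left_mono divide_right_mono)
    qed
    also have "\<dots> = \<bar>c\<bar> ^ k / fact k * (\<integral>z. total z ^ k * B ^ k \<partial>G)" by simp
    also have "(\<integral>z. total z ^ k * B ^ k \<partial>G) = pochhammer a k * (\<integral>z. B ^ k \<partial>G)"
      unfolding a_def by (intro moment_total[where C = "\<bar>B ^ k\<bar>"]) auto
    also have "(\<integral>z. B ^ k \<partial>G) = B ^ k"
    proof -
      interpret prob_space G by (rule prob_space_G)
      show ?thesis by (simp add: prob_space)
    qed
    finally show ?thesis by (simp add: power_mult_distrib mult_ac)
  qed
  have "(\<lambda>k. \<integral>z. f k z \<partial>G) sums (\<integral>z. (\<Sum>k. f k z) \<partial>G)"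
  proof (rule sums_integral[OF int])
    have e: "f k z = (c * (total z * mean x z)) ^ k /\<^sub>R fact k" for k z
      by (simp add: f_def power_mult_distrib divide_inverse mult_ac)
    show "AE z in G. summable (\<lambda>k. norm (f k z))"
      unfolding e by (intro AE_I2 summable_norm_exp)
    show "summable (\<lambda>k. \<integral>z. norm (f k z) \<partial>G)"
    proof (rule summable_comparison_test')
      show "summable (\<lambda>k. pochhammer a k / fact k * (\<bar>c\<bar> * B) ^ k)"
        using sums_pochhammer_powr[of "\<bar>c\<bar> * B" a] c B by (auto simp: sums_iff abs_mult)
      show "norm (\<integral>z. norm (f k z) \<partial>G) \<le> pochhammer a k / fact k * (\<bar>c\<bar> * B) ^ k" for k
        using norm_le[of k] by simp
    qed
  qed
  also have "(\<integral>z. (\<Sum>k. f k z) \<partial>G) = (\<integral>z. exp (\<Sum>i\<in>I. c * x i * z i) \<partial>G)"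
  proof (rule integral_cong_AE)
    show "AE z in G. (\<Sum>k. f k z) = exp (\<Sum>i\<in>I. c * x i * z i)"
      using AE_total_pos
    proof eventually_elim
      case (elim z)
      have "total z * mean x z = (\<Sum>i\<in>I. x i * z i)"
        using elim by (simp add: mean_eq)
      then have "f k z = (c * (\<Sum>i\<in>I. x i * z i)) ^ k /\<^sub>R fact k" for k
        by (simp add: f_def power_mult_distrib[symmetric] divide_inverse mult_ac)
      then show ?case by (simp add: exp_def sum_distrib_left mult.assoc)
    qed
  qed (use int in measurable)
  also have "\<dots> = (\<Prod>i\<in>I. (1 - c * x i) powr (- s i))"
  proof (rule mgf(2))
    fix i assume "i \<in> I"
    then have "\<bar>c * x i\<bar> \<le> \<bar>c\<bar> * B" using x by (auto simp: abs_mult intro: mult_left_mono)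
    with c show "c * x i < 1" by linarith
  qed
  finally show ?thesis by (simp add: val a_def)
qed

end

section \<open>Moments of the mean of a Dirichlet process\<close>

lemma measurable_vector_of_cells:
  assumes "\<And>i. i \<in> {1..n} \<Longrightarrow> (\<lambda>\<phi>. measure \<phi> (C i)) \<in> borel_measurable weak_borel"
  shows "(\<lambda>\<phi>. \<lambda>i\<in>{1..n}. measure \<phi> (C i)) \<in> measurable weak_borel (PiM {1..n::nat} (\<lambda>_. borel))"
  using assms by (intro measurable_restrict) auto

lemma measurable_gamma_component:
  assumes "i \<in> I"
  shows "(\<lambda>z. z i) \<in> borel_measurable (PiM I (\<lambda>i. gamma_distribution (p i)))"
  using measurable_component_singleton[OF assms, of "\<lambda>i. gamma_distribution (p i)"] by (simp cong: measurable_cong_sets)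

lemma measurable_normalised_gamma:
  "(\<lambda>z. \<lambda>i\<in>{1..n}. z i / (\<Sum>j\<in>{1..n + 1}. z j)) \<in>
    measurable (PiM {1..n + 1} (\<lambda>i. gamma_distribution (p i))) (PiM {1..n::nat} (\<lambda>_. borel))"
proof (rule measurable_restrict)
  fix i assume "i \<in> {1..n}"
  then have "(\<lambda>z. z i) \<in> borel_measurable (PiM {1..n + 1} (\<lambda>i. gamma_distribution (p i)))"
    by (intro measurable_gamma_component) simp
  moreover have "(\<lambda>z. \<Sum>j\<in>{1..n + 1}. z j) \<in> borel_measurable (PiM {1..n + 1} (\<lambda>i. gamma_distribution (p i)))"
    by (rule borel_measurable_sum) (rule measurable_gamma_component)
  ultimately show "(\<lambda>z. z i / (\<Sum>j\<in>{1..n + 1}. z j)) \<in> borel_measurable (PiM {1..n + 1} (\<lambda>i. gamma_distribution (p i)))"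
    by (rule borel_measurable_divide)
qed

lemma dirichlet_process_law_cells:
  fixes n :: nat
  assumes law: "dirichlet_process_law \<alpha> D"
    and C: "\<And>i. i \<in> {1..n + 1} \<Longrightarrow> C i \<in> sets borel" "disjoint_family_on C {1..n + 1}" "(\<Union>i\<in>{1..n + 1}. C i) = UNIV"
  shows "distr D (PiM {1..n} (\<lambda>_. borel)) (\<lambda>\<phi>. \<lambda>i\<in>{1..n}. measure \<phi> (C i)) =
    distr (PiM {1..n + 1} (\<lambda>i. gamma_distribution (measure \<alpha> (C i)))) (PiM {1..n} (\<lambda>_. borel))
      (\<lambda>z. \<lambda>i\<in>{1..n}. z i / (\<Sum>j\<in>{1..n + 1}. z j))"
proof -
  have "\<forall>n C. (\<forall>i\<in>{1..n + 1}. C i \<in> sets borel) \<and> disjoint_family_on C {1..n + 1} \<and> (\<Union>i\<in>{1..n + 1}. C i) = UNIV \<longrightarrow>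
      distr D (PiM {1..n} (\<lambda>_. borel)) (\<lambda>\<phi>. \<lambda>i\<in>{1..n}. measure \<phi> (C i)) = dirichlet_distribution n (\<lambda>i. measure \<alpha> (C i))"
    using law unfolding dirichlet_process_law_def by (elim conjE)
  from this[rule_format, of n C] show ?thesis
    unfolding dirichlet_distribution_def using C by simp
qed

text \<open>Apply the law to the partition into the interval and its complement: the second gamma variable has
  shape \<open>0\<close>, hence vanishes almost surely.\<close>

lemma AE_mass_one:
  assumes law: "dirichlet_process_law \<alpha> D" and "finite_borel_measure \<alpha>"
    and null: "measure \<alpha> (- {x..<y}) = 0" and pos: "0 < measure \<alpha> UNIV" and xy: "x \<le> y"
  shows "AE \<phi> in D. measure \<phi> {x..<y} = 1"
proof -
  interpret \<alpha>: finite_borel_measure \<alpha> by fact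
  define C where "C i = (if i = 1 then {x..<y} else - {x..<y})" for i :: nat
  have I2: "{1..1 + 1::nat} = {1, 2}" by auto
  have sets_D: "sets D = sets weak_borel" using law by (simp add: dirichlet_process_law_def)
  let ?G = "PiM {1..1 + 1::nat} (\<lambda>i. gamma_distribution (measure \<alpha> (C i)))"
  let ?P = "PiM {1..1::nat} (\<lambda>_. borel :: real measure)"
  have meas: "(\<lambda>\<phi>. \<lambda>i\<in>{1..1}. measure \<phi> (C i)) \<in> measurable D ?P"
    using measurable_measure_Ico[OF xy] by (subst measurable_cong_sets[OF sets_D refl], intro measurable_vector_of_cells) (auto simp: C_def)
  have eq: "distr D ?P (\<lambda>\<phi>. \<lambda>i\<in>{1..1}. measure \<phi> (C i)) = distr ?G ?P (\<lambda>z. \<lambda>i\<in>{1..1}. z i / (\<Sum>j\<in>{1..1 + 1}. z j))"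
    by (rule dirichlet_process_law_cells[OF law]) (unfold I2, auto simp: C_def disjoint_family_on_def)
  have "measure \<alpha> UNIV = measure \<alpha> {x..<y} + measure \<alpha> (- {x..<y})"
    using \<alpha>.finite_measure_Union[of "{x..<y}" "- {x..<y}"] by (simp add: \<alpha>.M_is_borel)
  then have sum: "(\<Sum>i\<in>{1..1 + 1}. measure \<alpha> (C i)) = measure \<alpha> UNIV"
    unfolding I2 by (simp add: C_def)
  interpret g: gamma_vector "{1..1 + 1::nat}" "\<lambda>i. measure \<alpha> (C i)"
    using pos sum by unfold_locales auto
  have "AE z in ?G. z 2 = 0"
  proof (rule AE_PiM_component)
    show "AE v in gamma_distribution (measure \<alpha> (C 2)). v = 0"
    proof -
      have "gamma_distribution (measure \<alpha> (C 2)) = return borel 0"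
        using null by (simp add: C_def gamma_distribution_def)
      then show ?thesis by (simp only:) (subst AE_return, auto)
    qed
  qed (auto intro: prob_space_gamma_distribution)
  with g.AE_total_pos have "AE z in ?G. (\<lambda>i\<in>{1..1}. z i / (\<Sum>j\<in>{1..1 + 1}. z j)) 1 = 1"
  proof eventually_elim
    case (elim z)
    have "0 < (\<Sum>i\<in>{1..1 + 1}. z i)" using elim(1) unfolding g.total_def .
    then have "0 < z 1 + z 2" unfolding I2 by simp
    with elim(2) show ?case unfolding I2 by simp
  qed
  moreover have set: "{v \<in> space ?P. v 1 = 1} \<in> sets ?P" by measurable
  ultimately have "AE v in distr ?G ?P (\<lambda>z. \<lambda>i\<in>{1..1}. z i / (\<Sum>j\<in>{1..1 + 1}. z j)). v 1 = 1"
    using measurable_normalised_gamma by (subst AE_distr_iff) auto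
  then have "AE \<phi> in D. (\<lambda>i\<in>{1..1}. measure \<phi> (C i)) 1 = 1"
    unfolding eq[symmetric] using meas set by (subst (asm) AE_distr_iff) auto
  then show ?thesis by (simp add: C_def)
qed

text \<open>A partition of the line into \<open>N\<close> half-open cells of equal length that fill \<open>[-B, B)\<close>, and the rest. The
  function \<open>step\<close> sends each point of \<open>[-B, B)\<close> to the left end of its cell, and all other points to \<open>0\<close>.\<close>

locale grid =
  fixes B :: real and N :: nat
  assumes B: "0 < B" and N: "0 < N"
begin

definition index :: "real \<Rightarrow> int" where "index x = \<lfloor>(x + B) * real N / (2 * B)\<rfloor>"
definition node :: "nat \<Rightarrow> real" where "node j = - B + 2 * B * (real j - 1) / real N"
definition cell :: "nat \<Rightarrow> real set" where
  "cell j = (if j \<le> N then {x. index x = int j - 1} else - {- B..<B})"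
definition step :: "real \<Rightarrow> real" where "step x = (\<Sum>j\<in>{1..N}. node j * indicator (cell j) x)"

lemma node_mono: "i \<le> j \<Longrightarrow> node i \<le> node j"
  using B N unfolding node_def by (simp add: divide_right_mono)

lemma cell_Ico: "j \<le> N \<Longrightarrow> cell j = {node j..<node (j + 1)}"
proof -
  assume "j \<le> N"
  have "index x = int j - 1 \<longleftrightarrow> node j \<le> x \<and> x < node (j + 1)" for x
  proof -
    have "index x = int j - 1 \<longleftrightarrow> real j - 1 \<le> (x + B) * real N / (2 * B) \<and> (x + B) * real N / (2 * B) < real j"
      unfolding index_def floor_eq_iff by simp
    moreover have "real j - 1 \<le> (x + B) * real N / (2 * B) \<longleftrightarrow> node j \<le> x"
      using B N by (simp add: node_def field_simps)
    moreover have "(x + B) * real N / (2 * B) < real j \<longleftrightarrow> x < node (j + 1)"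
      using B N by (simp add: node_def field_simps)
    ultimately show ?thesis by (simp only:)
  qed
  then have "{x. index x = int j - 1} = {node j..<node (j + 1)}"
    by (simp only: atLeastLessThan_def atLeast_def lessThan_def Collect_conj_eq)
  with \<open>j \<le> N\<close> show ?thesis unfolding cell_def by (simp only: if_True)
qed

lemma cell_borel [measurable]: "cell j \<in> sets borel"
  by (cases "j \<le> N") (simp_all add: cell_Ico, simp add: cell_def)

lemma index_range: "x \<in> {- B..<B} \<longleftrightarrow> 0 \<le> index x \<and> index x < int N"
proof -
  have "0 \<le> index x \<longleftrightarrow> - B \<le> x" unfolding index_def using B N by (simp add: zero_le_divide_iff zero_le_mult_iff) linarith
  moreover have "index x < int N \<longleftrightarrow> x < B"
    unfolding index_def floor_less_iff using B N by (simp add: field_simps)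
  ultimately show ?thesis by auto
qed

lemma disjoint_cells: "disjoint_family_on cell {1..N + 1}"
  unfolding disjoint_family_on_def
proof (intro ballI impI)
  fix i j assume ij: "i \<in> {1..N + 1}" "j \<in> {1..N + 1}" "i \<noteq> j"
  have "\<not> (x \<in> cell i \<and> x \<in> cell j)" for x
    using ij index_range[of x] by (auto simp: cell_def split: if_splits)
  then show "cell i \<inter> cell j = {}" by blast
qed

lemma Union_cells: "(\<Union>j\<in>{1..N + 1}. cell j) = UNIV"
proof -
  have "\<exists>j\<in>{1..N + 1}. x \<in> cell j" for x
  proof (cases "x \<in> {- B..<B}")
    case True
    then have "0 \<le> index x" "index x < int N" using index_range by auto
    then show ?thesis by (intro bexI[of _ "nat (index x + 1)"]) (auto simp: cell_def)
  next
    case False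
    then show ?thesis by (intro bexI[of _ "N + 1"]) (auto simp: cell_def)
  qed
  then show ?thesis by blast
qed

lemma step_in_cell:
  assumes "j \<in> {1..N}" "x \<in> cell j"
  shows "step x = node j"
proof -
  have "step x = (\<Sum>i\<in>{1..N}. if i = j then node j else 0)"
    unfolding step_def using assms by (intro sum.cong) (auto simp: cell_def indicator_def)
  then show ?thesis using assms by simp
qed

lemma cell_cases:
  assumes "x \<in> {- B..<B}"
  obtains j where "j \<in> {1..N}" "x \<in> cell j"
proof -
  obtain j where j: "j \<in> {1..N + 1}" "x \<in> cell j" using Union_cells by blast
  then have "j \<noteq> N + 1" using assms by (auto simp: cell_def)
  with j have "j \<in> {1..N}" by simp
  then show ?thesis using j(2) by (rule that)
qed

lemma step_close:
  assumes "x \<in> {- B..<B}"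
  shows "\<bar>x - step x\<bar> \<le> 2 * B / real N"
proof -
  obtain j where j: "j \<in> {1..N}" "x \<in> cell j" using cell_cases[OF assms] .
  then have "node j \<le> x" "x < node (j + 1)" using cell_Ico[of j] by auto
  moreover have "node (j + 1) - node j = 2 * B / real N"
    using B N by (simp add: node_def field_simps)
  ultimately show ?thesis unfolding step_in_cell[OF j] by linarith
qed

lemma abs_node_le:
  assumes "j \<in> {1..N}"
  shows "\<bar>node j\<bar> \<le> B"
proof -
  define r where "r = (real j - 1) / real N"
  have r: "0 \<le> r" "r \<le> 1" using assms by (auto simp: r_def)
  have "0 \<le> 2 * B * r" "2 * B * r \<le> 2 * B * 1"
    using B r by (auto intro!: mult_left_mono)
  moreover have "node j = - B + 2 * B * r" by (simp add: node_def r_def)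
  ultimately show ?thesis by (simp add: abs_le_iff)
qed

lemma step_outside: "x \<notin> {- B..<B} \<Longrightarrow> step x = 0"
  unfolding step_def using index_range[of x] by (intro sum.neutral) (auto simp: cell_def indicator_def)

lemma abs_step_le: "\<bar>step x\<bar> \<le> B"
proof (cases "x \<in> {- B..<B}")
  case True
  then obtain j where "j \<in> {1..N}" "x \<in> cell j" using cell_cases by blast
  then show ?thesis using step_in_cell abs_node_le by simp
qed (use step_outside B in auto)

lemma step_borel [measurable]: "step \<in> borel_measurable borel"
  unfolding step_def by measurable

lemma integral_step:
  fixes h :: "real \<Rightarrow> real"
  assumes "finite_measure \<mu>" "sets \<mu> = sets borel" "h 0 = 0"
  shows "(\<integral>x. h (step x) \<partial>\<mu>) = (\<Sum>j\<in>{1..N}. h (node j) * measure \<mu> (cell j))"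
proof -
  interpret finite_measure \<mu> by fact
  have "h (step x) = (\<Sum>j\<in>{1..N}. h (node j) * indicator (cell j) x)" for x
  proof (cases "x \<in> {- B..<B}")
    case True
    then obtain j where j: "j \<in> {1..N}" "x \<in> cell j" using cell_cases by blast
    have "(\<Sum>i\<in>{1..N}. h (node i) * indicator (cell i) x) = (\<Sum>i\<in>{1..N}. if i = j then h (node j) else 0)"
      using j by (intro sum.cong) (auto simp: cell_def indicator_def)
    then show ?thesis using j step_in_cell[OF j] by simp
  next
    case False
    then have "(\<Sum>i\<in>{1..N}. h (node i) * indicator (cell i) x) = 0"
      using index_range[of x] by (intro sum.neutral) (auto simp: cell_def indicator_def)
    then show ?thesis using step_outside[OF False] assms(3) by simp
  qed
  then have "(\<integral>x. h (step x) \<partial>\<mu>) = (\<integral>x. (\<Sum>j\<in>{1..N}. h (node j) * indicator (cell j) x) \<partial>\<mu>)" by simp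
  also have "\<dots> = (\<Sum>j\<in>{1..N}. \<integral>x. h (node j) * indicator (cell j) x \<partial>\<mu>)"
    using assms(2) by (intro Bochner_Integration.integral_sum integrable_mult_right integrable_real_indicator)
      (auto simp: emeasure_eq_measure)
  also have "\<dots> = (\<Sum>j\<in>{1..N}. h (node j) * measure \<mu> (cell j))"
    using assms(2) sets_eq_imp_space_eq[OF assms(2)] by simp
  finally show ?thesis .
qed

text \<open>The mean of the discretised process is a Dirichlet mean over the cells.\<close>

lemma mean_step_moments:
  assumes law: "dirichlet_process_law \<alpha> D" and \<alpha>: "finite_borel_measure \<alpha>"
    and null: "measure \<alpha> (- {- B..<B}) = 0" and pos: "0 < measure \<alpha> UNIV" and c: "\<bar>c\<bar> * B < 1"
  shows "(\<lambda>k. pochhammer (measure \<alpha> UNIV) k / fact k * c ^ k * (\<integral>\<phi>. (\<integral>x. step x \<partial>\<phi>) ^ k \<partial>D)) sums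
    exp (- (\<integral>x. ln (1 - c * step x) \<partial>\<alpha>))"
proof -
  interpret \<alpha>: finite_borel_measure \<alpha> by fact
  define s where "s j = measure \<alpha> (cell j)" for j
  define node' where "node' j = (if j \<le> N then node j else 0)" for j
  let ?G = "PiM {1..N + 1} (\<lambda>i. gamma_distribution (s i))"
  let ?P = "PiM {1..N} (\<lambda>_. borel :: real measure)"
  have I: "{1..N + 1} = insert (N + 1) {1..N}" by auto
  have sets_D: "sets D = sets weak_borel" using law by (simp add: dirichlet_process_law_def)
  have total: "(\<Sum>i\<in>{1..N + 1}. s i) = measure \<alpha> UNIV"
  proof -
    have "measure \<alpha> (\<Union>i\<in>{1..N + 1}. cell i) = (\<Sum>i\<in>{1..N + 1}. s i)"
      unfolding s_def using disjoint_cells by (intro \<alpha>.finite_measure_finite_Union) auto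
    then show ?thesis by (simp only: Union_cells)
  qed
  interpret g: gamma_vector "{1..N + 1}" s
    using pos total by unfold_locales (auto simp: s_def)
  have meas: "(\<lambda>\<phi>. \<lambda>i\<in>{1..N}. measure \<phi> (cell i)) \<in> measurable D ?P"
    using node_mono by (subst measurable_cong_sets[OF sets_D refl], intro measurable_vector_of_cells)
      (simp add: cell_Ico measurable_measure_Ico)
  have eq: "distr D ?P (\<lambda>\<phi>. \<lambda>i\<in>{1..N}. measure \<phi> (cell i)) = distr ?G ?P (\<lambda>z. \<lambda>i\<in>{1..N}. z i / (\<Sum>j\<in>{1..N + 1}. z j))"
    unfolding s_def by (rule dirichlet_process_law_cells[OF law cell_borel disjoint_cells Union_cells])
  have mom: "(\<integral>\<phi>. (\<integral>x. step x \<partial>\<phi>) ^ k \<partial>D) = (\<integral>z. g.mean node' z ^ k \<partial>?G)" for k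
  proof -
    define F where "F v = (\<Sum>j\<in>{1..N}. node j * v j) ^ k" for v :: "nat \<Rightarrow> real"
    have F: "F \<in> borel_measurable ?P" unfolding F_def by measurable
    have "(\<integral>\<phi>. (\<integral>x. step x \<partial>\<phi>) ^ k \<partial>D) = (\<integral>\<phi>. F (\<lambda>i\<in>{1..N}. measure \<phi> (cell i)) \<partial>D)"
    proof (rule Bochner_Integration.integral_cong)
      fix \<phi> assume "\<phi> \<in> space D"
      then have "\<phi> \<in> prob_measures" using sets_eq_imp_space_eq[OF sets_D] by simp
      then interpret real_distribution \<phi> by (simp add: prob_measures_def)
      have "(\<integral>x. step x \<partial>\<phi>) = (\<Sum>j\<in>{1..N}. node j * measure \<phi> (cell j))"
        by (rule integral_step) (auto intro: finite_measure_axioms)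
      then show "(\<integral>x. step x \<partial>\<phi>) ^ k = F (\<lambda>i\<in>{1..N}. measure \<phi> (cell i))" by (simp add: F_def)
    qed simp
    also have "\<dots> = (\<integral>v. F v \<partial>distr D ?P (\<lambda>\<phi>. \<lambda>i\<in>{1..N}. measure \<phi> (cell i)))"
      by (rule integral_distr[OF meas F, symmetric])
    also have "\<dots> = (\<integral>z. F (\<lambda>i\<in>{1..N}. z i / (\<Sum>j\<in>{1..N + 1}. z j)) \<partial>?G)"
      unfolding eq by (rule integral_distr[OF measurable_normalised_gamma F])
    also have "\<dots> = (\<integral>z. g.mean node' z ^ k \<partial>?G)"
    proof (rule Bochner_Integration.integral_cong[OF refl])
      fix z
      have "(\<Sum>i\<in>{1..N + 1}. node' i * v i) = (\<Sum>i\<in>{1..N}. node i * v i)" for v :: "nat \<Rightarrow> real"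
        unfolding I by (simp add: node'_def)
      then have "g.mean node' z = (\<Sum>i\<in>{1..N}. node i * (z i / g.total z))"
        unfolding g.mean_def .
      then show "F (\<lambda>i\<in>{1..N}. z i / (\<Sum>j\<in>{1..N + 1}. z j)) = g.mean node' z ^ k"
        unfolding F_def g.total_def by (simp only: restrict_apply if_True cong: sum.cong if_cong)
    qed
    finally show ?thesis .
  qed
  have "(\<lambda>k. pochhammer (\<Sum>i\<in>{1..N + 1}. s i) k / fact k * c ^ k * (\<integral>z. g.mean node' z ^ k \<partial>?G)) sums
      (\<Prod>i\<in>{1..N + 1}. (1 - c * node' i) powr (- s i))"
    by (rule g.moments_generating_identity[where B = B]) (use c B abs_node_le in \<open>auto simp: node'_def\<close>)
  also have "(\<Prod>i\<in>{1..N + 1}. (1 - c * node' i) powr (- s i)) = (\<Prod>i\<in>{1..N}. (1 - c * node i) powr (- s i))"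
    unfolding I by (subst prod.insert) (auto simp: node'_def intro!: prod.cong)
  also have "\<dots> = exp (\<Sum>i\<in>{1..N}. - (ln (1 - c * node i) * s i))"
    unfolding exp_sum[OF finite_atLeastAtMost]
  proof (rule prod.cong[OF refl])
    fix i assume "i \<in> {1..N}"
    then have "\<bar>c * node i\<bar> \<le> \<bar>c\<bar> * B" using abs_node_le by (auto simp: abs_mult intro: mult_left_mono)
    then have "0 < 1 - c * node i" using c by linarith
    then show "(1 - c * node i) powr (- s i) = exp (- (ln (1 - c * node i) * s i))"
      by (simp add: powr_def mult.commute)
  qed
  also have "(\<Sum>i\<in>{1..N}. - (ln (1 - c * node i) * s i)) = - (\<integral>x. ln (1 - c * step x) \<partial>\<alpha>)"
    unfolding s_def by (subst integral_step[where h = "\<lambda>y. ln (1 - c * y)"])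
      (auto simp: sum_negf \<alpha>.finite_measure_axioms \<alpha>.M_is_borel)
  finally show ?thesis by (simp only: total mom)
qed

end

lemma abs_mean_le_of_mass_one:
  assumes "real_distribution \<phi>" "measure \<phi> {- B..<B} = 1" "0 < B"
  shows "integrable \<phi> (\<lambda>x. x)" "\<bar>\<integral>x. x \<partial>\<phi>\<bar> \<le> B" "AE x in \<phi>. x \<in> {- B..<B}"
proof -
  interpret real_distribution \<phi> by fact
  show AE: "AE x in \<phi>. x \<in> {- B..<B}"
    using assms(2) by (intro AE_prob_1)
  have bd: "AE x in \<phi>. norm x \<le> B" using AE by eventually_elim auto
  then show int: "integrable \<phi> (\<lambda>x. x)" by (intro integrable_const_bound[of _ B]) auto
  have "norm (\<integral>x. x \<partial>\<phi>) \<le> (\<integral>x. norm x \<partial>\<phi>)" by (rule integral_norm_bound)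
  also have "\<dots> \<le> (\<integral>x. B \<partial>\<phi>)" using int bd by (intro integral_mono_AE) auto
  finally show "\<bar>\<integral>x. x \<partial>\<phi>\<bar> \<le> B" using prob_space by simp
qed

lemma (in grid) abs_mean_minus_step_le:
  assumes "real_distribution \<phi>" "measure \<phi> {- B..<B} = 1"
  shows "\<bar>(\<integral>x. x \<partial>\<phi>) - (\<integral>x. step x \<partial>\<phi>)\<bar> \<le> 2 * B / real N"
proof -
  interpret real_distribution \<phi> by fact
  note i = abs_mean_le_of_mass_one[OF assms B]
  have s: "integrable \<phi> step" by (rule integrable_const_bound[of _ B]) (use abs_step_le in auto)
  have bd: "AE x in \<phi>. norm (x - step x) \<le> 2 * B / real N"
    using i(3) by eventually_elim (simp add: step_close)
  have "(\<integral>x. x \<partial>\<phi>) - (\<integral>x. step x \<partial>\<phi>) = (\<integral>x. x - step x \<partial>\<phi>)"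
    using i(1) s by simp
  also have "norm \<dots> \<le> (\<integral>x. norm (x - step x) \<partial>\<phi>)" by (rule integral_norm_bound)
  also have "\<dots> \<le> (\<integral>x. 2 * B / real N \<partial>\<phi>)" using i(1) s bd by (intro integral_mono_AE) auto
  finally show ?thesis using prob_space by simp
qed

lemma (in grid) abs_integral_step_le:
  assumes "real_distribution \<phi>"
  shows "\<bar>\<integral>x. step x \<partial>\<phi>\<bar> \<le> B"
proof -
  interpret real_distribution \<phi> by fact
  have s: "integrable \<phi> step" by (rule integrable_const_bound[of _ B]) (use abs_step_le in auto)
  have "norm (\<integral>x. step x \<partial>\<phi>) \<le> (\<integral>x. norm (step x) \<partial>\<phi>)" by (rule integral_norm_bound)
  also have "\<dots> \<le> (\<integral>x. B \<partial>\<phi>)" using s abs_step_le by (intro integral_mono) auto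
  finally show ?thesis using prob_space by simp
qed

lemma (in grid) measurable_integral_step: "(\<lambda>\<phi>. \<integral>x. step x \<partial>\<phi>) \<in> borel_measurable weak_borel"
proof (subst measurable_cong)
  fix \<phi> assume "\<phi> \<in> space weak_borel"
  then interpret real_distribution \<phi> by (simp add: prob_measures_def)
  show "(\<integral>x. step x \<partial>\<phi>) = (\<Sum>j\<in>{1..N}. node j * measure \<phi> (cell j))"
    by (rule integral_step) (auto intro: finite_measure_axioms)
next
  show "(\<lambda>\<phi>. \<Sum>j\<in>{1..N}. node j * measure \<phi> (cell j)) \<in> borel_measurable weak_borel"
    using node_mono by (intro borel_measurable_sum borel_measurable_times borel_measurable_const)
      (simp add: cell_Ico measurable_measure_Ico)
qed

locale dirichlet_process =
  fixes \<alpha> :: "real measure" and D :: "real measure measure" and B :: real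
  assumes law: "dirichlet_process_law \<alpha> D" and \<alpha>_fin: "finite_borel_measure \<alpha>"
    and null: "measure \<alpha> (- {- B..<B}) = 0" and pos: "0 < measure \<alpha> UNIV" and B: "0 < B"
begin

sublocale \<alpha>: finite_borel_measure \<alpha> by (rule \<alpha>_fin)
sublocale D: prob_space D using law by (simp add: dirichlet_process_law_def)

definition moment :: "nat \<Rightarrow> real" where "moment k = (\<integral>\<phi>. (\<integral>x. x \<partial>\<phi>) ^ k \<partial>D)"

lemma sets_D [measurable_cong]: "sets D = sets weak_borel"
  using law by (simp add: dirichlet_process_law_def)

lemma space_D: "\<phi> \<in> space D \<Longrightarrow> real_distribution \<phi>"
  using sets_eq_imp_space_eq[OF sets_D] by (simp add: prob_measures_def)

lemma measurable_mean_D [measurable]: "(\<lambda>\<phi>. \<integral>x. x \<partial>\<phi>) \<in> borel_measurable D"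
  using measurable_mean by (simp cong: measurable_cong_sets)

lemma AE_mass: "AE \<phi> in D. measure \<phi> {- B..<B} = 1"
  using B by (intro AE_mass_one[OF law \<alpha>_fin null pos]) simp

lemma AE_abs_mean_le: "AE \<phi> in D. \<bar>\<integral>x. x \<partial>\<phi>\<bar> \<le> B"
  using AE_mass AE_space by eventually_elim (rule abs_mean_le_of_mass_one[OF space_D _ B])

lemma AE_abs_mean_power_le: "AE \<phi> in D. norm ((\<integral>x. x \<partial>\<phi>) ^ k) \<le> B ^ k"
  using AE_abs_mean_le by eventually_elim (simp add: power_abs power_mono)

lemma integrable_mean_power: "integrable D (\<lambda>\<phi>. (\<integral>x. x \<partial>\<phi>) ^ k)"
  by (rule D.integrable_const_bound[OF AE_abs_mean_power_le]) measurable

lemma abs_moment_le: "\<bar>moment k\<bar> \<le> B ^ k"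
proof -
  have "norm (moment k) \<le> (\<integral>\<phi>. norm ((\<integral>x. x \<partial>\<phi>) ^ k) \<partial>D)"
    unfolding moment_def by (rule integral_norm_bound)
  also have "\<dots> \<le> (\<integral>\<phi>. B ^ k \<partial>D)"
    by (rule integral_mono_AE) (use integrable_mean_power AE_abs_mean_power_le in auto)
  finally show ?thesis by (simp add: D.prob_space)
qed

lemma AE_\<alpha>: "AE x in \<alpha>. x \<in> {- B..<B}"
proof (rule AE_I)
  show "{x \<in> space \<alpha>. x \<notin> {- B..<B}} \<subseteq> - {- B..<B}" by auto
  show "emeasure \<alpha> (- {- B..<B}) = 0" using null by (simp add: \<alpha>.emeasure_eq_measure)
qed (simp add: \<alpha>.M_is_borel)

text \<open>Refine the grid in the identity for the discretised mean: the moments converge because the means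
  are uniformly close, the series by Tannery's theorem, and the integral of the logarithm by dominated
  convergence.\<close>

theorem generating_function_real:
  assumes c: "\<bar>c\<bar> * B < 1"
  shows "(\<lambda>k. pochhammer (measure \<alpha> UNIV) k / fact k * c ^ k * moment k) sums exp (- (\<integral>x. ln (1 - c * x) \<partial>\<alpha>))"
proof -
  define w where "w k = pochhammer (measure \<alpha> UNIV) k / fact k * c ^ k" for k
  define E where "E k n = (\<integral>\<phi>. (\<integral>x. grid.step B (Suc n) x \<partial>\<phi>) ^ k \<partial>D)" for k n
  have g: "grid B (Suc n)" for n using B by unfold_locales auto
  have sums: "(\<lambda>k. w k * E k n) sums exp (- (\<integral>x. ln (1 - c * grid.step B (Suc n) x) \<partial>\<alpha>))" for n
    unfolding w_def E_def by (rule grid.mean_step_moments[OF g law \<alpha>_fin null pos c])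
  have mesh: "(\<lambda>n. 2 * B / real (Suc n)) \<longlonglongrightarrow> 0" by real_asymp
  have meas: "(\<lambda>\<phi>. \<integral>x. grid.step B (Suc n) x \<partial>\<phi>) \<in> borel_measurable D" for n
    using grid.measurable_integral_step[OF g, of n] by (simp cong: measurable_cong_sets add: sets_D)
  note [measurable] = this grid.step_borel[OF g]
  have bd: "AE \<phi> in D. norm ((\<integral>x. grid.step B (Suc n) x \<partial>\<phi>) ^ k) \<le> B ^ k" for n k
    using AE_space by eventually_elim (simp add: power_abs power_mono grid.abs_integral_step_le[OF g space_D])
  have E_lim: "(\<lambda>n. E k n) \<longlonglongrightarrow> moment k" for k
    unfolding E_def moment_def
  proof (rule integral_dominated_convergence[where w = "\<lambda>_. B ^ k"])
    show "AE \<phi> in D. (\<lambda>n. (\<integral>x. grid.step B (Suc n) x \<partial>\<phi>) ^ k) \<longlonglongrightarrow> (\<integral>x. x \<partial>\<phi>) ^ k"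
      using AE_mass AE_space
    proof eventually_elim
      case (elim \<phi>)
      have "(\<lambda>n. (\<integral>x. x \<partial>\<phi>) - (\<integral>x. grid.step B (Suc n) x \<partial>\<phi>)) \<longlonglongrightarrow> 0"
        by (rule Lim_null_comparison[OF _ mesh])
          (use grid.abs_mean_minus_step_le[OF g space_D[OF elim(2)] elim(1)] in \<open>intro always_eventually allI, simp only: real_norm_def\<close>)
      from tendsto_diff[OF tendsto_const[of "\<integral>x. x \<partial>\<phi>"] this]
      have "(\<lambda>n. \<integral>x. grid.step B (Suc n) x \<partial>\<phi>) \<longlonglongrightarrow> (\<integral>x. x \<partial>\<phi>)" by simp
      then show ?case by (rule tendsto_power)
    qed
    show "AE \<phi> in D. norm ((\<integral>x. grid.step B (Suc n) x \<partial>\<phi>) ^ k) \<le> B ^ k" for n by (rule bd)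
  qed (rule borel_measurable_power[OF measurable_mean_D] borel_measurable_power[OF meas] | simp)+
  have E_bd: "\<bar>E k n\<bar> \<le> B ^ k" for k n
  proof -
    have "norm (E k n) \<le> (\<integral>\<phi>. norm ((\<integral>x. grid.step B (Suc n) x \<partial>\<phi>) ^ k) \<partial>D)"
      unfolding E_def by (rule integral_norm_bound)
    also have "\<dots> \<le> (\<integral>\<phi>. B ^ k \<partial>D)"
    proof (rule integral_mono_AE)
      show "integrable D (\<lambda>\<phi>. norm ((\<integral>x. grid.step B (Suc n) x \<partial>\<phi>) ^ k))"
        by (intro integrable_norm D.integrable_const_bound[OF bd] borel_measurable_power meas)
    qed (use bd in auto)
    finally show ?thesis by (simp add: D.prob_space)
  qed
  have summable: "summable (\<lambda>k. pochhammer (measure \<alpha> UNIV) k / fact k * (\<bar>c\<bar> * B) ^ k)"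
    using sums_pochhammer_powr[of "\<bar>c\<bar> * B"] c B by (auto simp: sums_iff abs_mult)
  have w_bd: "\<bar>w k * y\<bar> \<le> pochhammer (measure \<alpha> UNIV) k / fact k * (\<bar>c\<bar> * B) ^ k" if "\<bar>y\<bar> \<le> B ^ k" for k y
  proof -
    have p: "0 \<le> pochhammer (measure \<alpha> UNIV) k / fact k" using pos by (simp add: pochhammer_nonneg)
    have "\<bar>w k * y\<bar> = pochhammer (measure \<alpha> UNIV) k / fact k * (\<bar>c\<bar> ^ k * \<bar>y\<bar>)"
      by (simp only: w_def abs_mult abs_of_nonneg[OF p] power_abs mult.assoc)
    also have "\<dots> \<le> pochhammer (measure \<alpha> UNIV) k / fact k * (\<bar>c\<bar> ^ k * B ^ k)"
      using that by (intro mult_left_mono p) auto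
    finally show ?thesis by (simp add: power_mult_distrib)
  qed
  have "\<forall>\<^sub>F (k, n) in at_top \<times>\<^sub>F sequentially. norm (w k * E k n) \<le> pochhammer (measure \<alpha> UNIV) k / fact k * (\<bar>c\<bar> * B) ^ k"
    using w_bd E_bd by (intro always_eventually) auto
  from tannerys_theorem[OF tendsto_mult[OF tendsto_const E_lim] this summable]
  have "(\<lambda>n. \<Sum>k. w k * E k n) \<longlonglongrightarrow> (\<Sum>k. w k * moment k)" by simp
  moreover have "(\<lambda>n. \<Sum>k. w k * E k n) \<longlonglongrightarrow> exp (- (\<integral>x. ln (1 - c * x) \<partial>\<alpha>))"
    unfolding sums[THEN sums_unique, symmetric]
  proof (intro tendsto_exp tendsto_minus integral_dominated_convergence[where w = "\<lambda>_. - ln (1 - \<bar>c\<bar> * B)"])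
    show "AE x in \<alpha>. (\<lambda>n. ln (1 - c * grid.step B (Suc n) x)) \<longlonglongrightarrow> ln (1 - c * x)"
      using AE_\<alpha>
    proof eventually_elim
      case (elim x)
      have "(\<lambda>n. x - grid.step B (Suc n) x) \<longlonglongrightarrow> 0"
        by (rule Lim_null_comparison[OF _ mesh])
          (use grid.step_close[OF g elim] in \<open>intro always_eventually allI, simp only: real_norm_def\<close>)
      from tendsto_diff[OF tendsto_const[of x] this]
      have "(\<lambda>n. grid.step B (Suc n) x) \<longlonglongrightarrow> x" by simp
      moreover have "\<bar>c * x\<bar> \<le> \<bar>c\<bar> * B" unfolding abs_mult using elim by (intro mult_left_mono) auto
      then have "1 - c * x \<noteq> 0" using c by linarith
      ultimately show ?case by (intro tendsto_intros)
    qed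
    have ln_bd: "norm (ln (1 - y)) \<le> - ln (1 - r)" if "\<bar>y\<bar> \<le> r" "r < 1" for y r :: real
    proof -
      have "(1 - r) * (1 + r) \<le> 1" by (simp add: algebra_simps)
      then have "1 + r \<le> inverse (1 - r)" using that by (simp add: field_simps)
      then have "ln (1 + r) \<le> - ln (1 - r)" using that by (subst ln_inverse[symmetric]) auto
      moreover have "ln (1 - y) \<le> ln (1 + r)" "ln (1 - r) \<le> ln (1 - y)" using that by auto
      ultimately show ?thesis by (simp add: abs_le_iff)
    qed
    show "AE x in \<alpha>. norm (ln (1 - c * grid.step B (Suc n) x)) \<le> - ln (1 - \<bar>c\<bar> * B)" for n
      using grid.abs_step_le[OF g] by (intro AE_I2 ln_bd c) (auto simp: abs_mult intro!: mult_left_mono)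
  qed (use \<alpha>.M_is_borel in \<open>simp_all cong: measurable_cong_sets\<close>)
  ultimately have "(\<Sum>k. w k * moment k) = exp (- (\<integral>x. ln (1 - c * x) \<partial>\<alpha>))" by (rule LIMSEQ_unique)
  moreover have "summable (\<lambda>k. w k * moment k)"
    by (rule summable_comparison_test'[OF summable]) (use w_bd abs_moment_le in auto)
  ultimately show ?thesis unfolding w_def by (simp add: sums_iff)
qed

end

section \<open>Logarithmic potentials of compactly supported measures\<close>

locale compact_measure = finite_borel_measure \<alpha> for \<alpha> :: "real measure" +
  fixes S :: "real set"
  assumes compact_S: "compact S" and AE_S: "AE x in \<alpha>. x \<in> S"
begin

lemma borel_measurable_\<alpha>: "f \<in> borel_measurable borel \<Longrightarrow> f \<in> borel_measurable \<alpha>"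
  using M_is_borel by (simp cong: measurable_cong_sets)

lemma integrable_of_continuous:
  fixes f :: "real \<Rightarrow> complex"
  assumes "f \<in> borel_measurable borel" "continuous_on S f"
  shows "integrable \<alpha> f"
proof -
  have "bounded (f ` S)" using compact_S assms(2) compact_continuous_image compact_imp_bounded by blast
  then obtain C where C: "\<And>x. x \<in> S \<Longrightarrow> norm (f x) \<le> C" unfolding bounded_iff by blast
  have "AE x in \<alpha>. norm (f x) \<le> C" using AE_S by eventually_elim (rule C)
  then show ?thesis using borel_measurable_\<alpha>[OF assms(1)] by (rule integrable_const_bound)
qed

text \<open>The difference quotients are dominated by the supremum of the derivative over a compact
  neighbourhood of the point, times the compact set \<open>S\<close>.\<close>

lemma has_field_derivative_integral:
  fixes f f' :: "complex \<Rightarrow> real \<Rightarrow> complex"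
  assumes U: "open U" "w0 \<in> U"
    and der: "\<And>w x. w \<in> U \<Longrightarrow> x \<in> S \<Longrightarrow> ((\<lambda>w. f w x) has_field_derivative f' w x) (at w)"
    and cont': "continuous_on (U \<times> S) (\<lambda>(w, x). f' w x)"
    and cont: "\<And>w. w \<in> U \<Longrightarrow> continuous_on S (f w)"
    and meas: "\<And>w. f w \<in> borel_measurable borel" "\<And>w. f' w \<in> borel_measurable borel"
  shows "((\<lambda>w. \<integral>x. f w x \<partial>\<alpha>) has_field_derivative (\<integral>x. f' w0 x \<partial>\<alpha>)) (at w0)"
proof -
  obtain r where r: "0 < r" "cball w0 r \<subseteq> U" using U open_contains_cball by blast
  have "compact ((\<lambda>(w, x). f' w x) ` (cball w0 r \<times> S))"
    using r compact_S by (intro compact_continuous_image continuous_on_subset[OF cont'] compact_Times) auto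
  then have "bounded ((\<lambda>(w, x). f' w x) ` (cball w0 r \<times> S))" by (rule compact_imp_bounded)
  then obtain C where C0: "\<forall>v\<in>(\<lambda>(w, x). f' w x) ` (cball w0 r \<times> S). norm v \<le> C" unfolding bounded_iff by blast
  have C: "norm (f' w x) \<le> C" if "w \<in> cball w0 r" "x \<in> S" for w x
    by (rule bspec[OF C0], rule image_eqI[of _ _ "(w, x)"]) (use that in auto)
  have lip: "norm (f w x - f w0 x) \<le> C * norm (w - w0)" if "w \<in> cball w0 r" "x \<in> S" for w x
  proof (rule field_differentiable_bound[where S = "cball w0 r" and f = "\<lambda>w. f w x" and f' = "\<lambda>w. f' w x" and x = w and y = w0])
    show "((\<lambda>w. f w x) has_field_derivative f' v x) (at v within cball w0 r)" if "v \<in> cball w0 r" for v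
      using that r \<open>x \<in> S\<close> by (intro has_field_derivative_at_within[OF der]) auto
    show "cmod (f' v x) \<le> C" if "v \<in> cball w0 r" for v using that \<open>x \<in> S\<close> by (rule C)
  qed (use that r in simp_all)
  have int: "integrable \<alpha> (f w)" if "w \<in> U" for w by (rule integrable_of_continuous[OF meas(1) cont[OF that]])
  have "((\<lambda>h. ((\<integral>x. f (w0 + h) x \<partial>\<alpha>) - (\<integral>x. f w0 x \<partial>\<alpha>)) / h) \<longlongrightarrow> (\<integral>x. f' w0 x \<partial>\<alpha>)) (at 0)"
    unfolding tendsto_at_iff_sequentially
  proof (intro allI impI)
    fix X :: "nat \<Rightarrow> complex" assume X: "\<forall>i. X i \<in> UNIV - {0}" "X \<longlonglongrightarrow> 0"
    obtain N where N: "\<And>n. N \<le> n \<Longrightarrow> norm (X n) < r"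
      using LIMSEQ_D[OF X(2) r(1)] by auto
    have in_ball: "w0 + X (n + N) \<in> cball w0 r" for n using N[of "n + N"] by (simp add: dist_norm)
    then have inU: "w0 + X (n + N) \<in> U" for n using r by blast
    have "(\<lambda>n. \<integral>x. (f (w0 + X (n + N)) x - f w0 x) / X (n + N) \<partial>\<alpha>) \<longlonglongrightarrow> (\<integral>x. f' w0 x \<partial>\<alpha>)"
    proof (rule integral_dominated_convergence[where w = "\<lambda>_. C"])
      show "AE x in \<alpha>. (\<lambda>n. (f (w0 + X (n + N)) x - f w0 x) / X (n + N)) \<longlonglongrightarrow> f' w0 x"
        using AE_S
      proof eventually_elim
        case (elim x)
        have "((\<lambda>h. (f (w0 + h) x - f w0 x) / h) \<longlongrightarrow> f' w0 x) (at 0)"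
          using der[OF U(2) elim] by (simp add: DERIV_def)
        then have "(\<lambda>n. (f (w0 + X n) x - f w0 x) / X n) \<longlonglongrightarrow> f' w0 x"
          using X unfolding tendsto_at_iff_sequentially by (simp add: o_def)
        then show ?case by (rule LIMSEQ_ignore_initial_segment)
      qed
      show "AE x in \<alpha>. norm ((f (w0 + X (n + N)) x - f w0 x) / X (n + N)) \<le> C" for n
        using AE_S
      proof eventually_elim
        case (elim x)
        have "X (n + N) \<noteq> 0" using X(1) by auto
        then show ?case using lip[OF in_ball elim, of n] by (simp add: norm_divide pos_divide_le_eq)
      qed
    qed (use meas in \<open>auto intro!: borel_measurable_\<alpha>\<close>)
    moreover have "(\<integral>x. (f (w0 + X (n + N)) x - f w0 x) / X (n + N) \<partial>\<alpha>) =
        ((\<integral>x. f (w0 + X (n + N)) x \<partial>\<alpha>) - (\<integral>x. f w0 x \<partial>\<alpha>)) / X (n + N)" for n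
      using int[OF inU] int[OF U(2)] by simp
    ultimately have "(\<lambda>n. ((\<integral>x. f (w0 + X (n + N)) x \<partial>\<alpha>) - (\<integral>x. f w0 x \<partial>\<alpha>)) / X (n + N)) \<longlonglongrightarrow> (\<integral>x. f' w0 x \<partial>\<alpha>)"
      by (simp only:)
    then show "((\<lambda>h. ((\<integral>x. f (w0 + h) x \<partial>\<alpha>) - (\<integral>x. f w0 x \<partial>\<alpha>)) / h) \<circ> X) \<longlonglongrightarrow> (\<integral>x. f' w0 x \<partial>\<alpha>)"
      unfolding o_def by (rule LIMSEQ_offset)
  qed
  then show ?thesis by (simp add: DERIV_def)
qed

text \<open>The base point \<open>y\<close> is \<open>0\<close> in the integrand; a base point in the support yields the analytic
  continuation of the integrand when the mass is an integer.\<close>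

definition log_integral :: "real \<Rightarrow> complex \<Rightarrow> complex" where
  "log_integral y z = (\<integral>x. Ln (1 - z * of_real (x - y)) \<partial>\<alpha>)"

definition log_domain :: "real \<Rightarrow> complex set" where
  "log_domain y = {z. \<forall>x\<in>S. 1 - z * of_real (x - y) \<notin> \<real>\<^sub>\<le>\<^sub>0}"

lemma open_log_domain: "open (log_domain y)"
proof -
  have "closed {z::complex. \<exists>x. x \<in> S \<and> (x, z) \<in> {p. 1 - snd p * of_real (fst p - y) \<in> \<real>\<^sub>\<le>\<^sub>0}}"
  proof (rule closed_compact_projection[OF compact_S])
    have "closed ((\<lambda>p::real \<times> complex. 1 - snd p * of_real (fst p - y)) -` \<real>\<^sub>\<le>\<^sub>0)"
      by (intro closed_vimage closed_nonpos_Reals_complex continuous_intros)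
    then show "closed {p::real \<times> complex. 1 - snd p * of_real (fst p - y) \<in> \<real>\<^sub>\<le>\<^sub>0}"
      by (simp add: vimage_def)
  qed
  moreover have "log_domain y = - {z. \<exists>x. x \<in> S \<and> (x, z) \<in> {p. 1 - snd p * of_real (fst p - y) \<in> \<real>\<^sub>\<le>\<^sub>0}}"
    by (auto simp: log_domain_def)
  ultimately show ?thesis by (simp add: open_Compl)
qed

lemma measurable_Ln_linear: "(\<lambda>x::real. Ln (1 - z * of_real (x - y))) \<in> borel_measurable borel"
  by (rule measurable_compose[OF _ Ln_measurable]) measurable

lemma continuous_on_Ln_linear: "z \<in> log_domain y \<Longrightarrow> continuous_on S (\<lambda>x. Ln (1 - z * of_real (x - y)))"
  by (intro continuous_intros) (auto simp: log_domain_def)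

lemma integrable_Ln_linear: "z \<in> log_domain y \<Longrightarrow> integrable \<alpha> (\<lambda>x. Ln (1 - z * of_real (x - y)))"
  by (intro integrable_of_continuous measurable_Ln_linear continuous_on_Ln_linear)

lemma has_field_derivative_log_integral:
  assumes "z \<in> log_domain y"
  shows "(log_integral y has_field_derivative (\<integral>x. - of_real (x - y) / (1 - z * of_real (x - y)) \<partial>\<alpha>)) (at z)"
  unfolding log_integral_def
proof (rule has_field_derivative_integral[OF open_log_domain assms])
  have nz: "1 - z * of_real (x - y) \<noteq> 0" if "z \<in> log_domain y" "x \<in> S" for z x
    using that by (force simp: log_domain_def)
  show "((\<lambda>w. Ln (1 - w * of_real (x - y))) has_field_derivative - of_real (x - y) / (1 - z * of_real (x - y))) (at z)"
    if "z \<in> log_domain y" "x \<in> S" for z x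
    using that nz[OF that] by (auto intro!: derivative_eq_intros simp: log_domain_def divide_inverse)
  show "continuous_on (log_domain y \<times> S) (\<lambda>(z, x). - of_real (x - y) / (1 - z * of_real (x - y)))"
    unfolding split_beta' using nz by (intro continuous_intros) auto
  show "(\<lambda>x. - of_real (x - y) / (1 - z * of_real (x - y))) \<in> borel_measurable borel" for z :: complex
    by measurable
qed (intro continuous_on_Ln_linear measurable_Ln_linear, assumption?)+

lemma holomorphic_log_integral: "log_integral y holomorphic_on log_domain y"
  using has_field_derivative_log_integral holomorphic_on_open[OF open_log_domain] by blast

end

context compact_measure begin

lemma space_\<alpha>: "space \<alpha> = UNIV"
  using sets_eq_imp_space_eq[OF M_is_borel] by simp

text \<open>The modulus of \<open>exp (- \<integral> Ln)\<close> only involves \<open>ln\<close> of moduli.\<close>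

lemma norm_exp_log_integral_le:
  assumes z: "z \<in> log_domain y" and c: "0 < c" "\<And>x. x \<in> S \<Longrightarrow> c \<le> cmod (1 - z * of_real (x - y))"
  shows "cmod (exp (- log_integral y z)) \<le> c powr (- measure \<alpha> UNIV)"
proof -
  have "measure \<alpha> UNIV * ln c = (\<integral>x. ln c \<partial>\<alpha>)" by (simp add: space_\<alpha>)
  also have "\<dots> \<le> (\<integral>x. Re (Ln (1 - z * of_real (x - y))) \<partial>\<alpha>)"
  proof (rule integral_mono_AE)
    show "integrable \<alpha> (\<lambda>x. Re (Ln (1 - z * of_real (x - y))))" by (intro integrable_Re integrable_Ln_linear z)
    show "AE x in \<alpha>. ln c \<le> Re (Ln (1 - z * of_real (x - y)))"
      using AE_S
    proof eventually_elim
      case (elim x)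
      then have "0 < cmod (1 - z * of_real (x - y))" using c by force
      then show ?case using c(1) c(2)[OF elim] by (subst Re_Ln) auto
    qed
  qed simp
  also have "\<dots> = Re (log_integral y z)"
    unfolding log_integral_def by (rule integral_Re[OF integrable_Ln_linear[OF z]])
  finally show ?thesis using c(1) by (simp add: powr_def mult.commute)
qed

end

lemma has_field_derivative_powr_of_real:
  fixes w :: complex and a :: real
  assumes "w \<noteq> 0" "w \<notin> \<real>\<^sub>\<le>\<^sub>0 \<or> a \<in> \<nat>"
  shows "((\<lambda>w. w powr of_real a) has_field_derivative of_real a * w powr of_real a / w) (at w)"
proof (cases "a \<in> \<nat>")
  case True
  then obtain n where a: "a = real n" by (auto elim: Nats_cases)
  have powr_a: "v powr of_real a = v ^ n" if "v \<noteq> 0" for v :: complex using that by (simp add: a)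
  have "((\<lambda>w. w ^ n) has_field_derivative of_nat n * w ^ (n - 1)) (at w)"
    by (auto intro!: derivative_eq_intros)
  then have "((\<lambda>w. w powr of_real a) has_field_derivative of_nat n * w ^ (n - 1)) (at w)"
    by (rule has_field_derivative_transform_within_open[where S = "- {0}"]) (use assms(1) powr_a in auto)
  moreover have "of_nat n * w ^ (n - 1) = of_real a * w powr of_real a / w"
    unfolding powr_a[OF assms(1)] using assms(1) by (cases n) (simp_all add: a)
  ultimately show ?thesis by simp
next
  case False
  then have "w \<notin> \<real>\<^sub>\<le>\<^sub>0" using assms by blast
  then have "((\<lambda>w. w powr of_real a) has_field_derivative of_real a * w powr (of_real a - 1)) (at w)"
    by (rule has_field_derivative_powr)
  moreover have "w powr (of_real a - 1) = w powr of_real a / w" using assms(1) by (simp add: powr_diff)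
  ultimately show ?thesis by simp
qed

context compact_measure begin

text \<open>The integrand without its oscillating factor \<open>e\<^sup>w\<close>.\<close>

definition amplitude :: "real \<Rightarrow> complex \<Rightarrow> complex" where
  "amplitude t w = 1 / w powr of_real (measure \<alpha> UNIV) * exp (- log_integral 0 (\<i> * of_real t / w))"

lemma integrand_eq: "dirichlet_mean_integrand \<alpha> (measure \<alpha> UNIV) t w = exp w * amplitude t w"
  by (simp add: dirichlet_mean_integrand_def amplitude_def log_integral_def)

text \<open>The logarithms are evaluated off their cut unless \<open>w\<close> lies on a segment from \<open>0\<close> to some \<open>itx\<close>:
  if \<open>1 - itx/w = r \<le> 0\<close>, then \<open>w = itx / (1 - r)\<close>.\<close>

lemma in_log_domain:
  assumes "w \<noteq> 0" "\<And>x s. x \<in> S \<Longrightarrow> s \<in> {0..1} \<Longrightarrow> w \<noteq> \<i> * of_real t * of_real x * of_real s"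
  shows "\<i> * of_real t / w \<in> log_domain 0"
  unfolding log_domain_def
proof (intro CollectI ballI notI)
  fix x assume x: "x \<in> S" and "1 - \<i> * of_real t / w * of_real (x - 0) \<in> \<real>\<^sub>\<le>\<^sub>0"
  then obtain r where r: "r \<le> 0" "1 - \<i> * of_real t / w * of_real (x - 0) = of_real r"
    by (auto elim!: nonpos_Reals_cases)
  then have "\<i> * of_real t * of_real x = w * of_real (1 - r)"
    using assms(1) by (simp add: field_simps)
  then have "w = \<i> * of_real t * of_real x * of_real (1 / (1 - r))"
    using r(1) by (simp add: field_simps flip: of_real_diff)
  moreover have "1 / (1 - r) \<in> {0..1}" using r(1) by simp
  ultimately show False using assms(2)[OF x] by blast
qed

lemma in_log_domain_off_axis: "Re w \<noteq> 0 \<Longrightarrow> \<i> * of_real t / w \<in> log_domain 0"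
  by (rule in_log_domain) auto

lemma has_field_derivative_amplitude:
  assumes "w \<noteq> 0" "w \<notin> \<real>\<^sub>\<le>\<^sub>0 \<or> measure \<alpha> UNIV \<in> \<nat>" "\<i> * of_real t / w \<in> log_domain 0"
  shows "(amplitude t has_field_derivative
    - amplitude t w * (of_real (measure \<alpha> UNIV) / w + \<i> * of_real t / w\<^sup>2 * (\<integral>x. of_real x / (1 - \<i> * of_real t / w * of_real x) \<partial>\<alpha>))) (at w)"
proof -
  have E: "(\<integral>x. - of_real (x - 0) / (1 - \<i> * of_real t / w * of_real (x - 0)) \<partial>\<alpha>) =
      - (\<integral>x. of_real x / (1 - \<i> * of_real t / w * of_real x) \<partial>\<alpha>)"
    by (simp del: of_real_minus flip: integral_minus)
  have inv: "((\<lambda>w. \<i> * of_real t / w) has_field_derivative - \<i> * of_real t / w\<^sup>2) (at w)"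
    using assms(1) by (auto intro!: derivative_eq_intros simp: power2_eq_square)
  have l: "((\<lambda>w. log_integral 0 (\<i> * of_real t / w)) has_field_derivative
     - (\<integral>x. of_real x / (1 - \<i> * of_real t / w * of_real x) \<partial>\<alpha>) * (- \<i> * of_real t / w\<^sup>2)) (at w)"
    using DERIV_chain2[OF has_field_derivative_log_integral[OF assms(3)] inv] unfolding E .
  have nz: "w powr of_real (measure \<alpha> UNIV) \<noteq> 0" using assms(1) by simp
  show ?thesis
    unfolding amplitude_def
    by (rule derivative_eq_intros has_field_derivative_powr_of_real[OF assms(1,2)] l nz refl)+
      (use nz assms(1) in \<open>simp add: field_simps power2_eq_square\<close>)
qed

lemma holomorphic_integrand:
  "dirichlet_mean_integrand \<alpha> (measure \<alpha> UNIV) t holomorphic_on - integrand_cuts t S"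
proof -
  have "amplitude t field_differentiable at w" if "w \<in> - integrand_cuts t S" for w
  proof -
    have w: "w \<notin> \<real>\<^sub>\<le>\<^sub>0" using that by (auto simp: integrand_cuts_def)
    then have "w \<noteq> 0" by auto
    moreover have "\<i> * of_real t / w \<in> log_domain 0"
      using that \<open>w \<noteq> 0\<close> by (intro in_log_domain) (auto simp: integrand_cuts_def)
    ultimately show ?thesis
      using has_field_derivative_amplitude w unfolding field_differentiable_def by blast
  qed
  then have "amplitude t holomorphic_on - integrand_cuts t S"
    by (auto simp: holomorphic_on_def intro: field_differentiable_at_within)
  then have "(\<lambda>w. exp w * amplitude t w) holomorphic_on - integrand_cuts t S"
    by (intro holomorphic_intros)
  then show ?thesis by (simp add: integrand_eq[abs_def])
qed

lemma holomorphic_integrand_half_plane: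
  "dirichlet_mean_integrand \<alpha> (measure \<alpha> UNIV) t holomorphic_on {w. 0 < Re w}"
  by (rule holomorphic_on_subset[OF holomorphic_integrand]) (auto simp: integrand_cuts_def complex_nonpos_Reals_iff)

end

section \<open>The generating function of the moments\<close>

locale dirichlet_mean = dirichlet_process \<alpha> D B + compact_measure \<alpha> S for \<alpha> D B S +
  assumes S_bound: "S \<subseteq> {- B..B}"
begin

lemma abs_S_le: "x \<in> S \<Longrightarrow> \<bar>x\<bar> \<le> B"
  using S_bound by (force simp: abs_le_iff)

abbreviation mass :: real where "mass \<equiv> measure \<alpha> UNIV"

definition coefficient :: "nat \<Rightarrow> real" where
  "coefficient k = pochhammer mass k / fact k * moment k"

lemma abs_coefficient_le: "\<bar>coefficient k\<bar> \<le> pochhammer mass k / fact k * B ^ k"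
proof -
  have "0 \<le> pochhammer mass k / fact k" using pos by (simp add: pochhammer_nonneg)
  then show ?thesis unfolding coefficient_def abs_mult by (simp only: abs_of_nonneg mult_left_mono[OF abs_moment_le])
qed

lemma summable_weights: "0 \<le> r \<Longrightarrow> r < 1 \<Longrightarrow> summable (\<lambda>k. pochhammer mass k / fact k * r ^ k)"
  using sums_pochhammer_powr[of r mass] by (auto simp: sums_iff)

lemma norm_coefficient_power_le: "cmod (of_real (coefficient k) * z ^ k) \<le> pochhammer mass k / fact k * (B * cmod z) ^ k"
proof -
  have "cmod (of_real (coefficient k) * z ^ k) = \<bar>coefficient k\<bar> * cmod z ^ k" by (simp add: norm_mult norm_power)
  also have "\<dots> \<le> (pochhammer mass k / fact k * B ^ k) * cmod z ^ k" by (intro mult_right_mono abs_coefficient_le) simp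
  finally show ?thesis by (simp add: power_mult_distrib)
qed

lemma summable_coefficient_power: "cmod z * B < 1 \<Longrightarrow> summable (\<lambda>k. of_real (coefficient k) * z ^ k :: complex)"
  using B by (intro summable_comparison_test'[OF summable_weights[of "B * cmod z"] norm_coefficient_power_le]) (auto simp: mult.commute)

lemma small_in_log_domain: "cmod z * B < 1 \<Longrightarrow> z \<in> log_domain 0"
  unfolding log_domain_def
proof (intro CollectI ballI)
  fix x assume "cmod z * B < 1" "x \<in> S"
  then have "cmod (z * of_real (x - 0)) \<le> cmod z * B"
    using abs_S_le by (auto simp: norm_mult intro!: mult_left_mono)
  then have "0 < Re (1 - z * of_real (x - 0))"
    using \<open>cmod z * B < 1\<close> complex_Re_le_cmod[of "z * of_real (x - 0)"] by simp
  then show "1 - z * of_real (x - 0) \<notin> \<real>\<^sub>\<le>\<^sub>0" by (rule Re_pos_notin_nonpos_Reals)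
qed

text \<open>On the real axis this is the Markov-Krein identity for the moments; both sides are analytic in a disc.\<close>

lemma generating_function:
  assumes z: "cmod z * B < 1"
  shows "(\<lambda>k. of_real (coefficient k) * z ^ k) sums exp (- log_integral 0 z)"
proof -
  define P where "P z = (\<Sum>k. of_real (coefficient k) * z ^ k)" for z :: complex
  have ball: "w \<in> ball 0 (1 / B) \<longleftrightarrow> cmod w * B < 1" for w :: complex
    using B by (simp add: pos_less_divide_eq)
  have P_sums: "(\<lambda>k. of_real (coefficient k) * w ^ k) sums P w" if "cmod w * B < 1" for w
    unfolding P_def by (rule summable_sums[OF summable_coefficient_power[OF that]])
  have hol_P: "P holomorphic_on ball 0 (1 / B)"
    by (rule power_series_holomorphic) (use P_sums ball in simp)
  have hol_E: "(\<lambda>z. exp (- log_integral 0 z)) holomorphic_on ball 0 (1 / B)"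
    using small_in_log_domain ball by (intro holomorphic_intros holomorphic_on_subset[OF holomorphic_log_integral]) blast
  have real: "P (of_real c) = exp (- log_integral 0 (of_real c))" if c: "0 < c" "c < 1 / B" for c :: real
  proof -
    have cB: "\<bar>c\<bar> * B < 1" using c B by (simp add: pos_less_divide_eq)
    have "log_integral 0 (of_real c) = (\<integral>x. of_real (ln (1 - c * x)) \<partial>\<alpha>)"
      unfolding log_integral_def
    proof (rule integral_cong_AE)
      show "AE x in \<alpha>. Ln (1 - of_real c * of_real (x - 0)) = of_real (ln (1 - c * x))"
        using AE_S
      proof eventually_elim
        case (elim x)
        then have "c * x \<le> c * B" using abs_S_le[of x] c by (intro mult_left_mono) auto
        moreover have "c * B < 1" using cB c by simp
        ultimately have "0 < 1 - c * x" by linarith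
        then have "Ln (of_real (1 - c * x)) = of_real (ln (1 - c * x))" by (rule Ln_of_real)
        then show ?case by simp
      qed
      show "(\<lambda>x. Ln (1 - of_real c * of_real (x - 0))) \<in> borel_measurable \<alpha>"
        by (rule borel_measurable_\<alpha>[OF measurable_Ln_linear])
      show "(\<lambda>x. complex_of_real (ln (1 - c * x))) \<in> borel_measurable \<alpha>"
        by (rule borel_measurable_\<alpha>) measurable
    qed
    also have "\<dots> = of_real (\<integral>x. ln (1 - c * x) \<partial>\<alpha>)" by (rule integral_complex_of_real)
    finally have E: "exp (- log_integral 0 (of_real c)) = of_real (exp (- (\<integral>x. ln (1 - c * x) \<partial>\<alpha>)))"
      by (simp add: exp_of_real[symmetric])
    have "(\<lambda>k. complex_of_real (coefficient k * c ^ k)) sums of_real (exp (- (\<integral>x. ln (1 - c * x) \<partial>\<alpha>)))"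
      using generating_function_real[OF cB] unfolding sums_of_real_iff by (simp add: coefficient_def mult_ac)
    then have "(\<lambda>k. of_real (coefficient k) * of_real c ^ k) sums exp (- log_integral 0 (of_real c))"
      unfolding E by simp
    moreover have "cmod (of_real c) * B < 1" using cB by simp
    ultimately show ?thesis using P_sums sums_unique2 by blast
  qed
  have "P z - exp (- log_integral 0 z) = 0"
  proof (rule analytic_continuation[of "\<lambda>z. P z - exp (- log_integral 0 z)" "ball 0 (1 / B)" "of_real ` {0<..<1 / B}" 0])
    show "(\<lambda>z. P z - exp (- log_integral 0 z)) holomorphic_on ball 0 (1 / B)"
      by (intro holomorphic_intros hol_P hol_E)
    show "0 islimpt (complex_of_real ` {0<..<1 / B})"
      unfolding islimpt_approachable
    proof (intro allI impI)
      fix e :: real assume "0 < e"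
      define m where "m = min e (1 / B)"
      define c where "c = m / 2"
      have "m \<le> e" "m \<le> 1 / B" "0 < m" using \<open>0 < e\<close> B by (auto simp: m_def)
      then have c: "0 < c" "c < e" "c < 1 / B" by (auto simp: c_def)
      then show "\<exists>x'\<in>complex_of_real ` {0<..<1 / B}. x' \<noteq> 0 \<and> dist x' 0 < e"
        by (intro bexI[of _ "of_real c"]) auto
    qed
  qed (use B z real ball in auto)
  then show ?thesis using P_sums[OF z] by simp
qed

lemma characteristic_function:
  "(\<lambda>k. (\<i> * of_real t) ^ k / fact k * of_real (moment k)) sums (\<integral>\<phi>. exp (\<i> * of_real t * of_real (\<integral>x. x \<partial>\<phi>)) \<partial>D)"
proof -
  define f :: "nat \<Rightarrow> real measure \<Rightarrow> complex" where
    "f k \<phi> = (\<i> * of_real t) ^ k / fact k * of_real ((\<integral>x. x \<partial>\<phi>) ^ k)" for k \<phi>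
  have int: "integrable D (f k)" for k
    unfolding f_def by (intro integrable_mult_right integrable_of_real integrable_mean_power)
  have val: "(\<integral>\<phi>. f k \<phi> \<partial>D) = (\<i> * of_real t) ^ k / fact k * of_real (moment k)" for k
    by (simp add: f_def moment_def del: of_real_power)
  have e: "f k \<phi> = (\<i> * of_real t * of_real (\<integral>x. x \<partial>\<phi>)) ^ k /\<^sub>R fact k" for k \<phi>
    by (simp add: f_def power_mult_distrib scaleR_conv_of_real divide_inverse)
  have "(\<lambda>k. \<integral>\<phi>. f k \<phi> \<partial>D) sums (\<integral>\<phi>. (\<Sum>k. f k \<phi>) \<partial>D)"
  proof (rule sums_integral[OF int])
    show "AE \<phi> in D. summable (\<lambda>k. norm (f k \<phi>))"
      unfolding e by (intro AE_I2 summable_norm_exp)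
    show "summable (\<lambda>k. \<integral>\<phi>. norm (f k \<phi>) \<partial>D)"
    proof (rule summable_comparison_test')
      show "summable (\<lambda>k. (\<bar>t\<bar> * B) ^ k /\<^sub>R fact k)" by (rule summable_exp_generic)
      show "norm (\<integral>\<phi>. norm (f k \<phi>) \<partial>D) \<le> (\<bar>t\<bar> * B) ^ k /\<^sub>R fact k" for k
      proof -
        have "(\<integral>\<phi>. norm (f k \<phi>) \<partial>D) \<le> (\<integral>\<phi>. \<bar>t\<bar> ^ k / fact k * B ^ k \<partial>D)"
        proof (rule integral_mono_AE)
          show "AE \<phi> in D. norm (f k \<phi>) \<le> \<bar>t\<bar> ^ k / fact k * B ^ k"
            using AE_abs_mean_power_le[of k]
            by eventually_elim (auto simp: f_def norm_mult norm_divide norm_power power_abs intro!: mult_left_mono divide_right_mono)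
        qed (use int in auto)
        then show ?thesis by (simp add: D.prob_space power_mult_distrib divide_inverse mult_ac)
      qed
    qed
  qed
  moreover have "(\<Sum>k. f k \<phi>) = exp (\<i> * of_real t * of_real (\<integral>x. x \<partial>\<phi>))" for \<phi>
    unfolding e by (simp add: exp_def)
  ultimately show ?thesis by (simp only: val)
qed

end

section \<open>The principal value integral along a vertical line\<close>

context dirichlet_mean begin

abbreviation integrand :: "real \<Rightarrow> complex \<Rightarrow> complex" where
  "integrand \<equiv> dirichlet_mean_integrand \<alpha> mass"

abbreviation characteristic :: "real \<Rightarrow> complex" where
  "characteristic t \<equiv> (\<integral>\<phi>. exp (\<i> * of_real t * of_real (\<integral>x. x \<partial>\<phi>)) \<partial>D)"

text \<open>The value of the two contour integrals.\<close>

definition loop_value :: "real \<Rightarrow> complex" where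
  "loop_value t = 2 * of_real pi * \<i> / of_real (Gamma mass) * characteristic t"

lemma characteristic_eq: "characteristic t = of_real (Gamma mass) / (2 * of_real pi * \<i>) * loop_value t"
  using Gamma_real_pos[OF pos] by (simp add: loop_value_def)

lemma powr_minus_add_nat:
  fixes w :: complex
  assumes "w \<noteq> 0"
  shows "w powr (- of_real (mass + real k)) = (1 / w) ^ k * (1 / w powr of_real mass)"
proof -
  have "w powr (- of_real (mass + real k)) = inverse (w powr of_real mass * w powr of_nat k)"
    unfolding of_real_add of_real_of_nat_eq by (simp only: powr_minus powr_add)
  then show ?thesis using assms by (simp add: power_inverse divide_inverse)
qed

lemma integrand_sums:
  assumes w: "\<bar>t\<bar> * B < cmod w"
  shows "(\<lambda>k. of_real (coefficient k) * (\<i> * of_real t) ^ k * (exp w * w powr (- of_real (mass + real k)))) sums integrand t w"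
proof -
  have w0: "w \<noteq> 0" using w B by (auto simp: mult_less_0_iff)
  have "cmod (\<i> * of_real t / w) * B < 1" using w w0 by (simp add: norm_divide norm_mult field_simps)
  from sums_mult[OF generating_function[OF this], of "exp w * (1 / w powr of_real mass)"]
  have "(\<lambda>k. exp w * (1 / w powr of_real mass) * (of_real (coefficient k) * (\<i> * of_real t / w) ^ k)) sums integrand t w"
    by (simp add: integrand_eq amplitude_def mult.assoc)
  also have "(\<lambda>k. exp w * (1 / w powr of_real mass) * (of_real (coefficient k) * (\<i> * of_real t / w) ^ k)) =
      (\<lambda>k. of_real (coefficient k) * (\<i> * of_real t) ^ k * (exp w * w powr (- of_real (mass + real k))))"
    unfolding powr_minus_add_nat[OF w0] by (simp add: fun_eq_iff power_divide mult_ac)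
  finally show ?thesis .
qed

text \<open>Expand the integrand in powers of \<open>1/w\<close> and integrate term by term with Hankel's formula. The terms
  with \<open>k \<ge> 1\<close> are absolutely integrable and summable along the line; the term with \<open>k = 0\<close> is in general only
  conditionally integrable and is split off. Since \<open>\<Gamma>(a) pochhammer a k = \<Gamma>(a) \<Gamma>(a + k) / \<Gamma>(a)\<close>, the factor
  \<open>1 / \<Gamma>(a + k)\<close> produced by the integral leaves just the exponential series of the moments.\<close>

lemma vertical_limit_far:
  assumes \<gamma>: "\<bar>t\<bar> * B < \<gamma>" "0 < \<gamma>"
  shows "((\<lambda>R. contour_integral (vline \<gamma> R) (integrand t)) \<longlongrightarrow> loop_value t) at_top"
proof -
  define e where "e k w = exp w * w powr (- of_real (mass + real k))" for k and w :: complex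
  define c where "c k = of_real (coefficient k) * (\<i> * of_real t) ^ k" for k
  have far: "\<bar>t\<bar> * B < cmod (Complex \<gamma> y)" for y
    using \<gamma> complex_Re_le_cmod[of "Complex \<gamma> y"] by simp
  have sums: "(\<lambda>k. c k * e k (Complex \<gamma> y)) sums integrand t (Complex \<gamma> y)" for y
    unfolding c_def e_def using integrand_sums[OF far] by (simp only: mult.assoc)
  have hank: "((\<lambda>R. contour_integral (vline \<gamma> R) (e k)) \<longlongrightarrow> 2 * of_real pi * \<i> / of_real (Gamma (mass + real k))) at_top" for k
    unfolding e_def[abs_def] using pos \<gamma> by (intro Hankel_vertical) auto
  have e_cont: "continuous_on UNIV (\<lambda>y. e (Suc k) (Complex \<gamma> y))" and e_int: "integrable lborel (\<lambda>y. e (Suc k) (Complex \<gamma> y))" for k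
    unfolding e_def using pos \<gamma> by (intro vertical_line_exp_powr; simp)+
  have e_val: "\<i> * (LBINT y. e (Suc k) (Complex \<gamma> y)) = 2 * of_real pi * \<i> / of_real (Gamma (mass + real (Suc k)))" for k
    by (rule tendsto_unique[OF _ contour_integral_vline_tendsto[OF e_cont e_int] hank]) simp
  define J where "J = (LBINT y. cmod (e 1 (Complex \<gamma> y)))"
  have J0: "0 \<le> J" unfolding J_def by simp
  have e_norm: "cmod (e (Suc k) (Complex \<gamma> y)) \<le> cmod (e 1 (Complex \<gamma> y)) * (1 / \<gamma>) ^ k" for k y
  proof -
    have nz: "Complex \<gamma> y \<noteq> 0" using \<gamma> by (auto simp: complex_eq_iff)
    have ge: "\<gamma> \<le> cmod (Complex \<gamma> y)" using complex_Re_le_cmod[of "Complex \<gamma> y"] by simp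
    have "cmod (e (Suc k) (Complex \<gamma> y)) = cmod (e 1 (Complex \<gamma> y)) * (1 / cmod (Complex \<gamma> y)) ^ k"
      unfolding e_def powr_minus_add_nat[OF nz] by (simp add: norm_mult norm_divide norm_power power_divide)
    also have "\<dots> \<le> cmod (e 1 (Complex \<gamma> y)) * (1 / \<gamma>) ^ k"
      using ge \<gamma> by (intro mult_left_mono power_mono divide_left_mono mult_pos_pos) auto
    finally show ?thesis .
  qed
  define f1 where "f1 w = integrand t w - c 0 * e 0 w" for w
  have f1_sum: "f1 (Complex \<gamma> y) = (\<Sum>k. c (Suc k) * e (Suc k) (Complex \<gamma> y))" for y
    using sums_split_initial_segment[OF sums, of 1 y] unfolding f1_def by (simp add: sums_iff)
  have int_k: "integrable lborel (\<lambda>y. c (Suc k) * e (Suc k) (Complex \<gamma> y))" for k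
    by (intro integrable_mult_right e_int)
  have norm_c: "cmod (c k) \<le> pochhammer mass k / fact k * (\<bar>t\<bar> * B) ^ k" for k
    using norm_coefficient_power_le[of k "\<i> * of_real t"] unfolding c_def by (simp add: norm_mult mult.commute)
  have summ1: "AE y in lborel. summable (\<lambda>k. norm (c (Suc k) * e (Suc k) (Complex \<gamma> y)))"
    and summ2: "summable (\<lambda>k. LBINT y. norm (c (Suc k) * e (Suc k) (Complex \<gamma> y)))"
  proof -
    define m where "m k = pochhammer mass (Suc k) / fact (Suc k) * (\<bar>t\<bar> * B / \<gamma>) ^ Suc k * \<gamma>" for k
    have m_sum: "summable m"
    proof -
      have "summable (\<lambda>k. pochhammer mass k / fact k * (\<bar>t\<bar> * B / \<gamma>) ^ k)"
        using \<gamma> B by (intro summable_weights) (auto simp: pos_divide_less_eq)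
      then have "summable (\<lambda>k. pochhammer mass (Suc k) / fact (Suc k) * (\<bar>t\<bar> * B / \<gamma>) ^ Suc k)"
        by (subst summable_Suc_iff)
      then show ?thesis unfolding m_def by (rule summable_mult2)
    qed
    have le: "norm (c (Suc k) * e (Suc k) (Complex \<gamma> y)) \<le> m k * cmod (e 1 (Complex \<gamma> y))" for k y
    proof -
      have pw: "(\<bar>t\<bar> * B / \<gamma>) ^ Suc k * \<gamma> = (\<bar>t\<bar> * B) ^ Suc k * (1 / \<gamma>) ^ k"
        using \<gamma> by (simp add: power_divide)
      have "norm (c (Suc k) * e (Suc k) (Complex \<gamma> y)) \<le>
          (pochhammer mass (Suc k) / fact (Suc k) * (\<bar>t\<bar> * B) ^ Suc k) * (cmod (e 1 (Complex \<gamma> y)) * (1 / \<gamma>) ^ k)"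
        unfolding norm_mult by (intro mult_mono norm_c e_norm order_trans[OF norm_ge_zero norm_c]) simp
      also have "\<dots> = pochhammer mass (Suc k) / fact (Suc k) * ((\<bar>t\<bar> * B) ^ Suc k * (1 / \<gamma>) ^ k) * cmod (e 1 (Complex \<gamma> y))"
        by (simp only: mult_ac)
      also have "\<dots> = m k * cmod (e 1 (Complex \<gamma> y))"
        unfolding pw[symmetric] m_def by (simp only: mult_ac)
      finally show ?thesis .
    qed
    show "AE y in lborel. summable (\<lambda>k. norm (c (Suc k) * e (Suc k) (Complex \<gamma> y)))"
    proof (rule AE_I2)
      fix y
      show "summable (\<lambda>k. norm (c (Suc k) * e (Suc k) (Complex \<gamma> y)))"
        by (rule summable_comparison_test'[OF summable_mult2[OF m_sum]]) (use le in simp)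
    qed
    show "summable (\<lambda>k. LBINT y. norm (c (Suc k) * e (Suc k) (Complex \<gamma> y)))"
    proof (rule summable_comparison_test'[OF summable_mult2[OF m_sum]])
      fix k
      have "(LBINT y. norm (c (Suc k) * e (Suc k) (Complex \<gamma> y))) \<le> (LBINT y. m k * cmod (e 1 (Complex \<gamma> y)))"
      proof (intro integral_mono le integrable_norm[OF int_k])
        show "integrable lborel (\<lambda>y. m k * cmod (e 1 (Complex \<gamma> y)))"
          using e_int[of 0] by (intro integrable_mult_right integrable_norm) simp
      qed
      then show "norm (LBINT y. norm (c (Suc k) * e (Suc k) (Complex \<gamma> y))) \<le> m k * J"
        by (simp add: J_def)
    qed
  qed
  have f1_int: "integrable lborel (\<lambda>y. f1 (Complex \<gamma> y))"
    unfolding f1_sum by (rule integrable_suminf[OF int_k summ1 summ2])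
  have f1_sums: "(\<lambda>k. LBINT y. c (Suc k) * e (Suc k) (Complex \<gamma> y)) sums (LBINT y. f1 (Complex \<gamma> y))"
    unfolding f1_sum by (rule sums_integral[OF int_k summ1 summ2])
  have cont_line: "continuous_on UNIV (\<lambda>y. g (Complex \<gamma> y))" if "g holomorphic_on {w. 0 < Re w}" for g
    using \<gamma> by (intro continuous_on_compose2[OF holomorphic_on_imp_continuous_on[OF that]] continuous_intros) auto
  have e0_hol: "e 0 holomorphic_on {w. 0 < Re w}" unfolding e_def[abs_def] by (rule holomorphic_exp_powr)
  have f1_cont: "continuous_on UNIV (\<lambda>y. f1 (Complex \<gamma> y))"
    unfolding f1_def by (intro continuous_intros cont_line holomorphic_integrand_half_plane e0_hol)
  have "((\<lambda>R. contour_integral (vline \<gamma> R) f1 + c 0 * contour_integral (vline \<gamma> R) (e 0)) \<longlongrightarrow>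
      \<i> * (LBINT y. f1 (Complex \<gamma> y)) + c 0 * (2 * of_real pi * \<i> / of_real (Gamma (mass + real 0)))) at_top"
    by (intro tendsto_intros contour_integral_vline_tendsto f1_cont f1_int hank)
  moreover have "contour_integral (vline \<gamma> R) f1 + c 0 * contour_integral (vline \<gamma> R) (e 0) = contour_integral (vline \<gamma> R) (integrand t)"
    if "0 < R" for R
  proof -
    have i1: "f1 contour_integrable_on vline \<gamma> R" by (rule contour_integral_vline(1)[OF that f1_cont])
    have i2: "e 0 contour_integrable_on vline \<gamma> R" by (rule contour_integral_vline(1)[OF that cont_line[OF e0_hol]])
    have "contour_integral (vline \<gamma> R) (\<lambda>w. f1 w + c 0 * e 0 w) = contour_integral (vline \<gamma> R) f1 + c 0 * contour_integral (vline \<gamma> R) (e 0)"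
      using i1 i2 by (simp add: contour_integral_add contour_integrable_lmul contour_integral_lmul)
    then show ?thesis by (simp add: f1_def[abs_def])
  qed
  then have "\<forall>\<^sub>F R in at_top. contour_integral (vline \<gamma> R) f1 + c 0 * contour_integral (vline \<gamma> R) (e 0) = contour_integral (vline \<gamma> R) (integrand t)"
    using eventually_gt_at_top[of 0] by (rule eventually_mono[rotated])
  ultimately have lim: "((\<lambda>R. contour_integral (vline \<gamma> R) (integrand t)) \<longlongrightarrow>
      \<i> * (LBINT y. f1 (Complex \<gamma> y)) + c 0 * (2 * of_real pi * \<i> / of_real (Gamma (mass + real 0)))) at_top"
    by (rule Lim_transform_eventually)
  have "(\<lambda>k. \<i> * (LBINT y. c (Suc k) * e (Suc k) (Complex \<gamma> y))) sums (\<i> * (LBINT y. f1 (Complex \<gamma> y)))"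
    by (rule sums_mult[OF f1_sums])
  moreover have "\<i> * (LBINT y. c (Suc k) * e (Suc k) (Complex \<gamma> y)) = c (Suc k) * (2 * of_real pi * \<i> / of_real (Gamma (mass + real (Suc k))))" for k
    unfolding e_val[symmetric] by simp
  ultimately have "(\<lambda>k. c (Suc k) * (2 * of_real pi * \<i> / of_real (Gamma (mass + real (Suc k))))) sums (\<i> * (LBINT y. f1 (Complex \<gamma> y)))"
    by (simp only:)
  then have "(\<lambda>k. c k * (2 * of_real pi * \<i> / of_real (Gamma (mass + real k)))) sums
      (\<i> * (LBINT y. f1 (Complex \<gamma> y)) + c 0 * (2 * of_real pi * \<i> / of_real (Gamma (mass + real 0))))"
    by (rule sums_Suc)
  moreover have "c k * (2 * of_real pi * \<i> / of_real (Gamma (mass + real k))) =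
      2 * of_real pi * \<i> / of_real (Gamma mass) * ((\<i> * of_real t) ^ k / fact k * of_real (moment k))" for k
  proof -
    have "0 < Gamma mass" "0 < Gamma (mass + real k)"
      using pos by (intro Gamma_real_pos; simp)+
    then have G: "Gamma mass \<noteq> 0" "Gamma (mass + real k) \<noteq> 0"
      by simp_all
    have "pochhammer mass k = Gamma (mass + real k) / Gamma mass"
      using pos nonpos_Ints_nonpos[of mass] by (intro pochhammer_Gamma) linarith
    then have "coefficient k / Gamma (mass + real k) = moment k / (fact k * Gamma mass)"
      unfolding coefficient_def using G by simp
    then have "complex_of_real (coefficient k / Gamma (mass + real k)) = of_real (moment k / (fact k * Gamma mass))"
      by (rule arg_cong)
    then have q: "complex_of_real (coefficient k) / of_real (Gamma (mass + real k)) = of_real (moment k) / (fact k * of_real (Gamma mass))"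
      by (simp only: of_real_divide of_real_mult of_real_fact)
    have "c k * (2 * of_real pi * \<i> / of_real (Gamma (mass + real k))) =
       (\<i> * of_real t) ^ k * (2 * of_real pi * \<i>) * (of_real (coefficient k) / of_real (Gamma (mass + real k)))"
      by (simp only: c_def divide_inverse mult_ac)
    also have "\<dots> = 2 * of_real pi * \<i> / of_real (Gamma mass) * ((\<i> * of_real t) ^ k / fact k * of_real (moment k))"
      unfolding q by (simp add: mult_ac)
    finally show ?thesis .
  qed
  ultimately have "(\<lambda>k. 2 * of_real pi * \<i> / of_real (Gamma mass) * ((\<i> * of_real t) ^ k / fact k * of_real (moment k))) sums
      (\<i> * (LBINT y. f1 (Complex \<gamma> y)) + c 0 * (2 * of_real pi * \<i> / of_real (Gamma (mass + real 0))))"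
    by (simp only:)
  from sums_unique2[OF this sums_mult[OF characteristic_function]] lim show ?thesis
    by (simp only: loop_value_def)
qed

text \<open>In \<open>1 - itx/w = (w - itx)/w\<close> the numerator has modulus at least \<open>\<delta>\<close>, and the denominator exceeds it by
  at most \<open>|t| B\<close>, so the quotient is bounded away from \<open>0\<close> uniformly in the half-plane \<open>Re w \<ge> \<delta>\<close>.\<close>

lemma norm_integrand_half_plane_le:
  assumes "0 < \<delta>" "\<delta> \<le> Re w" "Re w \<le> x"
  shows "cmod (integrand t w) \<le> exp x * (\<delta> / (\<delta> + \<bar>t\<bar> * B)) powr (- mass) * ((min 1 \<delta> / 2) powr (- mass) * (1 + \<bar>Im w\<bar>) powr (- mass))"
proof -
  have w0: "w \<noteq> 0" using assms by auto
  have tB: "0 \<le> \<bar>t\<bar> * B" using B by simp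
  have "cmod (exp (- log_integral 0 (\<i> * of_real t / w))) \<le> (\<delta> / (\<delta> + \<bar>t\<bar> * B)) powr (- mass)"
  proof (rule norm_exp_log_integral_le)
    show "\<i> * of_real t / w \<in> log_domain 0" using assms by (intro in_log_domain_off_axis) auto
    show "0 < \<delta> / (\<delta> + \<bar>t\<bar> * B)" using assms tB by simp
    fix x assume x: "x \<in> S"
    define v where "v = w - \<i> * of_real t * of_real x"
    have v: "\<delta> \<le> cmod v" using assms complex_Re_le_cmod[of v] by (simp add: v_def)
    have "cmod (\<i> * of_real t * of_real x) \<le> \<bar>t\<bar> * B"
      using abs_S_le[OF x] by (auto simp: norm_mult intro!: mult_left_mono)
    then have "cmod w \<le> cmod v + \<bar>t\<bar> * B"
      using norm_triangle_ineq[of v "\<i> * of_real t * of_real x"] by (simp add: v_def)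
    moreover have "\<delta> * (cmod v + \<bar>t\<bar> * B) \<le> cmod v * (\<delta> + \<bar>t\<bar> * B)"
      using mult_right_mono[OF v tB] by (simp add: algebra_simps)
    ultimately have "\<delta> * cmod w \<le> cmod v * (\<delta> + \<bar>t\<bar> * B)"
      using assms(1) by (meson less_imp_le mult_left_mono order_trans)
    then have "\<delta> / (\<delta> + \<bar>t\<bar> * B) \<le> cmod v / cmod w"
      using assms tB w0 by (simp add: field_simps)
    also have "\<dots> = cmod (v / w)" by (simp add: norm_divide)
    also have "v / w = 1 - \<i> * of_real t / w * of_real (x - 0)" using w0 by (simp add: v_def field_simps)
    finally show "\<delta> / (\<delta> + \<bar>t\<bar> * B) \<le> cmod (1 - \<i> * of_real t / w * of_real (x - 0))" .
  qed
  moreover have "cmod (exp w) \<le> exp x" using assms by simp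
  moreover have "cmod (1 / w powr of_real mass) \<le> (min 1 \<delta> / 2) powr (- mass) * (1 + \<bar>Im w\<bar>) powr (- mass)"
    using norm_powr_le_weight[of \<delta> w mass] assms pos by (simp add: norm_divide norm_powr_real_powr' powr_minus_divide)
  ultimately have "cmod (exp w) * cmod (exp (- log_integral 0 (\<i> * of_real t / w))) * cmod (1 / w powr of_real mass)
     \<le> exp x * (\<delta> / (\<delta> + \<bar>t\<bar> * B)) powr (- mass) * ((min 1 \<delta> / 2) powr (- mass) * (1 + \<bar>Im w\<bar>) powr (- mass))"
    by (intro mult_mono) auto
  then show ?thesis by (simp only: integrand_eq amplitude_def norm_mult mult_ac)
qed

theorem vertical_limit:
  assumes \<gamma>: "0 < \<gamma>"
  shows "((\<lambda>R. contour_integral (vline \<gamma> R) (integrand t)) \<longlongrightarrow> loop_value t) at_top"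
proof -
  define \<gamma>0 where "\<gamma>0 = \<bar>t\<bar> * B + 1"
  have \<gamma>0: "\<bar>t\<bar> * B < \<gamma>0" "0 < \<gamma>0" using B by (auto simp: \<gamma>0_def add_nonneg_pos)
  let ?\<delta> = "min \<gamma>0 \<gamma>"
  let ?c = "exp (max \<gamma>0 \<gamma>) * (?\<delta> / (?\<delta> + \<bar>t\<bar> * B)) powr (- mass) * (min 1 ?\<delta> / 2) powr (- mass)"
  show ?thesis
  proof (rule vertical_integral_shift[OF holomorphic_integrand_half_plane \<gamma>0(2) \<gamma> _ _ vertical_limit_far[OF \<gamma>0]])
    show "((\<lambda>y. ?c * (1 + y) powr (- mass)) \<longlongrightarrow> 0) at_top" by (rule weight_tendsto_0[OF pos])
    show "cmod (integrand t w) \<le> ?c * (1 + \<bar>Im w\<bar>) powr (- mass)" if "?\<delta> \<le> Re w" "Re w \<le> max \<gamma>0 \<gamma>" for w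
      using norm_integrand_half_plane_le[OF _ that, of t] \<gamma> \<gamma>0 by (simp add: mult.assoc)
  qed
qed

theorem has_pv_line_integral_integrand:
  assumes \<gamma>: "0 < \<gamma>"
  shows "has_pv_line_integral (integrand t) (loop_value t) \<gamma>"
proof -
  have "continuous_on UNIV (\<lambda>y. integrand t (Complex \<gamma> y))"
    using \<gamma> by (intro continuous_on_compose2[OF holomorphic_on_imp_continuous_on[OF holomorphic_integrand_half_plane]] continuous_intros) auto
  then show ?thesis
    unfolding has_pv_line_integral_def using vertical_limit[OF \<gamma>] contour_integral_vline(1) by auto
qed

end

section \<open>Replacing a loop by a standard path\<close>

text \<open>The factor \<open>s\<close> serves to turn the cut of the logarithm away from the segment.\<close>

lemma has_contour_integral_log_segment:
  assumes "s \<noteq> 0" "\<And>w. w \<in> closed_segment u v \<Longrightarrow> s * (w - z) \<notin> \<real>\<^sub>\<le>\<^sub>0"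
  shows "((\<lambda>w. 1 / (w - z)) has_contour_integral (Ln (s * (v - z)) - Ln (s * (u - z)))) (linepath u v)"
proof -
  have "((\<lambda>w. Ln (s * (w - z))) has_field_derivative 1 / (w - z)) (at w within closed_segment u v)"
    if "w \<in> closed_segment u v" for w
  proof -
    have "s * (w - z) \<noteq> 0" using assms(2)[OF that] by (metis nonpos_Reals_zero_I)
    then show ?thesis using assms(2)[OF that] assms(1) by (auto intro!: derivative_eq_intros simp: field_simps)
  qed
  from contour_integral_primitive[OF this valid_path_linepath, of u v] show ?thesis by simp
qed

lemma Ln_minus_upper: "0 < Im u \<Longrightarrow> Ln (- u) = Ln u - \<i> * of_real pi"
  by (subst Ln_minus) auto

lemma Ln_minus_lower: "Im u < 0 \<Longrightarrow> Ln (- u) = Ln u + \<i> * of_real pi"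
  by (subst Ln_minus) auto

lemma winding_closed_by_segment:
  assumes P: "valid_path P" "z \<notin> path_image P" and Re: "Re z = 0" "Re (pathstart P) < 0" "Re (pathfinish P) < 0"
    and wn: "winding_number (P +++ linepath (pathfinish P) (pathstart P)) z = 1"
  shows "(\<lambda>w. 1 / (w - z)) contour_integrable_on P"
    and "contour_integral P (\<lambda>w. 1 / (w - z)) =
      2 * of_real pi * \<i> + Ln (- (pathfinish P - z)) - Ln (- (pathstart P - z))"
proof -
  let ?l = "linepath (pathfinish P) (pathstart P)"
  have neg: "Re w < 0" if "w \<in> closed_segment (pathfinish P) (pathstart P)" for w
    using Re that closed_segment_subset[OF _ _ convex_halfspace_Re_lt[of 0], of "pathfinish P" "pathstart P"] by auto
  have l: "((\<lambda>w. 1 / (w - z)) has_contour_integral (Ln (- 1 * (pathstart P - z)) - Ln (- 1 * (pathfinish P - z)))) ?l"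
  proof (rule has_contour_integral_log_segment)
    fix w assume "w \<in> closed_segment (pathfinish P) (pathstart P)"
    from neg[OF this] show "- 1 * (w - z) \<notin> \<real>\<^sub>\<le>\<^sub>0" using Re(1) by (intro Re_pos_notin_nonpos_Reals) simp
  qed simp
  have zl: "z \<notin> closed_segment (pathfinish P) (pathstart P)" using neg Re(1) by force
  show iP: "(\<lambda>w. 1 / (w - z)) contour_integrable_on P"
    using P by (intro contour_integrable_inversediff)
  have "winding_number (P +++ ?l) z = 1 / (2 * of_real pi * \<i>) * contour_integral (P +++ ?l) (\<lambda>w. 1 / (w - z))"
    using winding_number_valid_path[of "P +++ ?l" z] P zl by (simp add: path_image_join)
  also have "contour_integral (P +++ ?l) (\<lambda>w. 1 / (w - z)) = contour_integral P (\<lambda>w. 1 / (w - z)) + contour_integral ?l (\<lambda>w. 1 / (w - z))"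
    using P iP l by (intro contour_integral_join) (auto simp: contour_integrable_on_def)
  finally have "contour_integral P (\<lambda>w. 1 / (w - z)) + contour_integral ?l (\<lambda>w. 1 / (w - z)) = 2 * of_real pi * \<i>"
    using wn by (simp add: field_simps)
  then show "contour_integral P (\<lambda>w. 1 / (w - z)) = 2 * of_real pi * \<i> + Ln (- (pathfinish P - z)) - Ln (- (pathstart P - z))"
    unfolding contour_integral_unique[OF l] by (simp add: algebra_simps)
qed

text \<open>Off the cut the principal logarithm is a primitive of \<open>1/w\<close> along \<open>P\<close>, and \<open>Ln (- w)\<close> is one along the closing segment. The two
  differ by \<open>\<plusminus> \<pi> i\<close> according to the half-plane, so a total increment of \<open>2 \<pi> i\<close> forces \<open>P\<close> to start below the negative axis and to end
  above it.\<close>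

lemma loop_ends_on_both_sides:
  assumes P: "valid_path P" "path_image P \<inter> \<real>\<^sub>\<le>\<^sub>0 = {}" and Re: "Re (pathstart P) < 0" "Re (pathfinish P) < 0"
    and wn: "winding_number (P +++ linepath (pathfinish P) (pathstart P)) 0 = 1"
  shows "Im (pathstart P) < 0" "0 < Im (pathfinish P)"
proof -
  let ?u = "pathstart P" and ?v = "pathfinish P"
  have mem: "?u \<in> path_image P" "?v \<in> path_image P" by auto
  then have Im: "Im ?u \<noteq> 0" "Im ?v \<noteq> 0" using P(2) Re by (auto simp: complex_nonpos_Reals_iff)
  have 0: "0 \<notin> path_image P" using P(2) by auto
  have "((\<lambda>w. 1 / (w - 0)) has_contour_integral (Ln ?v - Ln ?u)) P"
  proof (rule contour_integral_primitive[OF _ P(1) order_refl])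
    fix w assume "w \<in> path_image P"
    then have "w \<notin> \<real>\<^sub>\<le>\<^sub>0" using P(2) by blast
    then show "(Ln has_field_derivative 1 / (w - 0)) (at w within path_image P)"
      by (auto intro!: derivative_eq_intros simp: divide_inverse)
  qed
  with winding_closed_by_segment(2)[OF P(1) 0 _ Re wn]
  have eq: "Ln ?v - Ln ?u = 2 * of_real pi * \<i> + Ln (- ?v) - Ln (- ?u)"
    by (simp add: contour_integral_unique)
  have v: "Ln (- ?v) = Ln ?v + (if 0 < Im ?v then - \<i> * of_real pi else \<i> * of_real pi)"
    using Im Ln_minus_upper[of ?v] Ln_minus_lower[of ?v] by auto
  have u: "Ln (- ?u) = Ln ?u + (if 0 < Im ?u then - \<i> * of_real pi else \<i> * of_real pi)"
    using Im Ln_minus_upper[of ?u] Ln_minus_lower[of ?u] by auto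
  have "2 * of_real pi * \<i> + (if 0 < Im ?v then - \<i> * of_real pi else \<i> * of_real pi)
      - (if 0 < Im ?u then - \<i> * of_real pi else \<i> * of_real pi) = (0 :: complex)"
    using eq unfolding u v by (simp add: algebra_simps)
  then have "0 < Im ?v \<and> \<not> 0 < Im ?u"
    by (cases "0 < Im ?v"; cases "0 < Im ?u") (auto simp: complex_eq_iff)
  with Im show "Im ?u < 0" "0 < Im ?v" by auto
qed

text \<open>The reference path goes from \<open>u\<close> vertically down to height \<open>-R\<close>, to the right, up along \<open>Re w = \<gamma>\<close>, back to
  the left at height \<open>R\<close> and vertically to \<open>v\<close>. Followed by the reversed reference path, \<open>P\<close> has winding number
  \<open>0\<close> about \<open>z\<close>: both paths, closed by the segment from \<open>v\<close> to \<open>u\<close>, wind once around \<open>z\<close>. For the reference path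
  this is read off from two branches of the logarithm, one on the left half-plane and one off the
  horizontal ray from \<open>z\<close> to the left. As the complement of \<open>U\<close> is connected, the winding number vanishes on all of it, and
  the global form of Cauchy's theorem applies.\<close>

lemma loop_integral_eq_reference:
  assumes P: "valid_path P" "path_image P \<subseteq> U" and U: "open U" "connected (- U)" and g: "g holomorphic_on U"
    and z: "z \<notin> U" "Re z = 0" "\<bar>Im z\<bar> < R" and \<gamma>: "0 < \<gamma>"
    and ends: "pathstart P = u" "pathfinish P = v" "Re u < 0" "Re v < 0"
    and wn: "winding_number (P +++ linepath v u) z = 1"
    and seg: "closed_segment u (Complex (Re u) (- R)) \<subseteq> U" "closed_segment (Complex (Re u) (- R)) (Complex \<gamma> (- R)) \<subseteq> U"
      "closed_segment (Complex \<gamma> (- R)) (Complex \<gamma> R) \<subseteq> U" "closed_segment (Complex \<gamma> R) (Complex (Re v) R) \<subseteq> U"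
      "closed_segment (Complex (Re v) R) v \<subseteq> U"
  shows "contour_integral P g = contour_integral (linepath u (Complex (Re u) (- R))) g +
    (contour_integral (linepath (Complex (Re u) (- R)) (Complex \<gamma> (- R))) g +
    (contour_integral (vline \<gamma> R) g +
    (contour_integral (linepath (Complex \<gamma> R) (Complex (Re v) R)) g +
    contour_integral (linepath (Complex (Re v) R) v) g)))"
proof -
  define a1 a2 b2 b1 where "a1 = Complex (Re u) (- R)" and "a2 = Complex \<gamma> (- R)" and "b2 = Complex \<gamma> R" and "b1 = Complex (Re v) R"
  note defs = a1_def a2_def b2_def b1_def
  define Q where "Q = linepath u a1 +++ linepath a1 a2 +++ linepath a2 b2 +++ linepath b2 b1 +++ linepath b1 v"
  have Q: "valid_path Q" "pathstart Q = u" "pathfinish Q = v" "path_image Q \<subseteq> U"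
    using seg unfolding Q_def defs by (auto simp: path_image_join)
  have R: "0 < R" using z(3) by linarith
  have sum: "h contour_integrable_on Q \<and> contour_integral Q h = contour_integral (linepath u a1) h + (contour_integral (linepath a1 a2) h + (contour_integral (linepath a2 b2) h +
      (contour_integral (linepath b2 b1) h + contour_integral (linepath b1 v) h)))"
    if "h contour_integrable_on linepath u a1" "h contour_integrable_on linepath a1 a2" "h contour_integrable_on linepath a2 b2"
       "h contour_integrable_on linepath b2 b1" "h contour_integrable_on linepath b1 v" for h
    unfolding Q_def using that by simp
  have zQ: "z \<notin> path_image Q" and zP: "z \<notin> path_image P" using Q(4) P(2) z(1) by auto
  let ?k = "\<lambda>w. 1 / (w - z)"
  have left: "(?k has_contour_integral (Ln (- 1 * (y - z)) - Ln (- 1 * (x - z)))) (linepath x y)" if "Re x < 0" "Re y < 0" for x y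
  proof (rule has_contour_integral_log_segment)
    fix w assume "w \<in> closed_segment x y"
    then have "Re w < 0" using that closed_segment_subset[OF _ _ convex_halfspace_Re_lt[of 0], of x y] by auto
    then show "- 1 * (w - z) \<notin> \<real>\<^sub>\<le>\<^sub>0" using z(2) by (intro Re_pos_notin_nonpos_Reals) simp
  qed simp
  have right: "(?k has_contour_integral (Ln (1 * (y - z)) - Ln (1 * (x - z)))) (linepath x y)"
    if "\<And>w. w \<in> closed_segment x y \<Longrightarrow> 0 < Re w \<or> \<bar>Im w\<bar> = R" for x y
  proof (rule has_contour_integral_log_segment)
    fix w assume "w \<in> closed_segment x y"
    from that[OF this] show "1 * (w - z) \<notin> \<real>\<^sub>\<le>\<^sub>0"
      using z(2,3) by (auto simp: complex_nonpos_Reals_iff)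
  qed simp
  have i1: "(?k has_contour_integral (Ln (- 1 * (a1 - z)) - Ln (- 1 * (u - z)))) (linepath u a1)"
    using ends by (intro left) (auto simp: defs)
  have i5: "(?k has_contour_integral (Ln (- 1 * (v - z)) - Ln (- 1 * (b1 - z)))) (linepath b1 v)"
    using ends by (intro left) (auto simp: defs)
  have i2: "(?k has_contour_integral (Ln (1 * (a2 - z)) - Ln (1 * (a1 - z)))) (linepath a1 a2)"
    using R by (intro right) (auto simp: defs closed_segment_same_Im)
  have i3: "(?k has_contour_integral (Ln (1 * (b2 - z)) - Ln (1 * (a2 - z)))) (linepath a2 b2)"
    using \<gamma> by (intro right) (auto simp: defs closed_segment_same_Re)
  have i4: "(?k has_contour_integral (Ln (1 * (b1 - z)) - Ln (1 * (b2 - z)))) (linepath b2 b1)"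
    using R by (intro right) (auto simp: defs closed_segment_same_Im)
  note parts = i1 i2 i3 i4 i5
  have kQ: "?k contour_integrable_on Q" "contour_integral Q ?k =
      Ln (- (a1 - z)) - Ln (- (u - z)) + (Ln (b1 - z) - Ln (a1 - z)) + (Ln (- (v - z)) - Ln (- (b1 - z)))"
    using sum[OF parts[THEN has_contour_integral_integrable]] unfolding parts[THEN contour_integral_unique] by (auto simp: algebra_simps)
  have kP: "?k contour_integrable_on P" "contour_integral P ?k = 2 * of_real pi * \<i> + Ln (- (v - z)) - Ln (- (u - z))"
    using winding_closed_by_segment[OF P(1) zP z(2)] ends wn by auto
  have b1: "Ln (- (b1 - z)) = Ln (b1 - z) - \<i> * of_real pi" using z(3) by (intro Ln_minus_upper) (auto simp: defs)
  have a1: "Ln (- (a1 - z)) = Ln (a1 - z) + \<i> * of_real pi" using z(3) by (intro Ln_minus_lower) (auto simp: defs)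
  define W where "W = P +++ reversepath Q"
  have W: "valid_path W" "pathfinish W = pathstart W" "path_image W \<subseteq> U"
    using P Q ends unfolding W_def by (auto simp: path_image_join)
  have "winding_number W z = 1 / (2 * of_real pi * \<i>) * contour_integral W ?k"
    using winding_number_valid_path[of W z] W z(1) by auto
  also have "contour_integral W ?k = contour_integral P ?k - contour_integral Q ?k"
    unfolding W_def using P Q ends kP(1) kQ(1)
    by (subst contour_integral_join) (auto simp: contour_integral_reversepath contour_integrable_reversepath)
  also have "\<dots> = 0" unfolding kP(2) kQ(2) a1 b1 by (simp add: algebra_simps)
  finally have W0: "winding_number W z = 0" by simp
  have zero: "winding_number W y = 0" if "y \<notin> U" for y
  proof -
    have "winding_number W constant_on (- U)"
      using W U(2) by (intro winding_number_constant) (auto intro: valid_path_imp_path)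
    then show ?thesis using W0 that z(1) unfolding constant_on_def by force
  qed
  have "(g has_contour_integral 0) W"
    by (rule Cauchy_theorem_global[OF U(1) g W(1,2,3) zero])
  moreover have gP: "g contour_integrable_on P"
    by (rule contour_integrable_holomorphic_simple[OF g U(1) P])
  moreover have gQ: "g contour_integrable_on Q"
    by (rule contour_integrable_holomorphic_simple[OF g U(1) Q(1,4)])
  ultimately have "contour_integral P g - contour_integral Q g = 0"
    unfolding W_def using P Q ends
    by (metis contour_integral_join contour_integral_reversepath contour_integral_unique contour_integrable_reversepath diff_conv_add_uminus pathstart_reversepath valid_path_reversepath)
  moreover have "contour_integral Q g = contour_integral (linepath u a1) g + (contour_integral (linepath a1 a2) g + (contour_integral (linepath a2 b2) g +
      (contour_integral (linepath b2 b1) g + contour_integral (linepath b1 v) g)))"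
    using seg g by (intro sum[THEN conjunct2] contour_integrable_continuous_linepath)
      (auto simp: defs intro: continuous_on_subset holomorphic_on_imp_continuous_on)
  ultimately show ?thesis by (simp add: defs)
qed

section \<open>Estimates far from the origin\<close>

context dirichlet_mean begin

text \<open>From this radius on \<open>|itx/w| \<le> 1/2\<close> for all \<open>x\<close> in the support, so that the logarithms are off their cut and
  \<open>|1 - itx/w| \<ge> 1/2\<close>; the summand \<open>1\<close> makes powers of \<open>|w|\<close> monotone in the exponent.\<close>

definition far_radius :: "real \<Rightarrow> real" where "far_radius t = 2 * \<bar>t\<bar> * B + 1"

lemma far_radius_ge_1: "1 \<le> far_radius t"
  using B by (simp add: far_radius_def)

lemma far_bounds:
  assumes "far_radius t \<le> cmod w"
  shows "\<i> * of_real t / w \<in> log_domain 0" "x \<in> S \<Longrightarrow> 1 / 2 \<le> cmod (1 - \<i> * of_real t / w * of_real x)"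
proof -
  have w: "0 < cmod w" using assms far_radius_ge_1[of t] by linarith
  have half: "cmod (\<i> * of_real t / w) * B \<le> 1 / 2"
    using assms w unfolding far_radius_def by (simp add: norm_mult norm_divide field_simps)
  then show "\<i> * of_real t / w \<in> log_domain 0" by (intro small_in_log_domain) simp
  assume "x \<in> S"
  then have "cmod (\<i> * of_real t / w * of_real x) \<le> cmod (\<i> * of_real t / w) * B"
    using abs_S_le unfolding norm_mult[of _ "of_real x"] by (intro mult_left_mono) auto
  then show "1 / 2 \<le> cmod (1 - \<i> * of_real t / w * of_real x)"
    using half norm_triangle_ineq2[of 1 "\<i> * of_real t / w * of_real x"] by simp
qed

definition amplitude_bound :: real where "amplitude_bound = (1 / 2) powr (- mass)"

lemma amplitude_bound_nonneg: "0 \<le> amplitude_bound"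
  by (simp add: amplitude_bound_def)

lemma norm_amplitude_le:
  assumes "far_radius t \<le> cmod w"
  shows "cmod (amplitude t w) \<le> amplitude_bound * cmod w powr (- mass)"
proof -
  have "cmod (exp (- log_integral 0 (\<i> * of_real t / w))) \<le> amplitude_bound"
    unfolding amplitude_bound_def using far_bounds[OF assms] by (intro norm_exp_log_integral_le) auto
  then have "cmod (exp (- log_integral 0 (\<i> * of_real t / w))) * cmod w powr (- mass) \<le> amplitude_bound * cmod w powr (- mass)"
    by (intro mult_right_mono) auto
  then show ?thesis
    by (simp only: amplitude_def norm_mult norm_divide norm_one norm_powr_real_powr' Reals_of_real Re_complex_of_real
      powr_minus_divide mult.commute)
qed

definition amplitude_deriv :: "real \<Rightarrow> complex \<Rightarrow> complex" where
  "amplitude_deriv t w = - amplitude t w * (of_real mass / w + \<i> * of_real t / w\<^sup>2 *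
     (\<integral>x. of_real x / (1 - \<i> * of_real t / w * of_real x) \<partial>\<alpha>))"

lemma norm_amplitude_deriv_le:
  assumes w: "far_radius t \<le> cmod w"
  shows "cmod (amplitude_deriv t w) \<le> amplitude_bound * mass * (1 + 2 * B * \<bar>t\<bar>) * cmod w powr (- (mass + 1))"
proof -
  have w1: "1 \<le> cmod w" using w far_radius_ge_1[of t] by linarith
  have bd: "AE x in \<alpha>. cmod (of_real x / (1 - \<i> * of_real t / w * of_real x)) \<le> 2 * B"
    using AE_S
  proof eventually_elim
    case (elim x)
    have "\<bar>x\<bar> / cmod (1 - \<i> * of_real t / w * of_real x) \<le> B / (1 / 2)"
      using abs_S_le[OF elim] far_bounds(2)[OF w elim] B by (intro frac_le) auto
    then show ?case by (simp add: norm_divide)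
  qed
  have "(\<lambda>x::real. of_real x / (1 - \<i> * of_real t / w * of_real x)) \<in> borel_measurable \<alpha>"
    by (rule borel_measurable_\<alpha>) measurable
  from \<alpha>.integrable_const_bound[OF bd this]
  have int: "integrable \<alpha> (\<lambda>x. of_real x / (1 - \<i> * of_real t / w * of_real x))" .
  have "cmod (\<integral>x. of_real x / (1 - \<i> * of_real t / w * of_real x) \<partial>\<alpha>) \<le> (\<integral>x. cmod (of_real x / (1 - \<i> * of_real t / w * of_real x)) \<partial>\<alpha>)"
    by (rule integral_norm_bound)
  also have "\<dots> \<le> (\<integral>x. 2 * B \<partial>\<alpha>)"
    using int bd by (intro integral_mono_AE integrable_norm) auto
  also have "\<dots> = 2 * B * mass" by (simp add: space_\<alpha>)
  finally have I: "cmod (\<integral>x. of_real x / (1 - \<i> * of_real t / w * of_real x) \<partial>\<alpha>) \<le> 2 * B * mass" .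
  have "cmod (of_real mass / w + \<i> * of_real t / w\<^sup>2 * (\<integral>x. of_real x / (1 - \<i> * of_real t / w * of_real x) \<partial>\<alpha>))
      \<le> mass / cmod w + \<bar>t\<bar> / (cmod w * cmod w) * (2 * B * mass)"
  proof (rule norm_triangle_mono)
    show "cmod (of_real mass / w) \<le> mass / cmod w" by (simp add: norm_divide)
    show "cmod (\<i> * of_real t / w\<^sup>2 * (\<integral>x. of_real x / (1 - \<i> * of_real t / w * of_real x) \<partial>\<alpha>)) \<le> \<bar>t\<bar> / (cmod w * cmod w) * (2 * B * mass)"
      unfolding norm_mult norm_divide norm_power power2_eq_square using I by (intro mult_mono) auto
  qed
  also have "\<bar>t\<bar> / (cmod w * cmod w) * (2 * B * mass) \<le> \<bar>t\<bar> / (cmod w * 1) * (2 * B * mass)"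
    using w1 B by (intro mult_right_mono divide_left_mono mult_left_mono mult_pos_pos) auto
  also have "mass / cmod w + \<bar>t\<bar> / (cmod w * 1) * (2 * B * mass) = mass * (1 + 2 * B * \<bar>t\<bar>) / cmod w"
    by (simp add: algebra_simps add_divide_distrib)
  finally have "cmod (amplitude_deriv t w) \<le> (amplitude_bound * cmod w powr (- mass)) * (mass * (1 + 2 * B * \<bar>t\<bar>) / cmod w)"
    unfolding amplitude_deriv_def norm_mult norm_minus_cancel
    using norm_amplitude_le[OF w] amplitude_bound_nonneg by (intro mult_mono) auto
  also have "cmod w powr (- (mass + 1)) = cmod w powr (- mass) / cmod w"
    using w1 by (simp add: powr_diff powr_minus_divide powr_add)
  then have "(amplitude_bound * cmod w powr (- mass)) * (mass * (1 + 2 * B * \<bar>t\<bar>) / cmod w) =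
      amplitude_bound * mass * (1 + 2 * B * \<bar>t\<bar>) * cmod w powr (- (mass + 1))"
    by (simp only: times_divide_eq_right times_divide_eq_left mult_ac)
  finally show ?thesis .
qed

lemma exp_amplitude_deriv:
  assumes "far_radius t \<le> cmod w" "w \<notin> \<real>\<^sub>\<le>\<^sub>0 \<or> mass \<in> \<nat>"
  shows "((\<lambda>w. exp w * amplitude t w) has_field_derivative (exp w * amplitude t w + exp w * amplitude_deriv t w)) (at w)"
proof -
  have "w \<noteq> 0" using assms(1) far_radius_ge_1[of t] by force
  from has_field_derivative_amplitude[OF this assms(2) far_bounds(1)[OF assms(1)]]
  have "(amplitude t has_field_derivative amplitude_deriv t w) (at w)" by (simp only: amplitude_deriv_def)
  then show ?thesis by (auto intro!: derivative_eq_intros)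
qed

text \<open>Integration by parts replaces the amplitude by its derivative, which is smaller by a factor \<open>1/|w|\<close> and
  therefore absolutely integrable over the whole vertical line. Hence the bound does not depend on the length of
  the segment, on which the loop gives no control.\<close>

lemma vertical_segment_bound:
  obtains C where "0 \<le> C"
    and "\<And>x y1 y2. x \<le> - far_radius t \<Longrightarrow> y1 \<le> y2 \<Longrightarrow>
      (\<And>y. y1 \<le> y \<Longrightarrow> y \<le> y2 \<Longrightarrow> Complex x y \<notin> \<real>\<^sub>\<le>\<^sub>0 \<or> mass \<in> \<nat>) \<Longrightarrow>
      cmod (contour_integral (linepath (Complex x y1) (Complex x y2)) (\<lambda>w. exp w * amplitude t w)) \<le> C * exp x"
proof -
  define K where "K = amplitude_bound * mass * (1 + 2 * B * \<bar>t\<bar>) * (1 / 2) powr (- (mass + 1))"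
  define J where "J = (LBINT y. (1 + \<bar>y::real\<bar>) powr (- (mass + 1)))"
  have Jint: "integrable lborel (\<lambda>y::real. (1 + \<bar>y\<bar>) powr (- (mass + 1)))"
    using pos by (intro integrable_inverse_power_weight) simp
  have K0: "0 \<le> K" unfolding K_def using amplitude_bound_nonneg B by (intro mult_nonneg_nonneg) auto
  have J0: "0 \<le> J" unfolding J_def by simp
  show ?thesis
  proof (rule that[of "2 * amplitude_bound + K * J"])
    show "0 \<le> 2 * amplitude_bound + K * J" using amplitude_bound_nonneg K0 J0 by simp
    fix x y1 y2 assume x: "x \<le> - far_radius t" and y: "y1 \<le> y2"
      and cut: "\<And>y. y1 \<le> y \<Longrightarrow> y \<le> y2 \<Longrightarrow> Complex x y \<notin> \<real>\<^sub>\<le>\<^sub>0 \<or> mass \<in> \<nat>"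
    let ?u = "Complex x y1" and ?v = "Complex x y2"
    have Ax: "far_radius t \<le> \<bar>x\<bar>" using x far_radius_ge_1[of t] by linarith
    have far: "far_radius t \<le> cmod (Complex x y)" for y using abs_Re_le_cmod[of "Complex x y"] Ax by simp
    show "cmod (contour_integral (linepath ?u ?v) (\<lambda>w. exp w * amplitude t w)) \<le> (2 * amplitude_bound + K * J) * exp x"
    proof (cases "y1 = y2")
      case True
      then show ?thesis using amplitude_bound_nonneg K0 J0 by simp
    next
      case False
      with y have y12: "y1 < y2" by simp
      define f where "f w = exp w * amplitude t w" for w
      define k where "k w = exp w * amplitude_deriv t w" for w
      have on: "\<exists>y. w = Complex x y \<and> y1 \<le> y \<and> y \<le> y2" if "w \<in> closed_segment ?u ?v" for w
        using that y12 by (intro exI[of _ "Im w"]) (auto simp: closed_segment_same_Re closed_segment_eq_real_ivl complex_eq_iff)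
      have d: "(f has_field_derivative (f w + k w)) (at w)" if "w \<in> closed_segment ?u ?v" for w
        using on[OF that] cut far exp_amplitude_deriv unfolding f_def k_def by blast
      have "((\<lambda>w. f w + k w) has_contour_integral (f ?v - f ?u)) (linepath ?u ?v)"
      proof -
        have "(f has_field_derivative (f w + k w)) (at w within closed_segment ?u ?v)" if "w \<in> closed_segment ?u ?v" for w
          by (rule has_field_derivative_at_within[OF d[OF that]])
        from contour_integral_primitive[OF this valid_path_linepath, of ?u ?v] show ?thesis by simp
      qed
      moreover have "f contour_integrable_on linepath ?u ?v"
        using d by (intro contour_integrable_continuous_linepath) (auto intro!: continuous_at_imp_continuous_on DERIV_isCont)
      then have fi: "(f has_contour_integral contour_integral (linepath ?u ?v) f) (linepath ?u ?v)"
        by (rule has_contour_integral_integral)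
      ultimately have "((\<lambda>w. f w + k w - f w) has_contour_integral (f ?v - f ?u - contour_integral (linepath ?u ?v) f)) (linepath ?u ?v)"
        by (rule has_contour_integral_diff)
      then have "(k has_contour_integral (f ?v - f ?u - contour_integral (linepath ?u ?v) f)) (linepath ?u ?v)" by simp
      then have hk: "((\<lambda>y. k (Complex x y)) has_integral (- \<i> * (f ?v - f ?u - contour_integral (linepath ?u ?v) f))) {y1..y2}"
        using y12 by (subst (asm) has_contour_integral_linepath_same_Re_iff[where c = x and a = y1 and b = y2]) auto
      have k_le: "cmod (k (Complex x y)) \<le> exp x * K * (1 + \<bar>y\<bar>) powr (- (mass + 1))" for y
      proof -
        have "cmod (Complex x y) powr (- (mass + 1)) \<le> (1 / 2) powr (- (mass + 1)) * (1 + \<bar>y\<bar>) powr (- (mass + 1))"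
          using norm_powr_le_weight[of 1 "Complex x y" "mass + 1"] Ax far_radius_ge_1[of t] pos by simp
        then have "amplitude_bound * mass * (1 + 2 * B * \<bar>t\<bar>) * cmod (Complex x y) powr (- (mass + 1)) \<le>
            amplitude_bound * mass * (1 + 2 * B * \<bar>t\<bar>) * ((1 / 2) powr (- (mass + 1)) * (1 + \<bar>y\<bar>) powr (- (mass + 1)))"
          using amplitude_bound_nonneg B by (intro mult_left_mono mult_nonneg_nonneg) auto
        also have "\<dots> = K * (1 + \<bar>y\<bar>) powr (- (mass + 1))" by (simp only: K_def mult.assoc)
        finally have "cmod (amplitude_deriv t (Complex x y)) \<le> K * (1 + \<bar>y\<bar>) powr (- (mass + 1))"
          using norm_amplitude_deriv_le[OF far] by (rule order_trans[rotated])
        then have "exp x * cmod (amplitude_deriv t (Complex x y)) \<le> exp x * (K * (1 + \<bar>y\<bar>) powr (- (mass + 1)))"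
          by (rule mult_left_mono) simp
        then show ?thesis by (simp add: k_def norm_mult mult.assoc)
      qed
      have wi: "set_integrable lborel {y1..y2} (\<lambda>y. exp x * K * (1 + \<bar>y\<bar>) powr (- (mass + 1)))"
        unfolding set_integrable_def using Jint by (intro integrable_mult_indicator integrable_mult_right) auto
      note wi' = set_borel_integral_eq_integral[OF wi]
      have "cmod (- \<i> * (f ?v - f ?u - contour_integral (linepath ?u ?v) f)) \<le> integral {y1..y2} (\<lambda>y. exp x * K * (1 + \<bar>y\<bar>) powr (- (mass + 1)))"
        using integral_norm_bound_integral[OF has_integral_integrable[OF hk] wi'(1) k_le] unfolding integral_unique[OF hk] .
      also have "\<dots> = (LBINT y. indicator {y1..y2} y *\<^sub>R (exp x * K * (1 + \<bar>y\<bar>) powr (- (mass + 1))))"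
        unfolding wi'(2)[symmetric] set_lebesgue_integral_def ..
      also have "\<dots> \<le> (LBINT y. exp x * K * (1 + \<bar>y\<bar>) powr (- (mass + 1)))"
        using wi[unfolded set_integrable_def] Jint K0 by (intro integral_mono integrable_mult_right) (auto simp: indicator_def)
      also have "\<dots> = exp x * K * J" by (simp add: J_def)
      finally have A: "cmod (f ?v - f ?u - contour_integral (linepath ?u ?v) f) \<le> exp x * K * J" by (simp add: norm_mult)
      have f_le: "cmod (f (Complex x y)) \<le> exp x * amplitude_bound" for y
      proof -
        have "1 \<le> cmod (Complex x y)" using far[of y] far_radius_ge_1[of t] by linarith
        then have "cmod (Complex x y) powr (- mass) \<le> 1" using powr_mono2'[of "- mass" 1 "cmod (Complex x y)"] pos by simp
        then have "amplitude_bound * cmod (Complex x y) powr (- mass) \<le> amplitude_bound * 1"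
          using amplitude_bound_nonneg by (intro mult_left_mono)
        then have "cmod (amplitude t (Complex x y)) \<le> amplitude_bound"
          using norm_amplitude_le[OF far[of y]] by linarith
        then show ?thesis by (simp add: f_def norm_mult)
      qed
      define d where "d = f ?v - f ?u - contour_integral (linepath ?u ?v) f"
      have "contour_integral (linepath ?u ?v) f = f ?v - f ?u - d" by (simp add: d_def)
      then have "cmod (contour_integral (linepath ?u ?v) f) \<le> cmod (f ?v) + cmod (f ?u) + cmod d"
        using norm_triangle_ineq4[of "f ?v - f ?u" d] norm_triangle_ineq4[of "f ?v" "f ?u"] by simp
      also have "\<dots> \<le> exp x * amplitude_bound + exp x * amplitude_bound + exp x * K * J"
        using A unfolding d_def by (intro add_mono f_le)
      finally show ?thesis unfolding f_def by (simp add: algebra_simps)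
    qed
  qed
qed

end

context dirichlet_mean begin

text \<open>The sign \<open>s\<close> selects the segment above or below the real axis. The segment has fixed length and bounded real part,
  while the amplitude decays like \<open>R\<^bsup>-a\<^esup>\<close>.\<close>

lemma horizontal_segment_tendsto_0:
  assumes "\<bar>s\<bar> = 1" "x \<le> \<gamma>"
  shows "((\<lambda>R. contour_integral (linepath (Complex x (s * R)) (Complex \<gamma> (s * R))) (\<lambda>w. exp w * amplitude t w)) \<longlongrightarrow> 0) at_top"
proof (rule Lim_null_comparison)
  have bound: "cmod (contour_integral (linepath (Complex x (s * R)) (Complex \<gamma> (s * R))) (\<lambda>w. exp w * amplitude t w))
      \<le> exp \<gamma> * amplitude_bound * R powr (- mass) * (\<gamma> - x)" if R: "far_radius t \<le> R" for R
  proof -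
    let ?u = "Complex x (s * R)" and ?v = "Complex \<gamma> (s * R)"
    have R0: "0 < R" using R far_radius_ge_1[of t] by linarith
    have sR: "\<bar>s * R\<bar> = R" using assms(1) R0 by (simp add: abs_mult)
    have w: "Re w \<le> \<gamma> \<and> \<bar>Im w\<bar> = R" if "w \<in> closed_segment ?u ?v" for w
      using that assms(2) sR by (auto simp: closed_segment_same_Im closed_segment_eq_real_ivl)
    have far: "far_radius t \<le> cmod w" if "w \<in> closed_segment ?u ?v" for w
      using w[OF that] R abs_Im_le_cmod[of w] by linarith
    have "cmod (contour_integral (linepath ?u ?v) (\<lambda>w. exp w * amplitude t w)) \<le> (exp \<gamma> * (amplitude_bound * R powr (- mass))) * cmod (?v - ?u)"
    proof (rule contour_integral_bound_linepath)
      have "isCont (\<lambda>w. exp w * amplitude t w) w" if "w \<in> closed_segment ?u ?v" for w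
        using w[OF that] R0 by (intro DERIV_isCont[OF exp_amplitude_deriv[OF far[OF that]]]) (auto simp: complex_nonpos_Reals_iff)
      then show "(\<lambda>w. exp w * amplitude t w) contour_integrable_on linepath ?u ?v"
        by (intro contour_integrable_continuous_linepath continuous_at_imp_continuous_on) auto
      fix w assume seg: "w \<in> closed_segment ?u ?v"
      have "cmod w powr (- mass) \<le> R powr (- mass)"
        using w[OF seg] abs_Im_le_cmod[of w] R0 pos by (intro powr_mono2') auto
      then have "amplitude_bound * cmod w powr (- mass) \<le> amplitude_bound * R powr (- mass)"
        using amplitude_bound_nonneg by (intro mult_left_mono)
      then have "cmod (amplitude t w) \<le> amplitude_bound * R powr (- mass)"
        using norm_amplitude_le[OF far[OF seg]] by linarith
      moreover have "cmod (exp w) \<le> exp \<gamma>" using w[OF seg] by simp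
      ultimately show "cmod (exp w * amplitude t w) \<le> exp \<gamma> * (amplitude_bound * R powr (- mass))"
        unfolding norm_mult by (intro mult_mono) auto
    qed (use amplitude_bound_nonneg in auto)
    also have "cmod (?v - ?u) = \<gamma> - x" using assms(2) by (simp add: cmod_def)
    finally show ?thesis by (simp add: mult.assoc)
  qed
  show "\<forall>\<^sub>F R in at_top. cmod (contour_integral (linepath (Complex x (s * R)) (Complex \<gamma> (s * R))) (\<lambda>w. exp w * amplitude t w))
      \<le> exp \<gamma> * amplitude_bound * R powr (- mass) * (\<gamma> - x)"
    using eventually_ge_at_top[of "far_radius t"] by eventually_elim (rule bound)
  have "((\<lambda>R. R powr (- mass)) \<longlongrightarrow> 0) at_top" using pos by (intro tendsto_neg_powr filterlim_ident) simp
  then show "((\<lambda>R. exp \<gamma> * amplitude_bound * R powr (- mass) * (\<gamma> - x)) \<longlongrightarrow> 0) at_top"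
    by (intro tendsto_mult_left_zero tendsto_mult_right_zero)
qed

lemma contour_integral_linepath_swap:
  "contour_integral (linepath b a) f = - contour_integral (linepath a b) f"
proof -
  have "contour_integral (reversepath (linepath a b)) f = - contour_integral (linepath a b) f"
    by (rule contour_integral_reversepath) simp
  then show ?thesis by simp
qed

text \<open>Compare with the reference path and let \<open>R\<close> tend to infinity: the horizontal segments vanish, the line \<open>Re w = 1\<close>
  gives the principal value, and the vertical pieces at the two ends are controlled by \<open>e\<^sup>x\<close> alone.
  The analytic function \<open>g\<close> agrees with the integrand except perhaps at \<open>0\<close>, where the integrand takes a default value. If
  the mass is not an integer, the ends must lie on different sides of the negative axis, so that the vertical
  pieces do not cross it.\<close>

theorem loop_integral_bound:
  obtains C where "0 \<le> C"
    and "\<And>U g z P u v. open U \<Longrightarrow> g holomorphic_on U \<Longrightarrow> connected (- U) \<Longrightarrow>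
      (\<And>w. w \<notin> U \<Longrightarrow> Re w = 0 \<and> \<bar>Im w\<bar> \<le> \<bar>t\<bar> * B \<or> mass \<notin> \<nat> \<and> w \<in> \<real>\<^sub>\<le>\<^sub>0) \<Longrightarrow>
      (\<And>w. w \<in> U \<Longrightarrow> w \<noteq> 0 \<Longrightarrow> g w = integrand t w) \<Longrightarrow>
      z \<notin> U \<Longrightarrow> Re z = 0 \<Longrightarrow>
      valid_path P \<Longrightarrow> path_image P \<subseteq> U \<Longrightarrow> pathstart P = u \<Longrightarrow> pathfinish P = v \<Longrightarrow>
      Re u \<le> - far_radius t \<Longrightarrow> Re v \<le> - far_radius t \<Longrightarrow>
      winding_number (P +++ linepath v u) z = 1 \<Longrightarrow>
      (mass \<notin> \<nat> \<Longrightarrow> Im u < 0 \<and> 0 < Im v) \<Longrightarrow>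
      cmod (contour_integral P g - loop_value t) \<le> C * exp (Re u) + C * exp (Re v)"
proof -
  show ?thesis
  proof (rule vertical_segment_bound[of t])
    fix C assume C: "0 \<le> C"
      and vert: "\<And>x y1 y2. x \<le> - far_radius t \<Longrightarrow> y1 \<le> y2 \<Longrightarrow>
        (\<And>y. y1 \<le> y \<Longrightarrow> y \<le> y2 \<Longrightarrow> Complex x y \<notin> \<real>\<^sub>\<le>\<^sub>0 \<or> mass \<in> \<nat>) \<Longrightarrow>
        cmod (contour_integral (linepath (Complex x y1) (Complex x y2)) (\<lambda>w. exp w * amplitude t w)) \<le> C * exp x"
    show ?thesis
    proof (rule that[OF C])
      fix U :: "complex set" and g :: "complex \<Rightarrow> complex" and z u v :: complex and P :: "real \<Rightarrow> complex"
      assume U: "open U" "g holomorphic_on U" "connected (- U)"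
        and out: "\<And>w. w \<notin> U \<Longrightarrow> Re w = 0 \<and> \<bar>Im w\<bar> \<le> \<bar>t\<bar> * B \<or> mass \<notin> \<nat> \<and> w \<in> \<real>\<^sub>\<le>\<^sub>0"
        and g: "\<And>w. w \<in> U \<Longrightarrow> w \<noteq> 0 \<Longrightarrow> g w = integrand t w"
        and z: "z \<notin> U" "Re z = 0"
        and P: "valid_path P" "path_image P \<subseteq> U" "pathstart P = u" "pathfinish P = v"
        and ends: "Re u \<le> - far_radius t" "Re v \<le> - far_radius t"
        and wn: "winding_number (P +++ linepath v u) z = 1"
        and sides: "mass \<notin> \<nat> \<Longrightarrow> Im u < 0 \<and> 0 < Im v"
      let ?f = "\<lambda>w. exp w * amplitude t w"
      have zt: "\<bar>Im z\<bar> \<le> \<bar>t\<bar> * B"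
        using out[OF z(1)] z(2) B by (auto simp: complex_nonpos_Reals_iff)
      have tB: "\<bar>t\<bar> * B < far_radius t" using B by (simp add: far_radius_def add_nonneg_pos)
      have sides': "mass \<in> \<nat> \<or> Im u < 0 \<and> 0 < Im v" using sides by blast
      have neg: "Re u < 0" "Re v < 0" using ends far_radius_ge_1[of t] by linarith+
      define R0 where "R0 = max (far_radius t) (max \<bar>Im u\<bar> \<bar>Im v\<bar>)"
      have decomposition: "cmod (contour_integral P g - contour_integral (vline 1 R) (integrand t)
           - contour_integral (linepath (Complex (Re u) ((- 1) * R)) (Complex 1 ((- 1) * R))) ?f
           + contour_integral (linepath (Complex (Re v) (1 * R)) (Complex 1 (1 * R))) ?f) \<le> C * exp (Re u) + C * exp (Re v)"
        if R: "R0 \<le> R" for R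
      proof -
        have R: "far_radius t \<le> R" "\<bar>Im u\<bar> \<le> R" "\<bar>Im v\<bar> \<le> R" using R unfolding R0_def by auto
        have inU: "w \<in> U" if "Re w \<noteq> 0 \<or> \<bar>t\<bar> * B < \<bar>Im w\<bar>" "mass \<in> \<nat> \<or> w \<notin> \<real>\<^sub>\<le>\<^sub>0" for w
          using out[of w] that by force
        have h1: "Re w = Re u \<and> - R \<le> Im w \<and> Im w \<le> Im u" if "w \<in> closed_segment u (Complex (Re u) (- R))" for w
          using that R by (auto simp: closed_segment_same_Re closed_segment_eq_real_ivl split: if_splits)
        have h5: "Re w = Re v \<and> Im v \<le> Im w \<and> Im w \<le> R" if "w \<in> closed_segment (Complex (Re v) R) v" for w
          using that R by (auto simp: closed_segment_same_Re closed_segment_eq_real_ivl split: if_splits)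
        have s1: "closed_segment u (Complex (Re u) (- R)) \<subseteq> U"
        proof
          fix w assume "w \<in> closed_segment u (Complex (Re u) (- R))"
          from h1[OF this] show "w \<in> U" using sides neg by (intro inU) (auto simp: complex_nonpos_Reals_iff)
        qed
        have s5: "closed_segment (Complex (Re v) R) v \<subseteq> U"
        proof
          fix w assume "w \<in> closed_segment (Complex (Re v) R) v"
          from h5[OF this] show "w \<in> U" using sides neg by (intro inU) (auto simp: complex_nonpos_Reals_iff)
        qed
        have R1: "1 \<le> R" "\<bar>t\<bar> * B < R" using R(1) far_radius_ge_1[of t] tB by linarith+
        have s2: "closed_segment (Complex x y) (Complex x' y) \<subseteq> U" if "\<bar>y\<bar> = R" for x x' y
        proof
          fix w assume "w \<in> closed_segment (Complex x y) (Complex x' y)"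
          then have "Im w = y" by (auto simp: closed_segment_same_Im)
          then show "w \<in> U" using that R1 by (intro inU) (auto simp: complex_nonpos_Reals_iff)
        qed
        have s3: "closed_segment (Complex 1 (- R)) (Complex 1 R) \<subseteq> U"
        proof
          fix w assume "w \<in> closed_segment (Complex 1 (- R)) (Complex 1 R)"
          then have "Re w = 1" by (auto simp: closed_segment_same_Re)
          then show "w \<in> U" by (intro inU) (auto simp: complex_nonpos_Reals_iff)
        qed
        have "contour_integral P g = contour_integral (linepath u (Complex (Re u) (- R))) g +
          (contour_integral (linepath (Complex (Re u) (- R)) (Complex 1 (- R))) g +
          (contour_integral (vline 1 R) g +
          (contour_integral (linepath (Complex 1 R) (Complex (Re v) R)) g +
          contour_integral (linepath (Complex (Re v) R) v) g)))"
          using R1 zt by (intro loop_integral_eq_reference[OF P(1,2) U(1,3,2) z _ _ P(3,4) neg wn s1 _ s3 _ s5] s2) auto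
        moreover have eq: "contour_integral (linepath x y) g = contour_integral (linepath x y) ?f"
          if "closed_segment x y \<subseteq> U" "0 \<notin> closed_segment x y" for x y
          by (rule contour_integral_cong[OF refl]) (use that g integrand_eq in \<open>auto simp: subset_iff\<close>)
        moreover have "0 \<notin> closed_segment u (Complex (Re u) (- R))" "0 \<notin> closed_segment (Complex (Re v) R) v"
          using h1[of 0] h5[of 0] neg by auto
        moreover have "0 \<notin> closed_segment (Complex x y) (Complex x' y)" if "\<bar>y\<bar> = R" for x x' y
          using that R1 by (auto simp: closed_segment_same_Im)
        moreover have "0 \<notin> closed_segment (Complex 1 (- R)) (Complex 1 R)" by (auto simp: closed_segment_same_Re)
        ultimately have dec: "contour_integral P g = contour_integral (linepath u (Complex (Re u) (- R))) ?f +
          (contour_integral (linepath (Complex (Re u) (- R)) (Complex 1 (- R))) ?f +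
          (contour_integral (vline 1 R) (integrand t) +
          (contour_integral (linepath (Complex 1 R) (Complex (Re v) R)) ?f +
          contour_integral (linepath (Complex (Re v) R) v) ?f)))"
          using s1 s2 s3 s5 R1 by (simp add: integrand_eq[abs_def])
        have b1: "cmod (contour_integral (linepath u (Complex (Re u) (- R))) ?f) \<le> C * exp (Re u)"
        proof -
          have "cmod (contour_integral (linepath (Complex (Re u) (- R)) (Complex (Re u) (Im u))) ?f) \<le> C * exp (Re u)"
            using sides' R by (intro vert ends) (auto simp: complex_nonpos_Reals_iff)
          then show ?thesis by (simp add: contour_integral_linepath_swap[of u])
        qed
        have b5: "cmod (contour_integral (linepath (Complex (Re v) R) v) ?f) \<le> C * exp (Re v)"
        proof -
          have "cmod (contour_integral (linepath (Complex (Re v) (Im v)) (Complex (Re v) R)) ?f) \<le> C * exp (Re v)"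
            using sides' R by (intro vert ends) (auto simp: complex_nonpos_Reals_iff)
          then show ?thesis by (simp add: contour_integral_linepath_swap[of v])
        qed
        have "contour_integral P g - contour_integral (vline 1 R) (integrand t)
           - contour_integral (linepath (Complex (Re u) ((- 1) * R)) (Complex 1 ((- 1) * R))) ?f
           + contour_integral (linepath (Complex (Re v) (1 * R)) (Complex 1 (1 * R))) ?f =
           contour_integral (linepath u (Complex (Re u) (- R))) ?f + contour_integral (linepath (Complex (Re v) R) v) ?f"
          unfolding dec using contour_integral_linepath_swap[of "Complex 1 R" "Complex (Re v) R" ?f] by simp
        also have "cmod \<dots> \<le> C * exp (Re u) + C * exp (Re v)" by (rule norm_triangle_mono[OF b1 b5])
        finally show ?thesis .
      qed
      have "((\<lambda>R. cmod (contour_integral P g - contour_integral (vline 1 R) (integrand t)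
           - contour_integral (linepath (Complex (Re u) ((- 1) * R)) (Complex 1 ((- 1) * R))) ?f
           + contour_integral (linepath (Complex (Re v) (1 * R)) (Complex 1 (1 * R))) ?f)) \<longlongrightarrow>
           cmod (contour_integral P g - loop_value t - 0 + 0)) at_top"
        using neg by (intro tendsto_norm tendsto_add tendsto_diff tendsto_const vertical_limit horizontal_segment_tendsto_0) auto
      then have "cmod (contour_integral P g - loop_value t - 0 + 0) \<le> C * exp (Re u) + C * exp (Re v)"
        by (rule tendsto_upperbound) (use decomposition in \<open>auto intro: eventually_at_top_linorderI[of R0]\<close>)
      then show "cmod (contour_integral P g - loop_value t) \<le> C * exp (Re u) + C * exp (Re v)" by simp
    qed
  qed
qed

end

section \<open>The cuts and the hull of the support\<close>

lemma connected_of_scaling: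
  fixes T :: "complex set"
  assumes "0 \<in> T" "\<And>w r. w \<in> T \<Longrightarrow> 0 \<le> r \<Longrightarrow> r \<le> 1 \<Longrightarrow> of_real r * w \<in> T"
  shows "connected T"
proof (rule starlike_imp_connected)
  have "closed_segment 0 w \<subseteq> T" if "w \<in> T" for w
    using assms(2)[OF that] by (auto simp: closed_segment_def scaleR_conv_of_real)
  then show "starlike T" using assms(1) unfolding starlike_def by blast
qed

abbreviation spokes :: "real \<Rightarrow> real set \<Rightarrow> complex set" where
  "spokes t S \<equiv> {\<i> * of_real t * of_real x * of_real s | x s. x \<in> S \<and> s \<in> {0..1}}"

lemma spokes_scale: "w \<in> spokes t S \<Longrightarrow> 0 \<le> r \<Longrightarrow> r \<le> 1 \<Longrightarrow> of_real r * w \<in> spokes t S"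
proof -
  assume "w \<in> spokes t S" "0 \<le> r" "r \<le> 1"
  then obtain x s where x: "w = \<i> * of_real t * of_real x * of_real s" "x \<in> S" "0 \<le> s" "s \<le> 1" by auto
  then have "of_real r * w = \<i> * of_real t * of_real x * of_real (r * s)" by simp
  moreover have "r * s \<in> {0..1}" using x \<open>0 \<le> r\<close> \<open>r \<le> 1\<close> by (simp add: mult_le_one)
  ultimately show ?thesis using x(2) by blast
qed

lemma connected_spokes:
  assumes "S \<noteq> {}"
  shows "connected (spokes t S)"
proof (rule connected_of_scaling[OF _ spokes_scale])
  obtain x where "x \<in> S" using assms by blast
  then show "0 \<in> spokes t S" by (intro CollectI exI[of _ x] exI[of _ 0]) simp
qed

lemma connected_integrand_cuts: "connected (integrand_cuts t S)"
proof (rule connected_of_scaling)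
  fix w :: complex and r :: real assume w: "w \<in> integrand_cuts t S" and r: "0 \<le> r" "r \<le> 1"
  show "of_real r * w \<in> integrand_cuts t S"
  proof (cases "w \<in> \<real>\<^sub>\<le>\<^sub>0")
    case True
    then have "of_real r * w \<in> \<real>\<^sub>\<le>\<^sub>0" using r(1) by (auto simp: complex_nonpos_Reals_iff mult_nonneg_nonpos)
    then show ?thesis by (simp add: integrand_cuts_def)
  next
    case False
    then have "w \<in> spokes t S" using w unfolding integrand_cuts_def by blast
    from spokes_scale[OF this r] show ?thesis unfolding integrand_cuts_def by blast
  qed
qed (simp add: integrand_cuts_def)

lemma closed_integrand_cuts:
  assumes "compact S"
  shows "closed (integrand_cuts t S)"
proof -
  have "spokes t S = (\<lambda>p. \<i> * of_real t * of_real (fst p) * of_real (snd p)) ` (S \<times> {0..1})" by force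
  moreover have "compact ((\<lambda>p. \<i> * of_real t * of_real (fst p) * of_real (snd p) :: complex) ` (S \<times> {0..1}))"
    using assms by (intro compact_continuous_image continuous_intros compact_Times) auto
  ultimately have "closed (spokes t S)" using compact_imp_closed by simp
  then show ?thesis unfolding integrand_cuts_def by (intro closed_Un closed_nonpos_Reals_complex)
qed

definition support_hull :: "real \<Rightarrow> real set \<Rightarrow> complex set" where
  "support_hull t S = closure (convex hull ((\<lambda>x. \<i> * of_real t * of_real x) ` S))"

lemma convex_support_hull: "convex (support_hull t S)"
  unfolding support_hull_def by (intro convex_closure convex_convex_hull)

lemma in_support_hull:
  assumes "x \<in> convex hull S"
  shows "\<i> * of_real t * of_real x \<in> support_hull t S"
proof -
  have "linear (\<lambda>x. \<i> * complex_of_real t * complex_of_real x)"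
    by (rule linearI) (auto simp: algebra_simps scaleR_conv_of_real)
  from convex_hull_linear_image[OF this, of S] assms show ?thesis
    unfolding support_hull_def by (intro subsetD[OF closure_subset]) auto
qed

lemma support_hull_subset:
  assumes "\<And>x. x \<in> S \<Longrightarrow> \<bar>x\<bar> \<le> B"
  shows "support_hull t S \<subseteq> {w. Re w = 0 \<and> \<bar>Im w\<bar> \<le> \<bar>t\<bar> * B}"
  unfolding support_hull_def
proof (intro closure_minimal hull_minimal)
  show "(\<lambda>x. \<i> * of_real t * of_real x) ` S \<subseteq> {w. Re w = 0 \<and> \<bar>Im w\<bar> \<le> \<bar>t\<bar> * B}"
    using assms by (auto simp: abs_mult intro!: mult_left_mono)
  have eq: "{w. Re w = 0 \<and> \<bar>Im w\<bar> \<le> \<bar>t\<bar> * B} = {w. Re w \<le> 0} \<inter> {w. 0 \<le> Re w} \<inter> {w. Im w \<le> \<bar>t\<bar> * B} \<inter> {w. - (\<bar>t\<bar> * B) \<le> Im w}"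
    by (auto simp: abs_le_iff)
  show "convex {w. Re w = 0 \<and> \<bar>Im w\<bar> \<le> \<bar>t\<bar> * B}"
    unfolding eq by (intro convex_Int convex_halfspace_Re_le convex_halfspace_Re_ge convex_halfspace_Im_le convex_halfspace_Im_ge)
  show "closed {w. Re w = 0 \<and> \<bar>Im w\<bar> \<le> \<bar>t\<bar> * B}"
    unfolding eq by (intro closed_Int closed_halfspace_Re_le closed_halfspace_Re_ge closed_halfspace_Im_le closed_halfspace_Im_ge)
qed

text \<open>The argument of the logarithm is \<open>(w - itx) / (w - itx\<^sub>0)\<close>. If it were real and nonpositive, \<open>w\<close> would lie on the
  segment between two points of the hull.\<close>

lemma shifted_log_argument:
  assumes "w \<notin> support_hull t S" "x0 \<in> convex hull S" "x \<in> convex hull S"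
  shows "1 - \<i> * of_real t / (w - \<i> * of_real t * of_real x0) * of_real (x - x0) \<notin> \<real>\<^sub>\<le>\<^sub>0"
proof
  let ?z = "\<i> * complex_of_real t * of_real x0" and ?y = "\<i> * complex_of_real t * of_real x"
  have nz: "w - ?z \<noteq> 0" using assms(1) in_support_hull[OF assms(2), of t] by auto
  assume "1 - \<i> * of_real t / (w - ?z) * of_real (x - x0) \<in> \<real>\<^sub>\<le>\<^sub>0"
  then obtain r where r: "r \<le> 0" "1 - \<i> * of_real t / (w - ?z) * of_real (x - x0) = of_real r"
    by (auto elim!: nonpos_Reals_cases)
  have "w - ?z - \<i> * of_real t * of_real (x - x0) = of_real r * (w - ?z)"
    unfolding r(2)[symmetric] using nz by (simp add: field_simps)
  then have eqw: "of_real (1 - r) * w = ?y - of_real r * ?z" by (simp add: algebra_simps)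
  have nzr: "complex_of_real (1 - r) \<noteq> 0" using r(1) unfolding of_real_eq_0_iff by linarith
  have "w = (?y - of_real r * ?z) / of_real (1 - r)"
    by (subst nonzero_eq_divide_eq[OF nzr], subst mult.commute, rule eqw)
  also have "\<dots> = of_real (1 / (1 - r)) * ?y + of_real (- r / (1 - r)) * ?z"
    by (simp add: diff_divide_distrib del: of_real_diff)
  finally have "w = of_real (1 / (1 - r)) * ?y + of_real (- r / (1 - r)) * ?z" .
  then have "w = (1 / (1 - r)) *\<^sub>R ?y + (- r / (1 - r)) *\<^sub>R ?z" by (simp only: scaleR_conv_of_real)
  moreover have "(1 / (1 - r)) *\<^sub>R ?y + (- r / (1 - r)) *\<^sub>R ?z \<in> support_hull t S"
    using r(1) by (intro convexD[OF convex_support_hull] in_support_hull assms) (auto simp: divide_simps)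
  ultimately show False using assms(1) by simp
qed

text \<open>Along the hull, the argument of the logarithm stays off the cut, unless it is real and negative throughout.\<close>

lemma continuous_on_hull_Ln:
  assumes w: "w \<notin> support_hull t S" "w \<noteq> 0"
  shows "continuous_on (convex hull S) (\<lambda>x. Ln (1 - \<i> * of_real t / w * of_real x))"
proof (cases "\<forall>x\<in>convex hull S. 1 - \<i> * of_real t / w * of_real x \<notin> \<real>\<^sub>\<le>\<^sub>0")
  case True
  then show ?thesis by (intro continuous_intros) auto
next
  case False
  then obtain x1 r where x1: "x1 \<in> convex hull S" "1 - \<i> * of_real t / w * of_real x1 = of_real r" "r \<le> 0"
    by (auto elim!: nonpos_Reals_cases)
  then have "x1 \<noteq> 0" by auto
  define q where "q = (1 - r) / x1"
  have q: "\<i> * of_real t / w = of_real q"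
    using x1(2) \<open>x1 \<noteq> 0\<close> unfolding q_def by (simp add: field_simps)
  have nz: "1 - q * x \<noteq> 0" if "x \<in> convex hull S" for x
  proof
    assume "1 - q * x = 0"
    then have "1 - \<i> * of_real t / w * of_real x = 0" unfolding q by (metis of_real_0 of_real_1 of_real_diff of_real_mult)
    then have "w = \<i> * of_real t * of_real x" using w(2) by (simp add: field_simps)
    then show False using w(1) in_support_hull[OF that] by blast
  qed
  have "1 - q * x1 < 0"
    using nz[OF x1(1)] x1(3) \<open>x1 \<noteq> 0\<close> by (simp add: q_def)
  have neg: "1 - q * x < 0" if x: "x \<in> convex hull S" for x
  proof (rule ccontr)
    assume "\<not> 1 - q * x < 0"
    moreover have "is_interval ((\<lambda>x. 1 - q * x) ` (convex hull S))"
      unfolding is_interval_connected_1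
      by (intro connected_continuous_image continuous_intros convex_connected convex_convex_hull)
    ultimately have "0 \<in> (\<lambda>x. 1 - q * x) ` (convex hull S)"
      using \<open>1 - q * x1 < 0\<close> x x1(1) unfolding is_interval_1 by (meson imageI less_imp_le not_less)
    then show False using nz by auto
  qed
  have "continuous_on (convex hull S) (\<lambda>x. complex_of_real (ln (- (1 - q * x))) + \<i> * of_real pi)"
    using neg by (intro continuous_intros) force
  moreover have "Ln (1 - \<i> * of_real t / w * of_real x) = complex_of_real (ln (- (1 - q * x))) + \<i> * of_real pi"
    if "x \<in> convex hull S" for x
  proof -
    have "Ln (of_real (1 - q * x)) = complex_of_real (ln \<bar>1 - q * x\<bar>) + \<i> * of_real pi"
      using neg[OF that] by (subst Ln_of_real') auto
    then show ?thesis using neg[OF that] unfolding q by simp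
  qed
  ultimately show ?thesis by (simp cong: continuous_on_cong)
qed

context compact_measure begin

text \<open>Move the base point of the logarithms from \<open>0\<close> to a point \<open>x\<^sub>0\<close> of the support. The two logarithms at \<open>x\<close> differ by
  the logarithm of \<open>(w - itx\<^sub>0) / w\<close>: exponentiating shows this up to a multiple of \<open>2 \<pi> i\<close>, the multiple depends
  continuously on \<open>x\<close> in the hull of \<open>S\<close>, and it is \<open>0\<close> at \<open>x\<^sub>0\<close>. Integration multiplies the difference by the mass \<open>n\<close>, which leaves
  the rational factor \<open>((w - itx\<^sub>0) / w)\<^sup>n\<close>. With the new base point all logarithms are off their cut outside the hull.\<close>

lemma integer_mass_extension:
  assumes x0: "x0 \<in> S" and mass: "measure \<alpha> UNIV \<in> \<nat>"
  obtains g where "g holomorphic_on - support_hull t S"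
    and "\<And>w. w \<notin> support_hull t S \<Longrightarrow> w \<noteq> 0 \<Longrightarrow> g w = dirichlet_mean_integrand \<alpha> (measure \<alpha> UNIV) t w"
proof -
  obtain n where n: "measure \<alpha> UNIV = real n" using mass by (auto elim: Nats_cases)
  define z where "z = \<i> * complex_of_real t * of_real x0"
  define g where "g w = exp w * (exp (- log_integral x0 (\<i> * of_real t / (w - z))) / (w - z) ^ n)" for w
  have hull: "x \<in> S \<Longrightarrow> x \<in> convex hull S" for x by (rule hull_inc)
  have nz: "w - z \<noteq> 0" if "w \<notin> support_hull t S" for w
    using that in_support_hull[OF hull[OF x0], of t] by (auto simp: z_def)
  have dom: "\<i> * of_real t / (w - z) \<in> log_domain x0" if "w \<notin> support_hull t S" for w
    unfolding log_domain_def z_def using shifted_log_argument[OF that hull[OF x0] hull] by blast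
  show ?thesis
  proof (rule that[of g])
    have "(\<lambda>w. log_integral x0 (\<i> * of_real t / (w - z))) holomorphic_on - support_hull t S"
      using dom nz by (intro holomorphic_on_compose_gen[OF _ holomorphic_log_integral, unfolded o_def] holomorphic_intros) auto
    then show "g holomorphic_on - support_hull t S"
      unfolding g_def using nz by (intro holomorphic_intros) auto
    fix w assume w: "w \<notin> support_hull t S" "w \<noteq> 0"
    define \<phi>1 where "\<phi>1 x = Ln (1 - \<i> * of_real t / w * of_real x)" for x
    define \<phi>2 where "\<phi>2 x = Ln (1 - \<i> * of_real t / (w - z) * of_real (x - x0))" for x
    define E where "E x = \<phi>1 x - \<phi>2 x - \<phi>1 x0" for x
    have arg: "1 - \<i> * of_real t / w * of_real x \<noteq> 0" if "x \<in> convex hull S" for x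
    proof
      assume "1 - \<i> * of_real t / w * of_real x = 0"
      then have "w = \<i> * of_real t * of_real x" using w(2) by (simp add: field_simps)
      then show False using w(1) in_support_hull[OF that] by blast
    qed
    have arg2: "1 - \<i> * of_real t / (w - z) * of_real (x - x0) \<notin> \<real>\<^sub>\<le>\<^sub>0" if "x \<in> convex hull S" for x
      using shifted_log_argument[OF w(1) hull[OF x0] that] by (simp add: z_def)
    have expE: "exp (E x) = 1" if "x \<in> convex hull S" for x
    proof -
      have a2: "1 - \<i> * of_real t / (w - z) * of_real (x - x0) \<noteq> 0" using arg2[OF that] by (metis nonpos_Reals_zero_I)
      have "exp (E x) = exp (\<phi>1 x) / exp (\<phi>2 x) / exp (\<phi>1 x0)" by (simp add: E_def exp_diff)
      also have "\<dots> = (1 - \<i> * of_real t / w * of_real x) / (1 - \<i> * of_real t / (w - z) * of_real (x - x0)) / (1 - \<i> * of_real t / w * of_real x0)"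
        unfolding \<phi>1_def \<phi>2_def using arg[OF that] arg[OF hull[OF x0]] a2 by simp
      also have "1 - \<i> * of_real t / w * of_real x = (w - \<i> * of_real t * of_real x) / w" using w(2) by (simp add: field_simps)
      also have "1 - \<i> * of_real t / (w - z) * of_real (x - x0) = (w - \<i> * of_real t * of_real x) / (w - z)"
        using nz[OF w(1)] by (simp add: z_def field_simps)
      also have "1 - \<i> * of_real t / w * of_real x0 = (w - z) / w" using w(2) by (simp add: z_def field_simps)
      finally have "exp (E x) = (w - \<i> * of_real t * of_real x) / w / ((w - \<i> * of_real t * of_real x) / (w - z)) / ((w - z) / w)" .
      moreover have "w - \<i> * of_real t * of_real x \<noteq> 0" using w(1) in_support_hull[OF that, of t] by auto
      ultimately show ?thesis using w(2) nz[OF w(1)] by simp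
    qed
    have "E constant_on (convex hull S)"
    proof (rule continuous_discrete_range_constant)
      show "connected (convex hull S)" by (intro convex_connected convex_convex_hull)
      have "continuous_on (convex hull S) \<phi>2"
        unfolding \<phi>2_def using arg2 by (intro continuous_intros) auto
      then show "continuous_on (convex hull S) E"
        unfolding E_def \<phi>1_def by (intro continuous_on_diff continuous_on_const continuous_on_hull_Ln[OF w])
      fix x assume x: "x \<in> convex hull S"
      \<comment> \<open>The values of \<open>E\<close> are multiples of \<open>2 \<pi> i\<close>, so distinct values are at least \<open>2 \<pi>\<close> apart.\<close>
      have "2 * pi \<le> cmod (E y - E x)" if "y \<in> convex hull S" "E y \<noteq> E x" for y
      proof -
        have "exp (E y - E x) = 1" using expE[OF that(1)] expE[OF x] by (simp add: exp_diff)
        then obtain k :: int where k: "Re (E y - E x) = 0" "Im (E y - E x) = of_int (2 * k) * pi" unfolding exp_eq_1 by blast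
        then have "k \<noteq> 0" using that(2) by (auto simp: complex_eq_iff)
        then have "1 \<le> \<bar>of_int k :: real\<bar>" by linarith
        then have "2 * pi * 1 \<le> 2 * pi * \<bar>of_int k\<bar>" by (intro mult_left_mono) auto
        also have "\<dots> = \<bar>Im (E y - E x)\<bar>" unfolding k(2) by (simp add: abs_mult)
        also have "\<dots> \<le> cmod (E y - E x)" by (rule abs_Im_le_cmod)
        finally show ?thesis by simp
      qed
      then show "\<exists>e>0. \<forall>y. y \<in> convex hull S \<and> E y \<noteq> E x \<longrightarrow> e \<le> cmod (E y - E x)"
        by (intro exI[of _ "2 * pi"]) auto
    qed
    moreover have "E x0 = 0" by (simp add: E_def \<phi>2_def)
    ultimately have "E x = 0" if "x \<in> convex hull S" for x
      using that hull[OF x0] unfolding constant_on_def by metis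
    then have \<phi>: "\<phi>1 x = \<phi>2 x + \<phi>1 x0" if "x \<in> convex hull S" for x
      using that unfolding E_def by (metis add.commute diff_add_cancel diff_eq_eq diff_zero)
    have "log_integral 0 (\<i> * of_real t / w) = (\<integral>x. \<phi>2 x + \<phi>1 x0 \<partial>\<alpha>)"
      unfolding log_integral_def
    proof (rule integral_cong_AE)
      show "AE x in \<alpha>. Ln (1 - \<i> * of_real t / w * of_real (x - 0)) = \<phi>2 x + \<phi>1 x0"
        using AE_S
      proof eventually_elim
        case (elim x)
        from \<phi>[OF hull[OF elim]] show ?case by (simp add: \<phi>1_def)
      qed
      show "(\<lambda>x. \<phi>2 x + \<phi>1 x0) \<in> borel_measurable \<alpha>"
        unfolding \<phi>2_def by (intro borel_measurable_add borel_measurable_const borel_measurable_\<alpha>[OF measurable_Ln_linear])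
    qed (rule borel_measurable_\<alpha>[OF measurable_Ln_linear])
    also have "\<dots> = log_integral x0 (\<i> * of_real t / (w - z)) + of_nat n * \<phi>1 x0"
      using integrable_Ln_linear[OF dom[OF w(1)]] unfolding \<phi>2_def log_integral_def
      by (subst Bochner_Integration.integral_add) (auto simp: space_\<alpha> n scaleR_conv_of_real)
    finally have "exp (- log_integral 0 (\<i> * of_real t / w)) = exp (- log_integral x0 (\<i> * of_real t / (w - z))) / exp (\<phi>1 x0) ^ n"
      by (simp add: exp_diff exp_of_nat_mult[symmetric] exp_minus exp_add divide_inverse)
    moreover have "exp (\<phi>1 x0) = (w - z) / w"
      unfolding \<phi>1_def using arg[OF hull[OF x0]] w(2) by (simp add: z_def field_simps)
    moreover have "w powr of_real (measure \<alpha> UNIV) = w ^ n" using w(2) by (simp add: n)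
    ultimately show "g w = dirichlet_mean_integrand \<alpha> (measure \<alpha> UNIV) t w"
      unfolding integrand_eq amplitude_def g_def using w(2) nz[OF w(1)] by (simp add: power_divide)
  qed
qed

end

text \<open>The complement of the support is a union of open null sets; by second countability countably many suffice.\<close>

lemma measure_support_complement:
  assumes "sets \<alpha> = sets (borel :: real measure)"
  shows "open (- measure_support \<alpha>)" "emeasure \<alpha> (- measure_support \<alpha>) = 0"
proof -
  have eq: "- measure_support \<alpha> = \<Union>{U. open U \<and> emeasure \<alpha> U = 0}"
    unfolding measure_support_def by (auto simp: zero_less_iff_neq_zero)
  show op: "open (- measure_support \<alpha>)" unfolding eq by (rule open_Union) blast
  obtain \<B> :: "real set set" where B: "countable \<B>" "topological_basis \<B>" using ex_countable_basis by blast
  let ?N = "{b \<in> \<B>. emeasure \<alpha> b = 0}"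
  have null: "b \<in> null_sets \<alpha>" if "b \<in> ?N" for b
  proof (rule null_setsI)
    have "open b" using that topological_basis_open[OF B(2)] by blast
    then show "b \<in> sets \<alpha>" unfolding assms by (rule borel_open)
  qed (use that in blast)
  have "- measure_support \<alpha> \<subseteq> \<Union>?N"
  proof
    fix x assume "x \<in> - measure_support \<alpha>"
    then obtain U where U: "open U" "emeasure \<alpha> U = 0" "x \<in> U" unfolding eq by blast
    then obtain b where b: "b \<in> \<B>" "x \<in> b" "b \<subseteq> U" using topological_basisE[OF B(2) U(1,3)] by blast
    have "emeasure \<alpha> b \<le> emeasure \<alpha> U" using b(3) borel_open[OF U(1)] unfolding assms[symmetric] by (rule emeasure_mono)
    then have "emeasure \<alpha> b = 0" unfolding U(2) by simp
    then show "x \<in> \<Union>?N" using b(1,2) by blast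
  qed
  moreover have "countable ?N" using B(1) by (rule countable_subset[rotated]) blast
  then have "(\<Union>b\<in>?N. b) \<in> null_sets \<alpha>"
    using null by (rule null_sets_UN')
  then have "\<Union>?N \<in> null_sets \<alpha>" by simp
  moreover have "- measure_support \<alpha> \<in> sets \<alpha>" unfolding assms by (rule borel_open[OF op])
  ultimately have "- measure_support \<alpha> \<in> null_sets \<alpha>" using null_sets_subset by blast
  then show "emeasure \<alpha> (- measure_support \<alpha>) = 0" by (rule null_setsD1)
qed

section \<open>The integral along a loop\<close>

lemma has_contour_integral_spike_point:
  assumes g: "(g has_contour_integral L) P" and fin: "finite {s \<in> {0..1}. P s = y}"
    and eq: "\<And>w. w \<in> path_image P \<Longrightarrow> w \<noteq> y \<Longrightarrow> f w = g w"
  shows "(f has_contour_integral L) P"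
  using g unfolding has_contour_integral_def
  by (rule has_integral_spike_finite[OF fin, rotated]) (use eq in \<open>auto simp: path_image_def\<close>)

lemma path_image_subpath_range: "path_image (subpath p q c) \<subseteq> range c"
  by (auto simp: path_image_def subpath_def)

lemma finite_subpath_preimage:
  assumes "inj c" "p < q"
  shows "finite {s \<in> {0..1}. subpath p q c s = y}"
proof -
  have eq: "s = s'" if "subpath p q c s = y" "subpath p q c s' = y" for s s'
  proof -
    have "c ((q - p) * s + p) = c ((q - p) * s' + p)" using that by (simp add: subpath_def)
    then have "(q - p) * s + p = (q - p) * s' + p" by (rule injD[OF assms(1)])
    then show ?thesis using assms(2) by simp
  qed
  show ?thesis
  proof (cases "\<exists>s. subpath p q c s = y")
    case True
    then obtain s0 where "subpath p q c s0 = y" by blast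
    then have "{s \<in> {0..1}. subpath p q c s = y} \<subseteq> {s0}" using eq by blast
    then show ?thesis by (rule finite_subset) simp
  qed simp
qed

context dirichlet_mean begin

lemma tendsto_exp_Re_ends:
  assumes "filterlim (\<lambda>s. Re (c s)) at_bot at_bot" "filterlim (\<lambda>s. Re (c s)) at_bot at_top"
  shows "((\<lambda>(p, q). C * exp (Re (c p)) + C * exp (Re (c q))) \<longlongrightarrow> 0) (at_bot \<times>\<^sub>F at_top)"
proof -
  have "((\<lambda>x. exp (Re (c (fst x)))) \<longlongrightarrow> 0) (at_bot \<times>\<^sub>F at_top)"
    by (rule filterlim_compose[OF filterlim_compose[OF exp_at_bot assms(1)] filterlim_fst])
  moreover have "((\<lambda>x. exp (Re (c (snd x)))) \<longlongrightarrow> 0) (at_bot \<times>\<^sub>F at_top)"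
    by (rule filterlim_compose[OF filterlim_compose[OF exp_at_bot assms(2)] filterlim_snd])
  ultimately have "((\<lambda>x. C * exp (Re (c (fst x))) + C * exp (Re (c (snd x)))) \<longlongrightarrow> C * 0 + C * 0) (at_bot \<times>\<^sub>F at_top)"
    by (intro tendsto_intros)
  then show ?thesis by (simp add: split_beta')
qed

text \<open>The bound for the pieces of the loop tends to \<open>0\<close> because the real parts of both ends tend to \<open>-\<infinity>\<close>. A loop passes
  through \<open>0\<close> at most once, so the value of the integrand there does not matter.\<close>

theorem has_loop_integral_of_extension:
  assumes loop: "simple_loop_from_minus_infinity c"
    and U: "open U" "g holomorphic_on U" "connected (- U)"
    and out: "\<And>w. w \<notin> U \<Longrightarrow> Re w = 0 \<and> \<bar>Im w\<bar> \<le> \<bar>t\<bar> * B \<or> mass \<notin> \<nat> \<and> w \<in> \<real>\<^sub>\<le>\<^sub>0"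
    and g: "\<And>w. w \<in> U \<Longrightarrow> w \<noteq> 0 \<Longrightarrow> g w = integrand t w"
    and z: "z \<notin> U" "Re z = 0" and c: "range c \<subseteq> U" and enc: "loop_encircles c z"
    and sides: "\<And>p q. p < q \<Longrightarrow> Re (c p) < 0 \<Longrightarrow> Re (c q) < 0 \<Longrightarrow>
        winding_number (subpath p q c +++ linepath (c q) (c p)) z = 1 \<Longrightarrow> mass \<notin> \<nat> \<Longrightarrow> Im (c p) < 0 \<and> 0 < Im (c q)"
  shows "has_loop_integral (integrand t) (loop_value t) c"
proof -
  have inj: "inj c" and valid: "\<And>p q. p < q \<Longrightarrow> valid_path (subpath p q c)"
    and left: "filterlim (\<lambda>s. Re (c s)) at_bot at_bot" "filterlim (\<lambda>s. Re (c s)) at_bot at_top"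
    using loop unfolding simple_loop_from_minus_infinity_def by auto
  have img: "path_image (subpath p q c) \<subseteq> U" for p q using path_image_subpath_range c by blast
  have same: "(integrand t has_contour_integral contour_integral (subpath p q c) g) (subpath p q c)" if "p < q" for p q
  proof (rule has_contour_integral_spike_point)
    show "(g has_contour_integral contour_integral (subpath p q c) g) (subpath p q c)"
      by (rule has_contour_integral_integral[OF contour_integrable_holomorphic_simple[OF U(2,1) valid[OF that] img]])
    show "finite {s \<in> {0..1}. subpath p q c s = 0}" by (rule finite_subpath_preimage[OF inj that])
    show "integrand t w = g w" if "w \<in> path_image (subpath p q c)" "w \<noteq> 0" for w
      using g[of w] img that by (metis subsetD)
  qed
  show ?thesis
  proof (rule loop_integral_bound[of t])
    fix C assume C: "0 \<le> C" and bound: "\<And>U g z P u v. open U \<Longrightarrow> g holomorphic_on U \<Longrightarrow> connected (- U) \<Longrightarrow>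
        (\<And>w. w \<notin> U \<Longrightarrow> Re w = 0 \<and> \<bar>Im w\<bar> \<le> \<bar>t\<bar> * B \<or> mass \<notin> \<nat> \<and> w \<in> \<real>\<^sub>\<le>\<^sub>0) \<Longrightarrow>
        (\<And>w. w \<in> U \<Longrightarrow> w \<noteq> 0 \<Longrightarrow> g w = integrand t w) \<Longrightarrow>
        z \<notin> U \<Longrightarrow> Re z = 0 \<Longrightarrow>
        valid_path P \<Longrightarrow> path_image P \<subseteq> U \<Longrightarrow> pathstart P = u \<Longrightarrow> pathfinish P = v \<Longrightarrow>
        Re u \<le> - far_radius t \<Longrightarrow> Re v \<le> - far_radius t \<Longrightarrow>
        winding_number (P +++ linepath v u) z = 1 \<Longrightarrow>
        (mass \<notin> \<nat> \<Longrightarrow> Im u < 0 \<and> 0 < Im v) \<Longrightarrow>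
        cmod (contour_integral P g - loop_value t) \<le> C * exp (Re u) + C * exp (Re v)"
    have "\<forall>\<^sub>F x in at_bot \<times>\<^sub>F at_top. Re (c (fst x)) \<le> - far_radius t \<and> fst x < 0"
      using left(1) unfolding filterlim_at_bot
      by (intro eventually_conj filterlim_fst[THEN filterlim_iff[THEN iffD1], rule_format] eventually_gt_at_bot) blast+
    moreover have "\<forall>\<^sub>F x in at_bot \<times>\<^sub>F at_top. Re (c (snd x)) \<le> - far_radius t \<and> 0 < snd x"
      using left(2) unfolding filterlim_at_bot
      by (intro eventually_conj filterlim_snd[THEN filterlim_iff[THEN iffD1], rule_format] eventually_gt_at_top) blast+
    moreover have "\<forall>\<^sub>F x in at_bot \<times>\<^sub>F at_top. winding_number (subpath (fst x) (snd x) c +++ linepath (c (snd x)) (c (fst x))) z = 1"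
      using enc unfolding loop_encircles_def by (simp only: split_beta')
    ultimately have "\<forall>\<^sub>F x in at_bot \<times>\<^sub>F at_top. norm ((case x of (p, q) \<Rightarrow> contour_integral (subpath p q c) (integrand t)) - loop_value t)
        \<le> (case x of (p, q) \<Rightarrow> C * exp (Re (c p)) + C * exp (Re (c q)))"
    proof eventually_elim
      case (elim x)
      obtain p q where x: "x = (p, q)" by (cases x)
      have pq: "p < q" and far: "Re (c p) \<le> - far_radius t" "Re (c q) \<le> - far_radius t"
        and wn: "winding_number (subpath p q c +++ linepath (c q) (c p)) z = 1"
        using elim by (auto simp: x)
      have neg: "Re (c p) < 0" "Re (c q) < 0" using far far_radius_ge_1[of t] by linarith+
      have "cmod (contour_integral (subpath p q c) g - loop_value t) \<le> C * exp (Re (c p)) + C * exp (Re (c q))"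
        by (rule bound[OF U out g z valid[OF pq] img _ _ far wn sides[OF pq neg wn]]) simp_all
      then show ?case by (simp add: x contour_integral_unique[OF same[OF pq]])
    qed
    from Lim_null_comparison[OF this tendsto_exp_Re_ends[OF left]]
    have "((\<lambda>x. case x of (p, q) \<Rightarrow> contour_integral (subpath p q c) (integrand t)) \<longlongrightarrow> loop_value t) (at_bot \<times>\<^sub>F at_top)"
      by (rule Lim_null[THEN iffD2])
    then show ?thesis
      unfolding has_loop_integral_def using same by (auto simp: contour_integrable_on_def)
  qed
qed

text \<open>For an integral mass, use the extension to the complement of the hull. Otherwise use the
  complement of the cuts: the loop avoids the connected union of the segments from \<open>0\<close> to the points \<open>itx\<close>, so it winds once
  around \<open>0\<close> as well, and as it stays off the negative axis its ends lie on opposite sides of this axis.\<close>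

theorem has_loop_integral_integrand:
  assumes loop: "simple_loop_from_minus_infinity c" and ne: "S \<noteq> {}"
    and enc: "\<And>z. z \<in> support_hull t S \<Longrightarrow> loop_encircles c z"
    and hull: "support_hull t S \<inter> range c = {}"
    and cuts: "mass \<notin> \<nat> \<Longrightarrow> range c \<inter> integrand_cuts t S = {}"
  shows "has_loop_integral (integrand t) (loop_value t) c"
proof -
  obtain x0 where x0: "x0 \<in> S" using ne by blast
  define z where "z = \<i> * complex_of_real t * of_real x0"
  have z_hull: "z \<in> support_hull t S" unfolding z_def by (rule in_support_hull[OF hull_inc[OF x0]])
  have Re_z: "Re z = 0" by (simp add: z_def)
  note hull_sub = support_hull_subset[OF abs_S_le, of S t]
  show ?thesis
  proof (cases "mass \<in> \<nat>")
    case True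
    show ?thesis
    proof (rule integer_mass_extension[OF x0 True, of t])
      fix g assume g: "g holomorphic_on - support_hull t S"
        "\<And>w. w \<notin> support_hull t S \<Longrightarrow> w \<noteq> 0 \<Longrightarrow> g w = integrand t w"
      show ?thesis
      proof (rule has_loop_integral_of_extension[OF loop _ g(1) _ _ _ _ Re_z _ enc[OF z_hull]])
        show "open (- support_hull t S)" by (simp add: support_hull_def open_Compl)
        show "connected (- (- support_hull t S))" using convex_connected[OF convex_support_hull] by simp
        show "Re w = 0 \<and> \<bar>Im w\<bar> \<le> \<bar>t\<bar> * B \<or> mass \<notin> \<nat> \<and> w \<in> \<real>\<^sub>\<le>\<^sub>0" if "w \<notin> - support_hull t S" for w
          using that hull_sub by blast
      qed (use g(2) z_hull hull True in auto)
    qed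
  next
    case False
    have c: "range c \<inter> integrand_cuts t S = {}" by (rule cuts[OF False])
    have spoke: "z \<in> spokes t S" unfolding z_def using x0 by (intro CollectI exI[of _ x0] exI[of _ 1]) simp
    have zero: "0 \<in> spokes t S" using x0 by (intro CollectI exI[of _ x0] exI[of _ 0]) simp
    show ?thesis
    proof (rule has_loop_integral_of_extension[OF loop _ holomorphic_integrand _ _ _ _ Re_z _ enc[OF z_hull]])
      show "open (- integrand_cuts t S)" using closed_integrand_cuts[OF compact_S] by (simp add: open_Compl)
      show "connected (- (- integrand_cuts t S))" using connected_integrand_cuts by simp
      show "Re w = 0 \<and> \<bar>Im w\<bar> \<le> \<bar>t\<bar> * B \<or> mass \<notin> \<nat> \<and> w \<in> \<real>\<^sub>\<le>\<^sub>0" if w_out: "w \<notin> - integrand_cuts t S" for w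
      proof (cases "w \<in> \<real>\<^sub>\<le>\<^sub>0")
        case F: False
        then obtain x s where w: "w = \<i> * of_real t * of_real x * of_real s" "x \<in> S" "0 \<le> s" "s \<le> 1"
          using w_out by (auto simp: integrand_cuts_def)
        have "\<bar>x\<bar> * \<bar>s\<bar> \<le> B * 1" using abs_S_le[OF w(2)] w(3,4) B by (intro mult_mono) auto
        then have "\<bar>t\<bar> * (\<bar>x\<bar> * \<bar>s\<bar>) \<le> \<bar>t\<bar> * B" by (intro mult_left_mono) auto
        then show ?thesis unfolding w(1) by (simp add: abs_mult mult.assoc)
      qed (use False in simp)
      show "range c \<subseteq> - integrand_cuts t S" using c by blast
      show "z \<notin> - integrand_cuts t S" using spoke by (simp add: integrand_cuts_def)
      fix p q :: real assume pq: "p < q" and neg: "Re (c p) < 0" "Re (c q) < 0"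
        and wn: "winding_number (subpath p q c +++ linepath (c q) (c p)) z = 1"
      let ?P = "subpath p q c"
      let ?W = "?P +++ linepath (c q) (c p)"
      have P: "valid_path ?P" using loop pq by (simp add: simple_loop_from_minus_infinity_def)
      have ends: "pathstart ?P = c p" "pathfinish ?P = c q" by simp_all
      have off: "path_image ?P \<inter> integrand_cuts t S = {}" using c path_image_subpath_range by blast
      have line: "Re w < 0" if "w \<in> closed_segment (c q) (c p)" for w
        using neg that closed_segment_subset[OF _ _ convex_halfspace_Re_lt[of 0], of "c q" "c p"] by auto
      have W_img: "path_image ?W \<inter> spokes t S = {}"
      proof -
        have "path_image ?W = path_image ?P \<union> closed_segment (c q) (c p)"
          using ends by (simp add: path_image_join)
        moreover have "closed_segment (c q) (c p) \<inter> spokes t S = {}" using line by force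
        moreover have "path_image ?P \<inter> spokes t S = {}" using off by (auto simp: integrand_cuts_def)
        ultimately show ?thesis by blast
      qed
      have "path ?W" using valid_path_imp_path[OF P] ends by (simp add: path_join)
      then have "winding_number ?W constant_on spokes t S"
        using W_img connected_spokes[OF ne] by (intro winding_number_constant) auto
      then obtain k where "\<forall>y\<in>spokes t S. winding_number ?W y = k" unfolding constant_on_def by blast
      from bspec[OF this spoke] bspec[OF this zero] wn have "winding_number ?W 0 = 1" by simp
      then have w0: "winding_number (?P +++ linepath (pathfinish ?P) (pathstart ?P)) 0 = 1" using ends by simp
      have off': "path_image ?P \<inter> \<real>\<^sub>\<le>\<^sub>0 = {}" using off by (auto simp: integrand_cuts_def)
      show "Im (c p) < 0 \<and> 0 < Im (c q)"
        using loop_ends_on_both_sides[OF P off' _ _ w0] neg by simp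
    qed (rule refl)
  qed
qed

end

theorem theorem6:
  fixes \<alpha> :: "real measure" and D :: "real measure measure" and S :: "real set"
    and a t :: real and S\<^sub>t :: "complex set"
  assumes "finite_borel_measure \<alpha>"
    and "S = measure_support \<alpha>" and "bounded S"
    and "a = measure \<alpha> S" and "a > 0"
    and "S\<^sub>t = closure (convex hull ((\<lambda>x. \<i> * of_real t * of_real x) ` S))"
    and "dirichlet_process_law \<alpha> D"
  shows "(\<forall>\<gamma>>0. \<exists>L. has_pv_line_integral (dirichlet_mean_integrand \<alpha> a t) L \<gamma> \<and>
           (\<integral>\<phi>. exp (\<i> * of_real t * of_real (\<integral>x. x \<partial>\<phi>)) \<partial>D) =
             of_real (Gamma a) / (2 * of_real pi * \<i>) * L) \<and>
         (\<forall>c. simple_loop_from_minus_infinity c \<and>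
           (\<forall>z\<in>S\<^sub>t. loop_encircles c z) \<and> S\<^sub>t \<inter> range c = {} \<and>
           (a \<notin> \<nat> \<longrightarrow> range c \<inter> integrand_cuts t S = {}) \<longrightarrow>
           (\<exists>L. has_loop_integral (dirichlet_mean_integrand \<alpha> a t) L c \<and>
             (\<integral>\<phi>. exp (\<i> * of_real t * of_real (\<integral>x. x \<partial>\<phi>)) \<partial>D) =
               of_real (Gamma a) / (2 * of_real pi * \<i>) * L))"
proof -
  interpret \<alpha>: finite_borel_measure \<alpha> by fact
  have op: "open (- S)" and null: "emeasure \<alpha> (- S) = 0"
    unfolding assms(2) using measure_support_complement[OF \<alpha>.M_is_borel] by auto
  have S_sets: "S \<in> sets \<alpha>" "- S \<in> sets \<alpha>"
    using op unfolding \<alpha>.M_is_borel by (auto intro: borel_closed simp: closed_def)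
  have space: "space \<alpha> = UNIV" using sets_eq_imp_space_eq[OF \<alpha>.M_is_borel] by simp
  have AE: "AE x in \<alpha>. x \<in> S"
    by (rule AE_I[of _ _ "- S"]) (use null S_sets in auto)
  have a: "a = measure \<alpha> UNIV"
    unfolding assms(4) measure_def
  proof (rule arg_cong[where f = enn2real], rule emeasure_eq_AE)
    show "AE x in \<alpha>. (x \<in> S) = (x \<in> UNIV)" using AE by simp
    show "UNIV \<in> sets \<alpha>" using sets.top[of \<alpha>] space by simp
  qed (rule S_sets)
  have ne: "S \<noteq> {}" using assms(4,5) by auto
  obtain b where b: "\<And>x. x \<in> S \<Longrightarrow> \<bar>x\<bar> \<le> b" using assms(3) unfolding bounded_iff by auto
  define B where "B = \<bar>b\<bar> + 1"
  have S_B: "S \<subseteq> {- B..<B}"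
  proof
    fix x assume "x \<in> S"
    from b[OF this] show "x \<in> {- B..<B}" by (auto simp: B_def)
  qed
  have "emeasure \<alpha> (- {- B..<B}) \<le> emeasure \<alpha> (- S)"
    using S_B S_sets by (intro emeasure_mono) auto
  then have "measure \<alpha> (- {- B..<B}) = 0" using null by (simp add: measure_def)
  then interpret dirichlet_mean \<alpha> D B S
    using assms a AE op S_B by unfold_locales (auto simp: B_def compact_eq_bounded_closed closed_def)
  have hull: "S\<^sub>t = support_hull t S" by (simp add: assms(6) support_hull_def)
  show ?thesis
    unfolding a hull
  proof (intro conjI allI impI)
    fix \<gamma> :: real assume "0 < \<gamma>"
    then show "\<exists>L. has_pv_line_integral (integrand t) L \<gamma> \<and> characteristic t = of_real (Gamma mass) / (2 * of_real pi * \<i>) * L"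
      by (intro exI[of _ "loop_value t"] conjI has_pv_line_integral_integrand characteristic_eq)
  next
    fix c assume c: "simple_loop_from_minus_infinity c \<and> (\<forall>z\<in>support_hull t S. loop_encircles c z) \<and>
      support_hull t S \<inter> range c = {} \<and> (mass \<notin> \<nat> \<longrightarrow> range c \<inter> integrand_cuts t S = {})"
    have "has_loop_integral (integrand t) (loop_value t) c"
      by (rule has_loop_integral_integrand[OF _ ne]) (use c in blast)+
    then show "\<exists>L. has_loop_integral (integrand t) L c \<and> characteristic t = of_real (Gamma mass) / (2 * of_real pi * \<i>) * L"
      by (intro exI[of _ "loop_value t"] conjI characteristic_eq)
  qed
qed

end
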